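(* For every integer $d\ge13$, the antisymmetric state $\alpha_d=\frac{\mathbb 1-F}{d(d-1)}$ on $\mathbb C^d\otimes\mathbb C^d$ satisfies $$E_{c,\mathrm{ADNE}}(\alpha_d)>E_{d,\mathrm{ADNE}}(\alpha_d).$$ That is, entanglement manipulation is irreversible under asymptotically dually non-entangling operations.
   Context: $F$ is the swap operator, $F|\psi\rangle|\phi\rangle=|\phi\rangle|\psi\rangle$. All Hilbert spaces are finite-dimensional. $\mathcal S=\mathcal S(A\!:\!B)$ is the set of separable states on $AB$ (finite convex combinations of product states); $\mathrm{cone}(\mathcal S)=\{\lambda\sigma:\lambda\ge0,\sigma\in\mathcal S\}$. Generalised robustness: $R^g_{\mathcal S}(\rho)=\min\{r\ge0:\exists\,\sigma\in\mathcal S,\ \rho\le(1+r)\sigma\}$. The adjoint $\Xi^\dagger$ is defined by $\mathrm{Tr}[X\,\Xi(Y)]=\mathrm{Tr}[\Xi^\dagger(X)Y]$. For $\delta\ge0$, $\mathrm{DNE}^g_\delta(AB\to A'B')$ is the set of completely positive trace-preserving maps $\Xi$ with $R^g_{\mathcal S}(\Xi(\sigma))\le\delta$ for all $\sigma\in\mathcal S(A\!:\!B)$ and $\Xi^\dagger(\mathcal S(A'\!:\!B'))\subseteq\mathrm{cone}(\mathcal S(A\!:\!B))$. Let $\Phi_2=|\Phi_2\rangle\langle\Phi_2|$, $|\Phi_2\rangle=\frac1{\sqrt2}(|00\rangle+|11\rangle)$ on a two-qubit system $A_0B_0$; $\Phi_2^{\otimes m}$ is bipartite across $A_0^m:B_0^m$.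 For $\varepsilon\in[0,1)$, $$E^{(1),\varepsilon}_{d,\mathrm{DNE}^g_\delta}(\rho)=\max\Big\{m\in\mathbb N:\inf_{\Theta\in\mathrm{DNE}^g_\delta(AB\to A_0^mB_0^m)}\tfrac12\|\Theta(\rho)-\Phi_2^{\otimes m}\|_1\le\varepsilon\Big\},$$ $$E^{(1),\varepsilon}_{c,\mathrm{DNE}^g_\delta}(\rho)=\min\Big\{m\in\mathbb N:\inf_{\Lambda\in\mathrm{DNE}^g_\delta(A_0^mB_0^m\to AB)}\tfrac12\|\Lambda(\Phi_2^{\otimes m})-\rho\|_1\le\varepsilon\Big\}.$$ For a sequence $\delta_n\ge0$, $E_{d,\mathrm{DNE}^g_{(\delta_n)}}(\rho)=\lim_{\varepsilon\to0^+}\liminf_{n}\frac1nE^{(1),\varepsilon}_{d,\mathrm{DNE}^g_{\delta_n}}(\rho^{\otimes n})$ and $E_{c,\mathrm{DNE}^g_{(\delta_n)}}(\rho)=\lim_{\varepsilon\to0^+}\limsup_{n}\frac1nE^{(1),\varepsilon}_{c,\mathrm{DNE}^g_{\delta_n}}(\rho^{\otimes n})$. $E_{d,\mathrm{ADNE}}(\rho)$ is the supremum of $E_{d,\mathrm{DNE}^g_{(\delta_n)}}(\rho)$, and $E_{c,\mathrm{ADNE}}(\rho)$ the infimum of $E_{c,\mathrm{DNE}^g_{(\delta_n)}}(\rho)$, over all sequences with $\delta_n\ge 0$, $\delta_n\to0$. *)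

theory Defs
  imports
    "Jordan_Normal_Form.Schur_Decomposition"
    "HOL-Library.Extended_Real"
    "HOL-Library.Liminf_Limsup"
begin

text \<open>Operators on $\mathbb{C}^n$ are elements of \<^term>\<open>carrier_mat n n\<close> over the complex numbers.
  On $\mathbb{C}^{a} \otimes \mathbb{C}^{b}$ the basis vector $|x\rangle|y\rangle$ has index
  \<open>x * b + y\<close>.\<close>

definition mtrace :: "complex mat \<Rightarrow> complex" where
  "mtrace X = (\<Sum>i<dim_row X. X $$ (i, i))"

text \<open>In the order on the complex numbers, \<open>0 \<le> z\<close> says that \<open>z\<close> is real and nonnegative.\<close>

definition psd :: "nat \<Rightarrow> complex mat \<Rightarrow> bool" where
  "psd n X \<longleftrightarrow> X \<in> carrier_mat n n \<and> (\<forall>v \<in> carrier_vec n. 0 \<le> (X *\<^sub>v v) \<bullet>c v)"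

definition loewner_le :: "nat \<Rightarrow> complex mat \<Rightarrow> complex mat \<Rightarrow> bool" where
  "loewner_le n X Y \<longleftrightarrow> X \<in> carrier_mat n n \<and> Y \<in> carrier_mat n n \<and> psd n (Y - X)"

definition states :: "nat \<Rightarrow> complex mat set" where
  "states n = {\<rho>. psd n \<rho> \<and> mtrace \<rho> = 1}"

definition psd_sqrt :: "nat \<Rightarrow> complex mat \<Rightarrow> complex mat" where
  "psd_sqrt n X = (THE R. psd n R \<and> R * R = X)"

definition trace_norm :: "complex mat \<Rightarrow> real" where
  "trace_norm X = Re (mtrace (psd_sqrt (dim_col X) (mat_adjoint X * X)))"

definition tensor_vec :: "complex vec \<Rightarrow> complex vec \<Rightarrow> complex vec" where
  "tensor_vec v w = vec (dim_vec v * dim_vec w)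
     (\<lambda>i. v $ (i div dim_vec w) * w $ (i mod dim_vec w))"

definition tensor_mat :: "complex mat \<Rightarrow> complex mat \<Rightarrow> complex mat" where
  "tensor_mat X Y = mat (dim_row X * dim_row Y) (dim_col X * dim_col Y)
     (\<lambda>(i, j). X $$ (i div dim_row Y, j div dim_col Y) * Y $$ (i mod dim_row Y, j mod dim_col Y))"

definition ket_bra :: "complex vec \<Rightarrow> complex mat" where
  "ket_bra v = mat (dim_vec v) (dim_vec v) (\<lambda>(i, j). v $ i * cnj (v $ j))"

text \<open>For operators \<open>X\<close> on $A B$ and \<open>Y\<close> on $C D$, \<open>bip_tensor a b c d X Y\<close> is $X \otimes Y$ as an
  operator on $(A C) \otimes (B D)$, i.e. bipartite across $A C : B D$. The function
  \<open>regroup\<close> sends the index of $|x\rangle|z\rangle|y\rangle|w\rangle$ in $A C B D$ to the index of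
  $|x\rangle|y\rangle|z\rangle|w\rangle$ in $A B C D$; it does not depend on the dimension of $A$.\<close>

definition regroup :: "nat \<Rightarrow> nat \<Rightarrow> nat \<Rightarrow> nat \<Rightarrow> nat" where
  "regroup b c d i =
     (let x = i div (b * d) div c; z = i div (b * d) mod c;
          y = i mod (b * d) div d; w = i mod (b * d) mod d
      in (x * b + y) * (c * d) + (z * d + w))"

definition bip_tensor ::
    "nat \<Rightarrow> nat \<Rightarrow> nat \<Rightarrow> nat \<Rightarrow> complex mat \<Rightarrow> complex mat \<Rightarrow> complex mat" where
  "bip_tensor a b c d X Y = mat ((a * c) * (b * d)) ((a * c) * (b * d))
     (\<lambda>(i, j). tensor_mat X Y $$ (regroup b c d i, regroup b c d j))"

text \<open>\<open>bip_power a b X n\<close> is $X^{\otimes n}$ as an operator on $A^n \otimes B^n$, of dimensions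
  \<open>a ^ n\<close> and \<open>b ^ n\<close>.\<close>

primrec bip_power :: "nat \<Rightarrow> nat \<Rightarrow> complex mat \<Rightarrow> nat \<Rightarrow> complex mat" where
  "bip_power a b X 0 = 1\<^sub>m 1"
| "bip_power a b X (Suc n) = bip_tensor a b (a ^ n) (b ^ n) X (bip_power a b X n)"

lemma div_mod_less:
  fixes i m n :: nat
  assumes "i < m * n"
  shows "i div n < m" "i mod n < n"
proof -
  show "i div n < m" using assms by (simp add: less_mult_imp_div_less)
  have "n > 0" using assms by (cases n) auto
  then show "i mod n < n" by simp
qed

lemma bip_tensor_product:
  assumes X: "X \<in> carrier_mat a a" and Y: "Y \<in> carrier_mat b b"
    and Z: "Z \<in> carrier_mat c c" and W: "W \<in> carrier_mat d d"
  shows "bip_tensor a b c d (tensor_mat X Y) (tensor_mat Z W)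
    = tensor_mat (tensor_mat X Z) (tensor_mat Y W)"
proof (rule eq_matI)
  have flat: "x * n + y < m * n" if "x < m" "y < n" for x y m n :: nat
  proof -
    have "x * n + y < Suc x * n" using that by simp
    also have "\<dots> \<le> m * n" using that by (intro mult_le_mono1) simp
    finally show ?thesis .
  qed
  fix i j
  assume "i < dim_row (tensor_mat (tensor_mat X Z) (tensor_mat Y W))"
    and "j < dim_col (tensor_mat (tensor_mat X Z) (tensor_mat Y W))"
  then have i: "i < (a * c) * (b * d)" and j: "j < (a * c) * (b * d)"
    using X Y Z W by (auto simp: tensor_mat_def)
  have i1: "i div (b * d) div c < a" "i div (b * d) mod c < c"
      "i mod (b * d) div d < b" "i mod (b * d) mod d < d"
      "i div (b * d) < a * c" "i mod (b * d) < b * d"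
    using div_mod_less[OF i] div_mod_less[OF div_mod_less(1)[OF i]]
      div_mod_less[OF div_mod_less(2)[OF i]] by simp_all
  have j1: "j div (b * d) div c < a" "j div (b * d) mod c < c"
      "j mod (b * d) div d < b" "j mod (b * d) mod d < d"
      "j div (b * d) < a * c" "j mod (b * d) < b * d"
    using div_mod_less[OF j] div_mod_less[OF div_mod_less(1)[OF j]]
      div_mod_less[OF div_mod_less(2)[OF j]] by simp_all
  note bi = flat[OF flat[OF i1(1,3)] flat[OF i1(2,4)]]
  note bj = flat[OF flat[OF j1(1,3)] flat[OF j1(2,4)]]
  show "bip_tensor a b c d (tensor_mat X Y) (tensor_mat Z W) $$ (i, j)
      = tensor_mat (tensor_mat X Z) (tensor_mat Y W) $$ (i, j)"
    using X Y Z W i j i1 j1 bi bj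
      flat[OF i1(1,3)] flat[OF i1(2,4)] flat[OF j1(1,3)] flat[OF j1(2,4)]
    by (simp add: bip_tensor_def tensor_mat_def regroup_def Let_def)
qed (use X Y Z W in \<open>auto simp: bip_tensor_def tensor_mat_def\<close>)

text \<open>A convex combination of the states \<open>\<sigma> k\<close> on $A$ tensored with the states \<open>\<tau> k\<close> on $B$,
  summed entrywise because matrices of varying dimension have no type-class addition.\<close>

definition separable :: "nat \<Rightarrow> nat \<Rightarrow> complex mat set" where
  "separable a b = {mat (a * b) (a * b)
       (\<lambda>ij. \<Sum>k<N. complex_of_real (p k) * tensor_mat (\<sigma> k) (\<tau> k) $$ ij)
     | (N::nat) p \<sigma> \<tau>. (\<forall>k<N. 0 \<le> p k \<and> \<sigma> k \<in> states a \<and> \<tau> k \<in> states b)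
         \<and> (\<Sum>k<N. p k) = (1::real)}"

definition cone :: "complex mat set \<Rightarrow> complex mat set" where
  "cone S = {complex_of_real t \<cdot>\<^sub>m \<sigma> | t \<sigma>. 0 \<le> t \<and> \<sigma> \<in> S}"

text \<open>For a state \<open>\<rho>\<close> and positive dimensions the set below is nonempty (take \<open>\<sigma>\<close> maximally
  mixed), and by compactness of the set of separable states the infimum is a minimum.\<close>

definition robustness :: "nat \<Rightarrow> nat \<Rightarrow> complex mat \<Rightarrow> real" where
  "robustness a b \<rho> = Inf {r. 0 \<le> r \<and>
     (\<exists>\<sigma> \<in> separable a b. loewner_le (a * b) \<rho> (complex_of_real (1 + r) \<cdot>\<^sub>m \<sigma>))}"

text \<open>A map on operators is represented by a function on all matrices, of which only the
  restriction to \<^term>\<open>carrier_mat n n\<close> matters.\<close>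

definition linear_map :: "nat \<Rightarrow> nat \<Rightarrow> (complex mat \<Rightarrow> complex mat) \<Rightarrow> bool" where
  "linear_map n m \<Xi> \<longleftrightarrow>
     (\<forall>X \<in> carrier_mat n n. \<Xi> X \<in> carrier_mat m m) \<and>
     (\<forall>X \<in> carrier_mat n n. \<forall>Y \<in> carrier_mat n n. \<Xi> (X + Y) = \<Xi> X + \<Xi> Y) \<and>
     (\<forall>c. \<forall>X \<in> carrier_mat n n. \<Xi> (c \<cdot>\<^sub>m X) = c \<cdot>\<^sub>m \<Xi> X)"

text \<open>\<open>ampliation k n m \<Xi>\<close> is $\mathrm{id}_k \otimes \Xi$: apply \<open>\<Xi>\<close> to each of the \<open>n\<close> by \<open>n\<close> blocks.\<close>

definition ampliation ::
    "nat \<Rightarrow> nat \<Rightarrow> nat \<Rightarrow> (complex mat \<Rightarrow> complex mat) \<Rightarrow> complex mat \<Rightarrow> complex mat" where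
  "ampliation k n m \<Xi> X = mat (k * m) (k * m)
     (\<lambda>(i, j). \<Xi> (mat n n (\<lambda>(x, y). X $$ (i div m * n + x, j div m * n + y))) $$ (i mod m, j mod m))"

definition completely_positive :: "nat \<Rightarrow> nat \<Rightarrow> (complex mat \<Rightarrow> complex mat) \<Rightarrow> bool" where
  "completely_positive n m \<Xi> \<longleftrightarrow> linear_map n m \<Xi> \<and>
     (\<forall>k X. psd (k * n) X \<longrightarrow> psd (k * m) (ampliation k n m \<Xi> X))"

definition trace_preserving :: "nat \<Rightarrow> (complex mat \<Rightarrow> complex mat) \<Rightarrow> bool" where
  "trace_preserving n \<Xi> \<longleftrightarrow> (\<forall>X \<in> carrier_mat n n. mtrace (\<Xi> X) = mtrace X)"

definition adjoint_map ::
    "nat \<Rightarrow> (complex mat \<Rightarrow> complex mat) \<Rightarrow> complex mat \<Rightarrow> complex mat" where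
  "adjoint_map n \<Xi> X = (THE Z. Z \<in> carrier_mat n n \<and>
     (\<forall>Y \<in> carrier_mat n n. mtrace (X * \<Xi> Y) = mtrace (Z * Y)))"

definition DNE ::
    "real \<Rightarrow> nat \<Rightarrow> nat \<Rightarrow> nat \<Rightarrow> nat \<Rightarrow> (complex mat \<Rightarrow> complex mat) set" where
  "DNE \<delta> a b a' b' = {\<Xi>.
     completely_positive (a * b) (a' * b') \<Xi> \<and> trace_preserving (a * b) \<Xi> \<and>
     (\<forall>\<sigma> \<in> separable a b. robustness a' b' (\<Xi> \<sigma>) \<le> \<delta>) \<and>
     adjoint_map (a * b) \<Xi> ` separable a' b' \<subseteq> cone (separable a b)}"

definition Phi2_ket :: "complex vec" where
  "Phi2_ket = complex_of_real (1 / sqrt 2) \<cdot>\<^sub>v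
     (tensor_vec (unit_vec 2 0) (unit_vec 2 0) + tensor_vec (unit_vec 2 1) (unit_vec 2 1))"

definition Phi2 :: "complex mat" where
  "Phi2 = ket_bra Phi2_ket"

text \<open>The maximum and the minimum over \<open>m\<close> are taken in the extended reals, so that an unbounded set
  has maximum \<open>\<infinity>\<close> and an empty set has minimum \<open>\<infinity>\<close>.\<close>

definition distillable_one_shot ::
    "real \<Rightarrow> real \<Rightarrow> nat \<Rightarrow> nat \<Rightarrow> complex mat \<Rightarrow> ereal" where
  "distillable_one_shot \<delta> \<epsilon> a b \<rho> = Sup {ereal (real m) | m.
     (INF \<Theta> \<in> DNE \<delta> a b (2 ^ m) (2 ^ m). 1 / 2 * trace_norm (\<Theta> \<rho> - bip_power 2 2 Phi2 m)) \<le> \<epsilon>}"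

definition cost_one_shot ::
    "real \<Rightarrow> real \<Rightarrow> nat \<Rightarrow> nat \<Rightarrow> complex mat \<Rightarrow> ereal" where
  "cost_one_shot \<delta> \<epsilon> a b \<rho> = Inf {ereal (real m) | m.
     (INF \<Lambda> \<in> DNE \<delta> (2 ^ m) (2 ^ m) a b. 1 / 2 * trace_norm (\<Lambda> (bip_power 2 2 Phi2 m) - \<rho>)) \<le> \<epsilon>}"

definition distillable_rate :: "(nat \<Rightarrow> real) \<Rightarrow> nat \<Rightarrow> nat \<Rightarrow> complex mat \<Rightarrow> ereal" where
  "distillable_rate \<delta> a b \<rho> = Lim (at_right 0) (\<lambda>\<epsilon>::real.
     liminf (\<lambda>n. distillable_one_shot (\<delta> n) \<epsilon> (a ^ n) (b ^ n) (bip_power a b \<rho> n) / ereal (real n)))"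

definition cost_rate :: "(nat \<Rightarrow> real) \<Rightarrow> nat \<Rightarrow> nat \<Rightarrow> complex mat \<Rightarrow> ereal" where
  "cost_rate \<delta> a b \<rho> = Lim (at_right 0) (\<lambda>\<epsilon>::real.
     limsup (\<lambda>n. cost_one_shot (\<delta> n) \<epsilon> (a ^ n) (b ^ n) (bip_power a b \<rho> n) / ereal (real n)))"

definition null_sequences :: "(nat \<Rightarrow> real) set" where
  "null_sequences = {\<delta>. (\<forall>n. 0 \<le> \<delta> n) \<and> \<delta> \<longlonglongrightarrow> 0}"

definition distillable_ADNE :: "nat \<Rightarrow> nat \<Rightarrow> complex mat \<Rightarrow> ereal" where
  "distillable_ADNE a b \<rho> = (SUP \<delta> \<in> null_sequences. distillable_rate \<delta> a b \<rho>)"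

definition cost_ADNE :: "nat \<Rightarrow> nat \<Rightarrow> complex mat \<Rightarrow> ereal" where
  "cost_ADNE a b \<rho> = (INF \<delta> \<in> null_sequences. cost_rate \<delta> a b \<rho>)"

definition swap_op :: "nat \<Rightarrow> complex mat" where
  "swap_op d = mat (d * d) (d * d)
     (\<lambda>(i, j). if i div d = j mod d \<and> i mod d = j div d then 1 else 0)"

lemma swap_op_tensor_vec:
  assumes v: "v \<in> carrier_vec d" and w: "w \<in> carrier_vec d"
  shows "swap_op d *\<^sub>v tensor_vec v w = tensor_vec w v"
proof (rule eq_vecI)
  fix i
  assume "i < dim_vec (tensor_vec w v)"
  then have i: "i < d * d" using v w by (simp add: tensor_vec_def)
  then have lt: "i div d < d" "i mod d < d" by (simp_all add: div_mod_less)
  define k where "k = (i mod d) * d + i div d"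
  have "k < Suc (i mod d) * d" using lt by (simp add: k_def)
  also have "\<dots> \<le> d * d" by (rule mult_le_mono1[OF Suc_leI[OF lt(2)]])
  finally have k: "k < d * d" .
  have kd: "k div d = i mod d" "k mod d = i div d" using lt by (simp_all add: k_def)
  have iff: "i div d = j mod d \<and> i mod d = j div d \<longleftrightarrow> j = k" for j
    using kd div_mult_mod_eq[of j d] by (auto simp: k_def)
  have "(swap_op d *\<^sub>v tensor_vec v w) $ i
      = (\<Sum>j<d * d. (if j = k then 1 else 0) * (v $ (j div d) * w $ (j mod d)))"
    using i v w
    by (simp add: swap_op_def tensor_vec_def scalar_prod_def iff lessThan_atLeast0)
  also have "\<dots> = (\<Sum>j<d * d. if j = k then v $ (j div d) * w $ (j mod d) else 0)"
    by (intro sum.cong) auto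
  also have "\<dots> = v $ (k div d) * w $ (k mod d)" using k by (simp add: sum.delta)
  also have "\<dots> = tensor_vec w v $ i" using i v w by (simp add: tensor_vec_def kd)
  finally show "(swap_op d *\<^sub>v tensor_vec v w) $ i = tensor_vec w v $ i" .
qed (use v w in \<open>simp add: swap_op_def tensor_vec_def\<close>)

definition antisymmetric_state :: "nat \<Rightarrow> complex mat" where
  "antisymmetric_state d =
     (1 / (of_nat d * (of_nat d - 1))) \<cdot>\<^sub>m (1\<^sub>m (d * d) - swap_op d)"

end

(* Let K = 2^m and let \<Phi> be m copies of the Bell state.

   Cost. Since \<Phi> is dominated by the unnormalised classically correlated state, of trace K, an
   almost non-entangling map takes \<Phi> to an operator below about K times a separable state. If it is
   close to the n-th power of the antisymmetric state, its overlap with the n-th power of the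
   antisymmetric projector W is almost 1, whereas separable states have overlap at most (3/4)^(n/2)
   with W. Hence K is at least of order (4/3)^(n/2). The overlap with a product vector is controlled by
   the purity of the reduced state of a vector of (\<Lambda>^2)^n, which is the expectation, on two copies, of
   the n-th power of the transposition F of the two A systems. Purities are nonnegative, so F may be replaced by
   F + 1/4, and F + 1/4 compressed to \<Lambda>^2 \<otimes> \<Lambda>^2 has norm 3/4.

   Distillation. The operator G = K \<Phi> + sum over x \<noteq> y of |xy><xy| is separable up to normalisation,
   so its image under the adjoint map is in the separable cone. On that cone the antisymmetric power is
   dominated by (1 + 2/d)^n times a separable state: take absolute values after partial transposition.
   Hence K is at most of order (1 + 2/d)^n, because separable states have expectation at most 2 in G.

   For d \<ge> 13 one has (1 + 2/d)^2 < 4/3. *)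

theory Submission
  imports Defs
begin


subsection \<open>Spectral theorem\<close>

text \<open>The shift by 1/4 balances a spectrum. On \<Lambda>^2 \<otimes> \<Lambda>^2 the
  compression of F has its eigenvalues between -1, taken on totally antisymmetric tensors, and 1/2.
  The norm of F thus gives no decay; adding 1/4 moves both ends to modulus 3/4. The number 1 + 2/d
  is the trace norm of the partial transpose of the antisymmetric state. Separable operators stay
  positive under partial transposition, so domination on the cone follows from an order between
  partial transposes. For powers this order is proved by an induction that carries both signs at
  once, since the difference alone does not reproduce itself. \<Phi> cannot be pulled back directly:
  the adjoint is controlled on separable operators only. G is the average over diagonal phases of
  one product projector, hence separable, and its expectation in separable states is bounded
  independently of K. The trace norm, the adjoint and the limit in the error are definite
  descriptions, and an infimum of reals is meaningless on the empty set. Hence uniqueness of square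
  roots, existence of adjoints, monotonicity in the error and nonemptiness of \<open>DNE\<close>
  must be proved as well.\<close>

lemma Cauchy_Schwarz_complex_sum:
  fixes a b :: "'i \<Rightarrow> complex"
  shows "(cmod (\<Sum>i\<in>I. a i * b i))\<^sup>2 \<le> (\<Sum>i\<in>I. (cmod (a i))\<^sup>2) * (\<Sum>i\<in>I. (cmod (b i))\<^sup>2)"
proof -
  define A where "A = (\<Sum>i\<in>I. (cmod (a i))\<^sup>2)"
  define B where "B = (\<Sum>i\<in>I. (cmod (b i))\<^sup>2)"
  define S where "S = (\<Sum>i\<in>I. cmod (a i) * cmod (b i))"
  \<comment> \<open>Lagrange's identity for the moduli: this double sum is twice the defect in the
    inequality.\<close>
  have "0 \<le> (\<Sum>i\<in>I. \<Sum>j\<in>I. (cmod (a i) * cmod (b j) - cmod (a j) * cmod (b i))\<^sup>2)"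
    by (intro sum_nonneg) simp
  also have "\<dots> = (\<Sum>i\<in>I. \<Sum>j\<in>I. (cmod (a i))\<^sup>2 * (cmod (b j))\<^sup>2
      + (cmod (b i))\<^sup>2 * (cmod (a j))\<^sup>2 - 2 * ((cmod (a i) * cmod (b i)) * (cmod (a j) * cmod (b j))))"
    by (intro sum.cong refl) (simp add: power2_eq_square algebra_simps)
  also have "\<dots> = A * B + B * A - 2 * (S * S)"
  proof -
    have "A * B = (\<Sum>i\<in>I. \<Sum>j\<in>I. (cmod (a i))\<^sup>2 * (cmod (b j))\<^sup>2)"
      unfolding A_def B_def by (rule sum_product)
    moreover have "B * A = (\<Sum>i\<in>I. \<Sum>j\<in>I. (cmod (b i))\<^sup>2 * (cmod (a j))\<^sup>2)"
      unfolding A_def B_def by (rule sum_product)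
    moreover have "S * S = (\<Sum>i\<in>I. \<Sum>j\<in>I. (cmod (a i) * cmod (b i)) * (cmod (a j) * cmod (b j)))"
      unfolding S_def by (rule sum_product)
    ultimately show ?thesis by (simp only: sum.distrib sum_subtractf sum_distrib_left)
  qed
  finally have "S\<^sup>2 \<le> A * B" by (simp add: power2_eq_square mult.commute[of B A])
  moreover have "cmod (\<Sum>i\<in>I. a i * b i) \<le> S"
    unfolding S_def by (rule order_trans[OF norm_sum]) (simp add: norm_mult)
  then have "(cmod (\<Sum>i\<in>I. a i * b i))\<^sup>2 \<le> S\<^sup>2" by (intro power_mono) simp_all
  ultimately show ?thesis unfolding A_def B_def by linarith
qed

text \<open>Vectors are functions on \<open>nat\<close>, read only below \<open>n\<close>. This
  spares carrier conditions and lets an index of a tensor product be split by \<open>div\<close> and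
  \<open>mod\<close>.\<close>

definition qform :: "nat \<Rightarrow> complex mat \<Rightarrow> (nat \<Rightarrow> complex) \<Rightarrow> complex" where
  "qform n X v = (\<Sum>i<n. \<Sum>j<n. cnj (v i) * X $$ (i, j) * v j)"

lemma qform_vec:
  assumes "X \<in> carrier_mat n n"
  shows "(X *\<^sub>v vec n v) \<bullet>c vec n v = qform n X v"
proof -
  have "(X *\<^sub>v vec n v) \<bullet>c vec n v = (\<Sum>i<n. (\<Sum>j<n. X $$ (i,j) * v j) * cnj (v i))"
    using assms by (simp add: scalar_prod_def lessThan_atLeast0)
  then show ?thesis unfolding qform_def by (simp add: sum_distrib_right sum_distrib_left mult_ac)
qed

lemma psd_iff: "psd n X \<longleftrightarrow> X \<in> carrier_mat n n \<and> (\<forall>v. 0 \<le> qform n X v)"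
proof -
  have "(\<forall>v \<in> carrier_vec n. 0 \<le> (X *\<^sub>v v) \<bullet>c v) \<longleftrightarrow> (\<forall>v. 0 \<le> qform n X v)"
    if X: "X \<in> carrier_mat n n"
  proof
    assume *: "\<forall>v \<in> carrier_vec n. 0 \<le> (X *\<^sub>v v) \<bullet>c v"
    show "\<forall>v. 0 \<le> qform n X v" using * qform_vec[OF X] by (metis vec_carrier)
  next
    assume *: "\<forall>v. 0 \<le> qform n X v"
    show "\<forall>v \<in> carrier_vec n. 0 \<le> (X *\<^sub>v v) \<bullet>c v"
    proof
      fix v :: "complex vec" assume "v \<in> carrier_vec n"
      then have "v = vec n (\<lambda>i. v $ i)" by auto
      then show "0 \<le> (X *\<^sub>v v) \<bullet>c v" using * qform_vec[OF X] by metis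
    qed
  qed
  then show ?thesis unfolding psd_def by blast
qed

definition hermitian :: "nat \<Rightarrow> complex mat \<Rightarrow> bool" where
  "hermitian n X \<longleftrightarrow> X \<in> carrier_mat n n \<and> (\<forall>i<n. \<forall>j<n. cnj (X $$ (j, i)) = X $$ (i, j))"

lemma qform_two:
  assumes "i < n" "j < n" "i \<noteq> j"
  shows "qform n X (\<lambda>k. if k = i then a else if k = j then b else 0) =
    cnj a * X $$ (i,i) * a + cnj a * X $$ (i,j) * b + cnj b * X $$ (j,i) * a + cnj b * X $$ (j,j) * b"
proof -
  let ?v = "\<lambda>k. if k = i then a else if k = j then b else 0"
  have *: "(\<Sum>k<n. ?v k * f k) = a * f i + b * f j" for f
  proof -
    have "(\<Sum>k<n. ?v k * f k) = (\<Sum>k<n. (if k = i then a * f k else 0) + (if k = j then b * f k else 0))"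
      using assms by (intro sum.cong) auto
    then show ?thesis using assms by (simp add: sum.distrib)
  qed
  have "qform n X ?v = cnj (\<Sum>k<n. ?v k * cnj (\<Sum>l<n. ?v l * X $$ (k,l)))"
    unfolding qform_def by (simp add: sum_distrib_left mult_ac)
  also have "\<dots> = cnj (\<Sum>k<n. ?v k * cnj (a * X $$ (k,i) + b * X $$ (k,j)))" by (simp only: *)
  also have "\<dots> = cnj (a * cnj (a * X $$ (i,i) + b * X $$ (i,j)) + b * cnj (a * X $$ (j,i) + b * X $$ (j,j)))"
    by (simp only: *)
  finally show ?thesis by (simp add: algebra_simps)
qed

lemma qform_one:
  assumes "i < n"
  shows "qform n X (\<lambda>k. if k = i then a else 0) = cnj a * X $$ (i,i) * a"
proof -
  let ?v = "\<lambda>k. if k = i then a else 0"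
  have *: "(\<Sum>k<n. ?v k * f k) = a * f i" for f
  proof -
    have "(\<Sum>k<n. ?v k * f k) = (\<Sum>k<n. if k = i then a * f k else 0)" by (intro sum.cong) auto
    then show ?thesis using assms by simp
  qed
  have "qform n X ?v = cnj (\<Sum>k<n. ?v k * cnj (\<Sum>l<n. ?v l * X $$ (k,l)))"
    unfolding qform_def by (simp only: cnj_sum complex_cnj_mult complex_cnj_cnj sum_distrib_left mult_ac)
  also have "\<dots> = cnj (a * cnj (a * X $$ (i,i)))" by (simp only: *)
  finally show ?thesis by (simp add: mult_ac)
qed

text \<open>Polarisation: the form is real on the basis vectors, on \<open>e_i + e_j\<close> and on
  \<open>e_i + \<i> e_j\<close>, which fixes the imaginary and the real part of the off-diagonal
  entries.\<close>

lemma psd_hermitian: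
  assumes "psd n X" shows "hermitian n X"
proof -
  have X: "X \<in> carrier_mat n n" and nn: "0 \<le> qform n X v" for v
    using assms by (auto simp: psd_iff)
  have re: "Im (qform n X v) = 0" for v using nn[of v] by (simp add: less_eq_complex_def)
  have diag: "Im (X $$ (i,i)) = 0" if "i < n" for i
    using re[of "\<lambda>k. if k = i then 1 else 0"] qform_one[OF that, of X 1] by simp
  have "cnj (X $$ (j,i)) = X $$ (i,j)" if "i < n" "j < n" for i j
  proof (cases "i = j")
    case True then show ?thesis using diag[OF that(1)] by (simp add: complex_eq_iff)
  next
    case False
    have 1: "Im (X $$ (i,j)) + Im (X $$ (j,i)) = 0"
      using re[of "\<lambda>k. if k = i then 1 else if k = j then 1 else 0"] qform_two[OF that False, of X 1 1] diag that
      by simp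
    have 2: "Re (X $$ (i,j)) - Re (X $$ (j,i)) = 0"
      using re[of "\<lambda>k. if k = i then 1 else if k = j then \<i> else 0"] qform_two[OF that False, of X 1 \<i>] diag that
      by simp
    show ?thesis using 1 2 by (simp add: complex_eq_iff)
  qed
  then show ?thesis using X by (auto simp: hermitian_def)
qed

lemma mtrace_mult:
  assumes "A \<in> carrier_mat n m" "B \<in> carrier_mat m n"
  shows "mtrace (A * B) = (\<Sum>i<n. \<Sum>j<m. A $$ (i,j) * B $$ (j,i))"
  using assms by (simp add: mtrace_def scalar_prod_def lessThan_atLeast0)

lemma mtrace_commute:
  assumes "A \<in> carrier_mat n m" "B \<in> carrier_mat m n"
  shows "mtrace (A * B) = mtrace (B * A)"
  unfolding mtrace_mult[OF assms] mtrace_mult[OF assms(2,1)]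
  by (subst sum.swap) (simp only: mult.commute)

section \<open>Eigenvectors of a hermitian matrix\<close>

lemma eigenvalue_ne:
  fixes A :: "complex mat"
  assumes A: "A \<in> carrier_mat n n" and t: "mtrace A \<noteq> of_nat n * \<mu>"
  shows "\<exists>k v. k \<noteq> \<mu> \<and> eigenvector A v k"
proof -
  obtain as where cp: "char_poly A = (\<Prod>a\<leftarrow>as. [:- a, 1:])" and len: "length as = n"
    using char_poly_factorized[OF A] by auto
  obtain B P Q where s: "schur_decomposition A as = (B, P, Q)" by (cases "schur_decomposition A as") auto
  from schur_decomposition[OF A cp s] have sim: "similar_mat_wit A B P Q" and d: "diag_mat B = as" by auto
  from similar_mat_witD2[OF A sim] have c: "B \<in> carrier_mat n n" "P \<in> carrier_mat n n" "Q \<in> carrier_mat n n"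
    and QP: "Q * P = 1\<^sub>m n" and AA: "A = P * B * Q" by auto
  have "mtrace A = mtrace (P * (B * Q))" using AA assoc_mult_mat[OF c(2) c(1) c(3)] by simp
  also have "\<dots> = mtrace ((B * Q) * P)" by (rule mtrace_commute[of _ n n]) (use c in auto)
  also have "\<dots> = mtrace B" using assoc_mult_mat[OF c(1) c(3) c(2)] QP c by simp
  also have "\<dots> = sum_list as" unfolding d[symmetric] using c
    by (simp add: mtrace_def diag_mat_def interv_sum_list_conv_sum_set_nat lessThan_atLeast0)
  finally have tr: "mtrace A = sum_list as" .
  have "\<exists>k\<in>set as. k \<noteq> \<mu>"
  proof (rule ccontr)
    assume "\<not> ?thesis"
    then have "as = replicate n \<mu>" using len by (auto intro!: replicate_eqI)
    then have "sum_list as = of_nat n * \<mu>" by (simp add: sum_list_replicate)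
    then show False using t tr by simp
  qed
  then obtain k where k: "k \<in> set as" "k \<noteq> \<mu>" by auto
  have "poly (char_poly A) k = 0" unfolding cp using k(1) by (induct as) auto
  then have "eigenvalue A k" using eigenvalue_root_char_poly[OF A] by simp
  then show ?thesis using k by (auto simp: eigenvalue_def)
qed

text \<open>Deflation: given \<open>m < n\<close> orthonormal eigenvectors, their eigenvalues are all moved to one value
  \<open>\<mu>\<close>, chosen so that by the trace not every eigenvalue of the new matrix is \<open>\<mu>\<close>; an eigenvector for
  any other eigenvalue is orthogonal to the old ones.\<close>

lemma orthonormal_eigenvectors:
  assumes H: "hermitian n A" and "m \<le> n"
  shows "\<exists>e l. (\<forall>k<m. \<forall>i<n. (\<Sum>j<n. A $$ (i,j) * e k j) = complex_of_real (l k) * e k i) \<and>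
     (\<forall>k<m. \<forall>k'<m. (\<Sum>i<n. cnj (e k i) * e k' i) = (if k = k' then 1 else 0))"
  using assms(2)
proof (induct m)
  case 0 then show ?case by simp
next
  case (Suc m)
  then obtain e l where
    ev: "\<forall>k<m. \<forall>i<n. (\<Sum>j<n. A $$ (i,j) * e k j) = complex_of_real (l k) * e k i"
    and on: "\<forall>k<m. \<forall>k'<m. (\<Sum>i<n. cnj (e k i) * e k' i) = (if k = k' then 1 else 0)"
    by auto
  have herm: "\<And>i j. i < n \<Longrightarrow> j < n \<Longrightarrow> cnj (A $$ (j, i)) = A $$ (i, j)" and A: "A \<in> carrier_mat n n"
    using H by (auto simp: hermitian_def)
  have mn: "m < n" using Suc by simp
  define L where "L = (\<Sum>k<m. complex_of_real (l k))"
  \<comment> \<open>The new trace \<open>mtrace A - L + m * \<mu>\<close> equals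
    \<open>n * \<mu>\<close> only if \<mu> is the mean \<open>(mtrace A - L) / (n - m)\<close> of
    the remaining eigenvalues; the \<open>+ 1\<close> rules this out.\<close>
  define \<mu> where "\<mu> = (mtrace A - L) / of_nat (n - m) + 1"
  define B where "B = mat n n (\<lambda>(i,j). A $$ (i,j) + (\<Sum>k<m. (\<mu> - l k) * e k i * cnj (e k j)))"
  have B: "B \<in> carrier_mat n n" by (simp add: B_def)
  have "mtrace B = mtrace A + (\<Sum>i<n. \<Sum>k<m. (\<mu> - l k) * e k i * cnj (e k i))"
    using A by (simp add: mtrace_def B_def sum.distrib)
  also have "(\<Sum>i<n. \<Sum>k<m. (\<mu> - l k) * e k i * cnj (e k i)) = (\<Sum>k<m. (\<mu> - l k) * (\<Sum>i<n. cnj (e k i) * e k i))"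
    by (subst sum.swap) (simp add: sum_distrib_left mult_ac)
  also have "\<dots> = of_nat m * \<mu> - L" using on by (simp add: sum_subtractf L_def)
  finally have trB: "mtrace B = mtrace A - L + of_nat m * \<mu>" by simp
  have "mtrace B \<noteq> of_nat n * \<mu>"
  proof
    assume "mtrace B = of_nat n * \<mu>"
    then have "mtrace A - L = of_nat (n - m) * \<mu>" using trB mn by (simp add: of_nat_diff algebra_simps)
    then show False using mn by (simp add: \<mu>_def field_simps del: of_nat_diff)
  qed
  from eigenvalue_ne[OF B this] obtain \<nu> v where \<nu>: "\<nu> \<noteq> \<mu>" and "eigenvector B v \<nu>" by auto
  then have v: "v \<in> carrier_vec n" "v \<noteq> 0\<^sub>v n" and Bv: "B *\<^sub>v v = \<nu> \<cdot>\<^sub>v v" using B by (auto simp: eigenvector_def)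
  define w where "w = (\<lambda>i. v $ i)"
  have Bw: "(\<Sum>j<n. B $$ (i,j) * w j) = \<nu> * w i" if "i < n" for i
  proof -
    have "(B *\<^sub>v v) $ i = (\<nu> \<cdot>\<^sub>v v) $ i" using Bv by simp
    then show ?thesis using that v B by (simp add: scalar_prod_def lessThan_atLeast0 w_def)
  qed
  define c where "c = (\<lambda>k. \<Sum>j<n. cnj (e k j) * w j)"
  have Bw': "(\<Sum>j<n. B $$ (i,j) * w j) = (\<Sum>j<n. A $$ (i,j) * w j) + (\<Sum>k<m. (\<mu> - l k) * e k i * c k)" if "i < n" for i
  proof -
    have "(\<Sum>j<n. B $$ (i,j) * w j) = (\<Sum>j<n. A $$ (i,j) * w j) + (\<Sum>j<n. \<Sum>k<m. (\<mu> - l k) * e k i * (cnj (e k j) * w j))"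
      using that by (simp add: B_def sum.distrib algebra_simps sum_distrib_left sum_distrib_right)
    also have "(\<Sum>j<n. \<Sum>k<m. (\<mu> - l k) * e k i * (cnj (e k j) * w j)) = (\<Sum>k<m. (\<mu> - l k) * e k i * c k)"
      by (subst sum.swap) (simp add: c_def sum_distrib_left)
    finally show ?thesis .
  qed
  \<comment> \<open>The inner product of \<open>e k\<close> with \<open>B w\<close>, computed in two
    ways, gives \<open>\<nu> * c k = l k * c k + (\<mu> - l k) * c k\<close>, and \<nu> differs from
    \<mu>.\<close>
  have c0: "c k = 0" if k: "k < m" for k
  proof -
    have "\<nu> * c k = (\<Sum>i<n. cnj (e k i) * (\<Sum>j<n. B $$ (i,j) * w j))"
      using Bw by (simp add: c_def sum_distrib_left mult_ac)
    also have "\<dots> = (\<Sum>i<n. cnj (e k i) * (\<Sum>j<n. A $$ (i,j) * w j)) +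
        (\<Sum>i<n. \<Sum>k'<m. (\<mu> - l k') * c k' * (cnj (e k i) * e k' i))"
      using Bw' by (simp add: sum.distrib algebra_simps sum_distrib_left)
    also have "(\<Sum>i<n. cnj (e k i) * (\<Sum>j<n. A $$ (i,j) * w j)) = (\<Sum>j<n. (\<Sum>i<n. cnj (e k i) * A $$ (i,j)) * w j)"
      unfolding sum_distrib_left sum_distrib_right by (subst sum.swap) (simp add: mult_ac)
    also have "\<dots> = (\<Sum>j<n. cnj (\<Sum>i<n. A $$ (j,i) * e k i) * w j)"
      using herm by (intro sum.cong refl) (simp add: mult.commute)
    also have "\<dots> = l k * c k" using ev k by (simp add: c_def sum_distrib_left mult_ac)
    also have "(\<Sum>i<n. \<Sum>k'<m. (\<mu> - l k') * c k' * (cnj (e k i) * e k' i))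
        = (\<Sum>k'<m. (\<mu> - l k') * c k' * (if k = k' then 1 else 0))"
      by (subst sum.swap) (use on k in \<open>simp add: sum_distrib_left[symmetric]\<close>)
    also have "\<dots> = (\<mu> - l k) * c k" using k by (simp add: if_distrib sum.delta cong: if_cong)
    finally have "(\<nu> - \<mu>) * c k = 0" by (simp add: algebra_simps)
    then show ?thesis using \<nu> by simp
  qed
  have Aw: "(\<Sum>j<n. A $$ (i,j) * w j) = \<nu> * w i" if "i < n" for i
    using Bw[OF that] Bw'[OF that] c0 by simp
  define N where "N = (\<Sum>i<n. (cmod (w i))\<^sup>2)"
  have wne: "\<exists>i<n. w i \<noteq> 0" using v by (auto simp: w_def vec_eq_iff)
  then have N: "N > 0" unfolding N_def
    by (auto intro!: sum_pos2)
  have cN: "(\<Sum>i<n. cnj (w i) * w i) = complex_of_real N"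
    unfolding N_def of_real_sum
    by (intro sum.cong refl) (simp add: complex_norm_square mult.commute flip: of_real_power)
  have \<nu>r: "\<nu> = complex_of_real (Re \<nu>)"
  proof -
    have q: "(\<Sum>i<n. cnj (w i) * (\<Sum>j<n. A $$ (i,j) * w j)) = \<nu> * N"
      unfolding cN[symmetric] sum_distrib_left[of \<nu>]
      by (intro sum.cong refl) (simp only: Aw lessThan_iff mult.left_commute)
    have "cnj (\<Sum>i<n. cnj (w i) * (\<Sum>j<n. A $$ (i,j) * w j)) = (\<Sum>i<n. \<Sum>j<n. cnj (w j) * A $$ (j,i) * w i)"
      using herm by (simp add: sum_distrib_left mult_ac)
    also have "\<dots> = (\<Sum>i<n. cnj (w i) * (\<Sum>j<n. A $$ (i,j) * w j))"
      by (subst sum.swap) (simp add: sum_distrib_left mult_ac)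
    finally have "cnj (\<nu> * N) = \<nu> * N" unfolding q .
    then show ?thesis using N by (simp add: complex_eq_iff)
  qed
  define e' where "e' = e(m := (\<lambda>i. w i / sqrt N))"
  define l' where "l' = l(m := Re \<nu>)"
  have 1: "(\<Sum>j<n. A $$ (i,j) * e' k j) = complex_of_real (l' k) * e' k i" if "k < Suc m" "i < n" for k i
  proof (cases "k = m")
    case True
    then show ?thesis using Aw[OF that(2)] \<nu>r by (simp add: e'_def l'_def sum_divide_distrib[symmetric])
  next
    case False then show ?thesis using ev that by (simp add: e'_def l'_def)
  qed
  have new: "(\<Sum>i<n. cnj (e k i) * e' m i) = 0" if "k < m" for k
    using c0[OF that] by (simp add: e'_def c_def sum_divide_distrib[symmetric])
  have 2: "(\<Sum>i<n. cnj (e' k i) * e' k' i) = (if k = k' then 1 else 0)" if k: "k < Suc m" "k' < Suc m" for k k'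
  proof -
    consider "k < m" "k' < m" | "k < m" "k' = m" | "k = m" "k' < m" | "k = m" "k' = m" using k by linarith
    then show ?thesis
    proof cases
      case 1 then show ?thesis using on by (simp add: e'_def)
    next
      case 2 then show ?thesis using new[of k] by (simp add: e'_def)
    next
      case 3
      have "(\<Sum>i<n. cnj (e' k i) * e' k' i) = cnj (\<Sum>i<n. cnj (e' k' i) * e' k i)" by (simp add: mult.commute)
      moreover have "e' k' = e k'" using 3 by (simp add: e'_def)
      ultimately show ?thesis using 3 new[of k'] by simp
    next
      case 4
      have "complex_of_real (sqrt N) * complex_of_real (sqrt N) = N" 
        unfolding of_real_mult[symmetric] using N by simp
      then have "(\<Sum>i<n. cnj (e' m i) * e' m i) = (\<Sum>i<n. cnj (w i) * w i) / complex_of_real N"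
        by (simp add: e'_def sum_divide_distrib)
      then show ?thesis using 4 N cN by simp
    qed
  qed
  show ?case using 1 2 by blast
qed

text \<open>Completeness and the expansion of \<open>A\<close> are bundled with the eigenvector
  equations, so that a resolution of the identity can be inserted entrywise in later sums.\<close>

definition eigenbasis :: "nat \<Rightarrow> complex mat \<Rightarrow> (nat \<Rightarrow> nat \<Rightarrow> complex) \<Rightarrow> (nat \<Rightarrow> real) \<Rightarrow> bool" where
  "eigenbasis n A e l \<longleftrightarrow>
    (\<forall>k<n. \<forall>i<n. (\<Sum>j<n. A $$ (i,j) * e k j) = complex_of_real (l k) * e k i) \<and>
    (\<forall>k<n. \<forall>k'<n. (\<Sum>i<n. cnj (e k i) * e k' i) = (if k = k' then 1 else 0)) \<and>
    (\<forall>i<n. \<forall>j<n. (\<Sum>k<n. e k i * cnj (e k j)) = (if i = j then 1 else 0)) \<and>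
    (\<forall>i<n. \<forall>j<n. A $$ (i,j) = (\<Sum>k<n. complex_of_real (l k) * e k i * cnj (e k j)))"

lemma eigenbasisD:
  assumes "eigenbasis n A e l"
  shows "\<And>k i. k < n \<Longrightarrow> i < n \<Longrightarrow> (\<Sum>j<n. A $$ (i,j) * e k j) = complex_of_real (l k) * e k i"
    and "\<And>k k'. k < n \<Longrightarrow> k' < n \<Longrightarrow> (\<Sum>i<n. cnj (e k i) * e k' i) = (if k = k' then 1 else 0)"
    and "\<And>i j. i < n \<Longrightarrow> j < n \<Longrightarrow> (\<Sum>k<n. e k i * cnj (e k j)) = (if i = j then 1 else 0)"
    and "\<And>i j. i < n \<Longrightarrow> j < n \<Longrightarrow> A $$ (i,j) = (\<Sum>k<n. complex_of_real (l k) * e k i * cnj (e k j))"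
  using assms unfolding eigenbasis_def by blast+

lemma spectral_theorem:
  assumes H: "hermitian n A"
  obtains e l where "eigenbasis n A e l"
proof -
  obtain e l where
    ev: "\<forall>k<n. \<forall>i<n. (\<Sum>j<n. A $$ (i,j) * e k j) = complex_of_real (l k) * e k i"
    and on: "\<forall>k<n. \<forall>k'<n. (\<Sum>i<n. cnj (e k i) * e k' i) = (if k = k' then 1 else 0)"
    using orthonormal_eigenvectors[OF H order_refl] by auto
  define U where "U = mat n n (\<lambda>(i,k). e k i)"
  define V where "V = mat n n (\<lambda>(k,i). cnj (e k i))"
  have U: "U \<in> carrier_mat n n" and V: "V \<in> carrier_mat n n" by (simp_all add: U_def V_def)
  \<comment> \<open>Orthonormality makes \<open>V\<close> a left inverse of \<open>U\<close>. For
    square matrices it is then a right inverse too, and that is completeness.\<close>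
  have "V * U = 1\<^sub>m n"
    by (rule eq_matI) (use on in \<open>auto simp: U_def V_def scalar_prod_def lessThan_atLeast0\<close>)
  then have UV: "U * V = 1\<^sub>m n" by (rule mat_mult_left_right_inverse[OF V U])
  have cm: "(\<Sum>k<n. e k i * cnj (e k j)) = (if i = j then 1 else 0)" if "i < n" "j < n" for i j
  proof -
    have "(U * V) $$ (i,j) = (1\<^sub>m n :: complex mat) $$ (i,j)" using UV by simp
    then show ?thesis using that by (simp add: U_def V_def scalar_prod_def lessThan_atLeast0)
  qed
  have "A $$ (i,j) = (\<Sum>k<n. complex_of_real (l k) * e k i * cnj (e k j))" if "i < n" "j < n" for i j
  proof -
    have "(\<Sum>k<n. complex_of_real (l k) * e k i * cnj (e k j)) = (\<Sum>k<n. (\<Sum>j'<n. A $$ (i,j') * e k j') * cnj (e k j))"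
      using ev that by simp
    also have "\<dots> = (\<Sum>j'<n. A $$ (i,j') * (\<Sum>k<n. e k j' * cnj (e k j)))"
      unfolding sum_distrib_left sum_distrib_right by (subst sum.swap) (simp add: mult_ac)
    also have "\<dots> = (\<Sum>j'<n. if j' = j then A $$ (i,j) else 0)"
      using that by (intro sum.cong refl) (simp add: cm)
    finally show ?thesis using that by simp
  qed
  then show ?thesis using that[of e l] ev on cm unfolding eigenbasis_def by blast
qed


subsection \<open>Square roots and the trace norm\<close>

lemma cnj_mult_self: "cnj z * z = complex_of_real ((cmod z)\<^sup>2)"
  by (metis complex_norm_square mult.commute of_real_power)

lemma sum_cnj_self: "(\<Sum>i\<in>I. cnj (f i) * f i) = complex_of_real (\<Sum>i\<in>I. (cmod (f i))\<^sup>2)"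
  by (simp add: cnj_mult_self)

lemma psd_carrier: "psd n X \<Longrightarrow> X \<in> carrier_mat n n"
  by (simp add: psd_def)

lemma qform_app: "qform n X v = (\<Sum>i<n. cnj (v i) * (\<Sum>j<n. X $$ (i,j) * v j))"
  unfolding qform_def by (simp add: sum_distrib_left mult.assoc)

lemma psd_spectral:
  assumes P: "psd n A"
  obtains e l where "eigenbasis n A e l" "\<forall>k<n. 0 \<le> l k"
proof -
  obtain e l where E: "eigenbasis n A e l" by (rule spectral_theorem[OF psd_hermitian[OF P]])
  have "0 \<le> l k" if k: "k < n" for k
  proof -
    have "qform n A (e k) = (\<Sum>i<n. complex_of_real (l k) * (cnj (e k i) * e k i))"
      unfolding qform_app by (intro sum.cong refl) (simp add: eigenbasisD(1)[OF E k])
    also have "\<dots> = complex_of_real (l k)" using eigenbasisD(2)[OF E k k] by (simp add: sum_distrib_left[symmetric])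
    finally have "qform n A (e k) = complex_of_real (l k)" .
    moreover have "0 \<le> qform n A (e k)" using P by (simp add: psd_iff)
    ultimately show ?thesis by (simp add: less_eq_complex_def)
  qed
  then show ?thesis using that E by blast
qed

text \<open>Spectral decompositions, square roots, Gram matrices and pure products all have this
  shape, so a single formula yields their positivity.\<close>

lemma qform_rank_one_sum:
  "qform n (mat n n (\<lambda>(i,j). \<Sum>k<m. complex_of_real (s k) * e k i * cnj (e k j))) v
    = complex_of_real (\<Sum>k<m. s k * (cmod (\<Sum>i<n. cnj (e k i) * v i))\<^sup>2)"
proof -
  have "qform n (mat n n (\<lambda>(i,j). \<Sum>k<m. complex_of_real (s k) * e k i * cnj (e k j))) v
     = (\<Sum>i<n. \<Sum>j<n. \<Sum>k<m. complex_of_real (s k) * ((cnj (v i) * e k i) * (cnj (e k j) * v j)))"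
    unfolding qform_def by (intro sum.cong refl) (simp add: sum_distrib_left sum_distrib_right mult_ac)
  also have "\<dots> = (\<Sum>i<n. \<Sum>k<m. \<Sum>j<n. complex_of_real (s k) * ((cnj (v i) * e k i) * (cnj (e k j) * v j)))"
    by (intro sum.cong refl sum.swap)
  also have "\<dots> = (\<Sum>k<m. \<Sum>i<n. \<Sum>j<n. complex_of_real (s k) * ((cnj (v i) * e k i) * (cnj (e k j) * v j)))"
    by (rule sum.swap)
  also have "\<dots> = (\<Sum>k<m. complex_of_real (s k) * ((\<Sum>i<n. cnj (v i) * e k i) * (\<Sum>j<n. cnj (e k j) * v j)))"
    by (simp only: sum_product) (simp only: sum_distrib_left)
  also have "\<dots> = (\<Sum>k<m. complex_of_real (s k) * (cnj (\<Sum>i<n. cnj (e k i) * v i) * (\<Sum>j<n. cnj (e k j) * v j)))"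
    by (simp add: mult.commute)
  also have "\<dots> = (\<Sum>k<m. complex_of_real (s k * (cmod (\<Sum>i<n. cnj (e k i) * v i))\<^sup>2))"
    by (simp only: cnj_mult_self of_real_mult)
  finally show ?thesis by (simp only: of_real_sum)
qed

lemma psd_rank_one_sum:
  assumes "\<And>k. k < m \<Longrightarrow> 0 \<le> s k"
  shows "psd n (mat n n (\<lambda>(i,j). \<Sum>k<m. complex_of_real (s k) * e k i * cnj (e k j)))"
proof -
  have "0 \<le> (\<Sum>k<m. s k * (cmod (\<Sum>i<n. cnj (e k i) * v i))\<^sup>2)" for v
    using assms by (intro sum_nonneg mult_nonneg_nonneg) auto
  then show ?thesis unfolding psd_iff qform_rank_one_sum by (simp add: less_eq_complex_def)
qed

text \<open>Uniqueness of the root, needed because \<open>psd_sqrt\<close> is a definite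
  description. The vector \<open>f = R e - s e\<close> satisfies \<open>R f = - s f\<close>, which
  contradicts positivity of \<open>R\<close> for \<open>s > 0\<close> unless \<open>f\<close>
  vanishes. For \<open>s = 0\<close> the squared norm of \<open>R e\<close> is the form of
  \<open>A\<close> at \<open>e\<close>, which is 0.\<close>

lemma psd_sqrt_unique:
  assumes R: "psd n R" "R * R = A"
    and ev: "\<And>i. i < n \<Longrightarrow> (\<Sum>j<n. A $$ (i,j) * e j) = complex_of_real l * e i" and s: "0 \<le> s" "l = s * s"
    and i: "i < n"
  shows "(\<Sum>j<n. R $$ (i,j) * e j) = complex_of_real s * e i"
proof -
  have Rc: "R \<in> carrier_mat n n" using R by (rule_tac psd_carrier)
  have ss: "s * s = l" "0 \<le> s" using s by simp_all
  define g where "g = (\<lambda>i. \<Sum>j<n. R $$ (i,j) * e j)"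
  define f where "f = (\<lambda>i. g i - complex_of_real s * e i)"
  have Rg: "(\<Sum>j<n. R $$ (i,j) * g j) = complex_of_real l * e i" if "i < n" for i
  proof -
    have "(\<Sum>j<n. R $$ (i,j) * g j) = (\<Sum>k<n. (\<Sum>j<n. R $$ (i,j) * R $$ (j,k)) * e k)"
      unfolding g_def sum_distrib_left sum_distrib_right by (subst sum.swap) (simp only: mult.assoc)
    also have "\<dots> = (\<Sum>k<n. A $$ (i,k) * e k)"
      using Rc that unfolding R(2)[symmetric]
      by (intro sum.cong refl) (simp add: scalar_prod_def lessThan_atLeast0)
    finally show ?thesis using ev[OF that] by simp
  qed
  have Rf: "(\<Sum>j<n. R $$ (i,j) * f j) = - complex_of_real s * f i" if "i < n" for i
  proof -
    have "(\<Sum>j<n. R $$ (i,j) * f j) = (\<Sum>j<n. R $$ (i,j) * g j) - complex_of_real s * g i"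
      by (simp add: f_def g_def right_diff_distrib sum_subtractf sum_distrib_left mult_ac)
    also have "\<dots> = complex_of_real (s * s) * e i - complex_of_real s * g i"
      unfolding Rg[OF that] ss(1) ..
    also have "\<dots> = - complex_of_real s * f i" by (simp add: f_def right_diff_distrib)
    finally show ?thesis .
  qed
  define N where "N = (\<Sum>i<n. (cmod (f i))\<^sup>2)"
  have "N = 0"
  proof (cases "s = 0")
    case True
    then have fg: "f = g" and l0: "l = 0" using ss by (auto simp: f_def)
    have "complex_of_real N = (\<Sum>i<n. cnj (g i) * g i)" by (simp only: N_def fg sum_cnj_self)
    also have "\<dots> = (\<Sum>i<n. \<Sum>j<n. cnj (e j) * (cnj (R $$ (i,j)) * g i))"
    proof (intro sum.cong refl)
      fix i
      have "cnj (g i) = (\<Sum>j<n. cnj (e j) * cnj (R $$ (i,j)))" by (simp add: g_def mult.commute)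
      then show "cnj (g i) * g i = (\<Sum>j<n. cnj (e j) * (cnj (R $$ (i,j)) * g i))"
        by (simp add: sum_distrib_right mult.assoc)
    qed
    also have "\<dots> = (\<Sum>j<n. \<Sum>i<n. cnj (e j) * (cnj (R $$ (i,j)) * g i))" by (rule sum.swap)
    also have "\<dots> = (\<Sum>j<n. \<Sum>i<n. cnj (e j) * (R $$ (j,i) * g i))"
      using psd_hermitian[OF R(1)] by (intro sum.cong refl) (simp add: hermitian_def)
    also have "\<dots> = (\<Sum>j<n. cnj (e j) * (\<Sum>i<n. R $$ (j,i) * g i))" by (simp only: sum_distrib_left)
    also have "\<dots> = 0" by (intro sum.neutral ballI) (simp add: Rg l0)
    finally show ?thesis by simp
  next
    case False
    have "qform n R f = (\<Sum>i<n. - complex_of_real s * (cnj (f i) * f i))"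
      unfolding qform_app by (intro sum.cong refl) (simp add: Rf)
    also have "\<dots> = complex_of_real (- s * N)" unfolding N_def sum_distrib_left[symmetric] sum_cnj_self by simp
    finally have "qform n R f = complex_of_real (- s * N)" .
    moreover have "0 \<le> qform n R f" using R(1) by (simp add: psd_iff)
    ultimately have "0 \<le> - s * N" by (simp add: less_eq_complex_def)
    moreover have "N \<ge> 0" by (simp add: N_def sum_nonneg)
    ultimately show ?thesis using ss(2) False by (simp add: mult_le_0_iff)
  qed
  then have "(cmod (f i))\<^sup>2 = 0" unfolding N_def using i by (subst (asm) sum_nonneg_eq_0_iff) auto
  then show ?thesis by (simp add: f_def g_def)
qed

text \<open>The displayed matrix squares to \<open>A\<close> by orthonormality. Any other positive
  root agrees with it on each \<open>e k\<close>, hence everywhere by completeness.\<close>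

lemma psd_sqrt_spectral:
  assumes E: "eigenbasis n A e l"
    and s: "\<And>k. k < n \<Longrightarrow> 0 \<le> s k" "\<And>k. k < n \<Longrightarrow> l k = s k * s k" and A: "A \<in> carrier_mat n n"
  shows "psd_sqrt n A = mat n n (\<lambda>(i,j). \<Sum>k<n. complex_of_real (s k) * e k i * cnj (e k j))" (is "_ = ?R")
  unfolding psd_sqrt_def
proof (rule the_equality)
  note ev = eigenbasisD(1)[OF E] and on = eigenbasisD(2)[OF E] and cm = eigenbasisD(3)[OF E] and de = eigenbasisD(4)[OF E]
  have "?R * ?R = A"
  proof (rule eq_matI)
    fix i j assume "i < dim_row A" "j < dim_col A"
    then have ij: "i < n" "j < n" using A by auto
    have "(?R * ?R) $$ (i,j) = (\<Sum>m<n. (\<Sum>k<n. complex_of_real (s k) * e k i * cnj (e k m)) * (\<Sum>k'<n. complex_of_real (s k') * e k' m * cnj (e k' j)))"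
      using ij by (simp add: scalar_prod_def lessThan_atLeast0)
    also have "\<dots> = (\<Sum>m<n. \<Sum>k<n. \<Sum>k'<n. (s k * s k') * e k i * cnj (e k' j) * (cnj (e k m) * e k' m))"
      unfolding sum_product by (intro sum.cong refl) (simp add: mult_ac)
    also have "\<dots> = (\<Sum>k<n. \<Sum>k'<n. \<Sum>m<n. (s k * s k') * e k i * cnj (e k' j) * (cnj (e k m) * e k' m))"
      by (subst sum.swap) (intro sum.cong refl sum.swap)
    also have "\<dots> = (\<Sum>k<n. \<Sum>k'<n. if k' = k then (s k * s k') * e k i * cnj (e k' j) else 0)"
      by (intro sum.cong refl) (simp add: sum_distrib_left[symmetric] on)
    also have "\<dots> = (\<Sum>k<n. complex_of_real (l k) * e k i * cnj (e k j))"
      by (intro sum.cong refl) (simp add: s(2))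
    finally show "(?R * ?R) $$ (i,j) = A $$ (i,j)" using de[OF ij] by simp
  qed (use A in auto)
  moreover have "psd n ?R" by (rule psd_rank_one_sum) (use s in simp)
  ultimately show "psd n ?R \<and> ?R * ?R = A" by simp
next
  note ev = eigenbasisD(1)[OF E] and cm = eigenbasisD(3)[OF E]
  fix R assume R: "psd n R \<and> R * R = A"
  then have Rc: "R \<in> carrier_mat n n" by (simp add: psd_carrier)
  show "R = ?R"
  proof (rule eq_matI)
    fix i j assume "i < dim_row ?R" "j < dim_col ?R"
    then have ij: "i < n" "j < n" by auto
    have "(\<Sum>k<n. complex_of_real (s k) * e k i * cnj (e k j)) = (\<Sum>k<n. (\<Sum>m<n. R $$ (i,m) * e k m) * cnj (e k j))"
    proof (rule sum.cong[OF refl])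
      fix k assume "k \<in> {..<n}"
      then have k: "k < n" by simp
      have "(\<Sum>m<n. R $$ (i,m) * e k m) = complex_of_real (s k) * e k i"
        by (rule psd_sqrt_unique[of n R A _ "l k" "s k"]) (use R ev[OF k] s[OF k] ij in auto)
      then show "complex_of_real (s k) * e k i * cnj (e k j) = (\<Sum>m<n. R $$ (i,m) * e k m) * cnj (e k j)" by simp
    qed
    also have "\<dots> = (\<Sum>m<n. R $$ (i,m) * (\<Sum>k<n. e k m * cnj (e k j)))"
      unfolding sum_distrib_left sum_distrib_right by (subst sum.swap) (simp only: mult.assoc)
    also have "\<dots> = (\<Sum>m<n. if m = j then R $$ (i,m) else 0)"
      by (intro sum.cong refl) (simp add: cm ij)
    finally show "R $$ (i,j) = ?R $$ (i,j)" using ij by simp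
  qed (use Rc in auto)
qed

section \<open>Duality for the trace norm\<close>

lemma index_mat_adjoint:
  assumes "X \<in> carrier_mat n m" "i < m" "j < n"
  shows "mat_adjoint X $$ (i, j) = cnj (X $$ (j, i))"
  using assms by (simp add: mat_adjoint_def mat_of_rows_index)

definition contraction :: "nat \<Rightarrow> complex mat \<Rightarrow> bool" where
  "contraction n P \<longleftrightarrow> P \<in> carrier_mat n n \<and>
     (\<forall>v. (\<Sum>i<n. (cmod (\<Sum>j<n. P $$ (i,j) * v j))\<^sup>2) \<le> (\<Sum>i<n. (cmod (v i))\<^sup>2))"

text \<open>One half of the duality, without a polar decomposition. In an eigenbasis of the adjoint
  of \<open>X\<close> times \<open>X\<close>, the vectors \<open>h k = X e_k\<close> have squared
  norm \<open>l k\<close>. Each diagonal element of \<open>P X\<close> is therefore at most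
  \<open>sqrt (l k)\<close> in modulus, and these roots add up to the trace norm.\<close>

lemma trace_norm_ge:
  assumes X: "X \<in> carrier_mat n n" and P: "contraction n P"
  shows "cmod (mtrace (P * X)) \<le> trace_norm X"
proof -
  define M where "M = mat_adjoint X * X"
  have ac: "mat_adjoint X \<in> carrier_mat n n" using X unfolding mat_adjoint_def by auto
  have M: "M \<in> carrier_mat n n" unfolding M_def by (rule mult_carrier_mat[OF ac X])
  have Me: "M $$ (i,j) = (\<Sum>k<n. complex_of_real 1 * cnj (X $$ (k,i)) * cnj (cnj (X $$ (k,j))))" if "i < n" "j < n" for i j
    using X ac that index_mat_adjoint[OF X] by (simp add: M_def scalar_prod_def lessThan_atLeast0)
  have "M = mat n n (\<lambda>(i,j). \<Sum>k<n. complex_of_real 1 * cnj (X $$ (k,i)) * cnj (cnj (X $$ (k,j))))"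
    by (rule eq_matI) (use M Me in auto)
  then have "psd n M" using psd_rank_one_sum[of n "\<lambda>_. 1" n "\<lambda>k i. cnj (X $$ (k,i))"] by simp
  then obtain e l where E: "eigenbasis n M e l" and l: "\<forall>k<n. 0 \<le> l k" by (rule psd_spectral)
  have sq: "psd_sqrt n M = mat n n (\<lambda>(i,j). \<Sum>k<n. complex_of_real (sqrt (l k)) * e k i * cnj (e k j))"
    by (rule psd_sqrt_spectral[OF E _ _ M]) (use l in auto)
  have "mtrace (psd_sqrt n M) = (\<Sum>i<n. \<Sum>k<n. complex_of_real (sqrt (l k)) * (cnj (e k i) * e k i))"
    unfolding sq mtrace_def by (simp add: mult_ac)
  also have "\<dots> = (\<Sum>k<n. complex_of_real (sqrt (l k)) * (\<Sum>i<n. cnj (e k i) * e k i))"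
    by (subst sum.swap) (simp only: sum_distrib_left)
  also have "\<dots> = (\<Sum>k<n. complex_of_real (sqrt (l k)))" using eigenbasisD(2)[OF E] by simp
  finally have tn: "trace_norm X = (\<Sum>k<n. sqrt (l k))"
    unfolding trace_norm_def using X by (simp add: M_def)
  define h where "h = (\<lambda>k i. \<Sum>j<n. X $$ (i,j) * e k j)"
  have h: "(\<Sum>i<n. (cmod (h k i))\<^sup>2) = l k" if k: "k < n" for k
  proof -
    have "complex_of_real (\<Sum>i<n. (cmod (h k i))\<^sup>2) = (\<Sum>m<n. cnj (h k m) * h k m)"
      by (simp only: sum_cnj_self)
    also have "\<dots> = (\<Sum>m<n. \<Sum>i<n. \<Sum>j<n. cnj (e k i) * (cnj (X $$ (m,i)) * X $$ (m,j)) * e k j)"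
      unfolding h_def cnj_sum sum_product by (intro sum.cong refl) (simp add: mult_ac)
    also have "\<dots> = (\<Sum>i<n. \<Sum>j<n. \<Sum>m<n. cnj (e k i) * (cnj (X $$ (m,i)) * X $$ (m,j)) * e k j)"
      by (subst sum.swap) (intro sum.cong refl sum.swap)
    also have "\<dots> = (\<Sum>i<n. \<Sum>j<n. cnj (e k i) * (M $$ (i,j) * e k j))"
      by (intro sum.cong refl) (simp add: Me sum_distrib_left[symmetric] sum_distrib_right[symmetric])
    also have "\<dots> = (\<Sum>i<n. cnj (e k i) * (\<Sum>j<n. M $$ (i,j) * e k j))" by (simp only: sum_distrib_left)
    also have "\<dots> = (\<Sum>i<n. complex_of_real (l k) * (cnj (e k i) * e k i))"
      by (intro sum.cong refl) (simp add: eigenbasisD(1)[OF E k])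
    also have "\<dots> = complex_of_real (l k)" using eigenbasisD(2)[OF E k k] by (simp add: sum_distrib_left[symmetric])
    finally show ?thesis by (simp only: of_real_eq_iff)
  qed
  have hX: "(\<Sum>m<n. X $$ (j,m) * (\<Sum>k<n. e k m * cnj (e k i))) = (\<Sum>k<n. h k j * cnj (e k i))" for i j
  proof -
    have "(\<Sum>m<n. X $$ (j,m) * (\<Sum>k<n. e k m * cnj (e k i))) = (\<Sum>m<n. \<Sum>k<n. X $$ (j,m) * e k m * cnj (e k i))"
      by (simp only: sum_distrib_left mult.assoc)
    also have "\<dots> = (\<Sum>k<n. \<Sum>m<n. X $$ (j,m) * e k m * cnj (e k i))" by (rule sum.swap)
    finally show ?thesis by (simp only: h_def sum_distrib_right)
  qed
  have hP: "(\<Sum>j<n. P $$ (i,j) * (\<Sum>k<n. h k j * cnj (e k i))) = (\<Sum>k<n. cnj (e k i) * (\<Sum>j<n. P $$ (i,j) * h k j))" for i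
  proof -
    have "(\<Sum>j<n. P $$ (i,j) * (\<Sum>k<n. h k j * cnj (e k i))) = (\<Sum>j<n. \<Sum>k<n. cnj (e k i) * (P $$ (i,j) * h k j))"
      by (simp only: sum_distrib_left mult_ac)
    also have "\<dots> = (\<Sum>k<n. \<Sum>j<n. cnj (e k i) * (P $$ (i,j) * h k j))" by (rule sum.swap)
    finally show ?thesis by (simp only: sum_distrib_left)
  qed
  have Pc: "P \<in> carrier_mat n n" using P by (simp add: contraction_def)
  have "mtrace (P * X) = (\<Sum>i<n. \<Sum>j<n. P $$ (i,j) * X $$ (j,i))" by (rule mtrace_mult[OF Pc X])
  \<comment> \<open>The resolution of the identity in the eigenbasis is inserted behind
    \<open>X\<close>.\<close>
  also have "\<dots> = (\<Sum>i<n. \<Sum>j<n. P $$ (i,j) * (\<Sum>m<n. X $$ (j,m) * (\<Sum>k<n. e k m * cnj (e k i))))"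
  proof (intro sum.cong refl)
    fix i j assume ij: "i \<in> {..<n}" "j \<in> {..<n}"
    have "(\<Sum>m<n. X $$ (j,m) * (\<Sum>k<n. e k m * cnj (e k i))) = (\<Sum>m<n. if m = i then X $$ (j,m) else 0)"
      using ij by (intro sum.cong refl) (simp add: eigenbasisD(3)[OF E])
    then show "P $$ (i,j) * X $$ (j,i) = P $$ (i,j) * (\<Sum>m<n. X $$ (j,m) * (\<Sum>k<n. e k m * cnj (e k i)))" using ij by simp
  qed
  also have "\<dots> = (\<Sum>i<n. \<Sum>j<n. P $$ (i,j) * (\<Sum>k<n. h k j * cnj (e k i)))"
    by (simp only: hX)
  also have "\<dots> = (\<Sum>i<n. \<Sum>k<n. cnj (e k i) * (\<Sum>j<n. P $$ (i,j) * h k j))"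
    by (simp only: hP)
  also have "\<dots> = (\<Sum>k<n. \<Sum>i<n. cnj (e k i) * (\<Sum>j<n. P $$ (i,j) * h k j))" by (rule sum.swap)
  finally have "mtrace (P * X) = (\<Sum>k<n. \<Sum>i<n. cnj (e k i) * (\<Sum>j<n. P $$ (i,j) * h k j))" .
  then have "cmod (mtrace (P * X)) \<le> (\<Sum>k<n. cmod (\<Sum>i<n. cnj (e k i) * (\<Sum>j<n. P $$ (i,j) * h k j)))"
    by (simp only: norm_sum)
  also have "\<dots> \<le> (\<Sum>k<n. sqrt (l k))"
  proof (rule sum_mono)
    fix k assume "k \<in> {..<n}"
    then have k: "k < n" by simp
    have "(cmod (\<Sum>i<n. cnj (e k i) * (\<Sum>j<n. P $$ (i,j) * h k j)))\<^sup>2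
        \<le> (\<Sum>i<n. (cmod (cnj (e k i)))\<^sup>2) * (\<Sum>i<n. (cmod (\<Sum>j<n. P $$ (i,j) * h k j))\<^sup>2)"
      by (rule Cauchy_Schwarz_complex_sum)
    also have "(\<Sum>i<n. (cmod (cnj (e k i)))\<^sup>2) = 1"
    proof -
      have "complex_of_real (\<Sum>i<n. (cmod (e k i))\<^sup>2) = 1" using eigenbasisD(2)[OF E k k] by (simp only: sum_cnj_self) simp
      then show ?thesis by (simp only: complex_mod_cnj of_real_eq_1_iff)
    qed
    also have "(\<Sum>i<n. (cmod (\<Sum>j<n. P $$ (i,j) * h k j))\<^sup>2) \<le> l k"
      unfolding h[OF k, symmetric] using P by (simp add: contraction_def)
    finally have "(cmod (\<Sum>i<n. cnj (e k i) * (\<Sum>j<n. P $$ (i,j) * h k j)))\<^sup>2 \<le> l k" by simp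
    then show "cmod (\<Sum>i<n. cnj (e k i) * (\<Sum>j<n. P $$ (i,j) * h k j)) \<le> sqrt (l k)"
      by (rule real_le_rsqrt)
  qed
  finally show ?thesis unfolding tn .
qed


subsection \<open>The purity of antisymmetric tensors\<close>

lemma sum_mult_index:
  fixes f :: "nat \<Rightarrow> 'a::comm_monoid_add"
  shows "(\<Sum>i<m * k. f i) = (\<Sum>x<m. \<Sum>i<k. f (x * k + i))"
proof -
  have "(\<Sum>x<m. \<Sum>i<k. f (x * k + i)) = (\<Sum>(x,i)\<in>{..<m} \<times> {..<k}. f (x * k + i))"
    by (rule sum.cartesian_product)
  also have "\<dots> = (\<Sum>i<m * k. f i)"
  proof (rule sum.reindex_bij_witness[where i = "\<lambda>i. (i div k, i mod k)" and j = "\<lambda>(x,i). x * k + i"])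
    fix a assume "a \<in> {..<m} \<times> {..<k}"
    then obtain x i where a: "a = (x,i)" "x < m" "i < k" by auto
    have "x * k + i < Suc x * k" using a by simp
    also have "\<dots> \<le> m * k" using a by (intro mult_le_mono1) simp
    finally show "(case a of (x, i) \<Rightarrow> x * k + i) \<in> {..<m * k}" using a by simp
  qed (use div_mod_less in auto)
  finally show ?thesis ..
qed

text \<open>A quadruple indexes A B C D, where A B is one copy of the bipartite system and C D a
  second copy.\<close>

type_synonym ix4 = "nat \<times> nat \<times> nat \<times> nat"

definition Q4 :: "nat \<Rightarrow> ix4 set" where
  "Q4 N = {..<N} \<times> {..<N} \<times> {..<N} \<times> {..<N}"

fun join4 :: "nat \<Rightarrow> ix4 \<Rightarrow> ix4 \<Rightarrow> ix4" where
  "join4 N (x, y, z, w) (i, j, k, l) = (x * N + i, y * N + j, z * N + k, w * N + l)"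

lemma finite_Q4 [simp]: "finite (Q4 N)" by (simp add: Q4_def)

lemma sum_Q4: "(\<Sum>p\<in>Q4 N. f p) = (\<Sum>i<N. \<Sum>j<N. \<Sum>k<N. \<Sum>l<N. f (i, j, k, l))"
  unfolding Q4_def by (simp only: sum.cartesian_product')

lemma index_less: "x < m \<Longrightarrow> i < k \<Longrightarrow> x * k + i < m * (k::nat)"
proof -
  assume "x < m" "i < k"
  then have "x * k + i < Suc x * k" by simp
  also have "\<dots> \<le> m * k" using \<open>x < m\<close> by (intro mult_le_mono1) simp
  finally show ?thesis .
qed

lemma join4_Q4: "p \<in> Q4 d \<Longrightarrow> q \<in> Q4 N \<Longrightarrow> join4 N p q \<in> Q4 (d * N)"
  by (auto simp: Q4_def index_less)

lemma sum_Q4_join: "(\<Sum>r\<in>Q4 (d * N). f r) = (\<Sum>p\<in>Q4 d. \<Sum>q\<in>Q4 N. f (join4 N p q))"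
proof -
  have "(\<Sum>p\<in>Q4 d. \<Sum>q\<in>Q4 N. f (join4 N p q)) = (\<Sum>(p,q)\<in>Q4 d \<times> Q4 N. f (join4 N p q))"
    by (rule sum.cartesian_product)
  also have "\<dots> = (\<Sum>r\<in>Q4 (d * N). f r)"
    by (rule sum.reindex_bij_witness[where j = "\<lambda>(p,q). join4 N p q" and
      i = "\<lambda>(a,b,c,e). ((a div N, b div N, c div N, e div N), (a mod N, b mod N, c mod N, e mod N))"])
      (auto simp: Q4_def div_mod_less index_less)
  finally show ?thesis ..
qed

fun sAB :: "ix4 \<Rightarrow> ix4" where "sAB (x, y, z, w) = (y, x, z, w)"
fun sCD :: "ix4 \<Rightarrow> ix4" where "sCD (x, y, z, w) = (x, y, w, z)"
fun sAC :: "ix4 \<Rightarrow> ix4" where "sAC (x, y, z, w) = (z, y, x, w)"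
fun sBD :: "ix4 \<Rightarrow> ix4" where "sBD (x, y, z, w) = (x, w, z, y)"
fun sAD :: "ix4 \<Rightarrow> ix4" where "sAD (x, y, z, w) = (w, y, z, x)"
fun sBC :: "ix4 \<Rightarrow> ix4" where "sBC (x, y, z, w) = (x, z, y, w)"

lemma swaps_Q4 [simp]:
  "sAB p \<in> Q4 N \<longleftrightarrow> p \<in> Q4 N" "sCD p \<in> Q4 N \<longleftrightarrow> p \<in> Q4 N" "sAC p \<in> Q4 N \<longleftrightarrow> p \<in> Q4 N"
  "sBD p \<in> Q4 N \<longleftrightarrow> p \<in> Q4 N" "sAD p \<in> Q4 N \<longleftrightarrow> p \<in> Q4 N" "sBC p \<in> Q4 N \<longleftrightarrow> p \<in> Q4 N"
  by (cases p, auto simp: Q4_def)+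

lemma swaps_invol [simp]:
  "sAB (sAB p) = p" "sCD (sCD p) = p" "sAC (sAC p) = p" "sBD (sBD p) = p" "sAD (sAD p) = p" "sBC (sBC p) = p"
  by (cases p, simp)+

lemma sum_Q4_invol:
  assumes "\<And>p. p \<in> Q4 N \<Longrightarrow> s p \<in> Q4 N" "\<And>p. s (s p) = p"
  shows "(\<Sum>p\<in>Q4 N. f (s p)) = (\<Sum>p\<in>Q4 N. f p)"
  by (rule sum.reindex_bij_witness[where i = s and j = s]) (use assms in auto)

text \<open>The ten cross terms are grouped by the values they take below: the overlap
  \<open>t\<close> of \<open>v\<close> with one transposition, the overlap \<open>y\<close> with the
  exchange of the pairs, and \<open>- t\<close>.\<close>

lemma cmod_square_five:
  "(cmod (v + a + b + c + e))\<^sup>2 = (cmod v)\<^sup>2 + (cmod a)\<^sup>2 + (cmod b)\<^sup>2 + (cmod c)\<^sup>2 + (cmod e)\<^sup>2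
    + 2 * (Re (cnj v * a) + Re (cnj v * b) + Re (cnj v * c) + Re (cnj v * e))
    + 2 * (Re (cnj a * b) + Re (cnj c * e))
    + 2 * (Re (cnj a * c) + Re (cnj a * e) + Re (cnj b * c) + Re (cnj b * e))"
  unfolding cmod_power2 by (simp add: power2_eq_square algebra_simps)

text \<open>On tensors antisymmetric in the first and in the second pair, the sum \<open>X\<close> of the four
  transpositions between the pairs satisfies \<open>X\<^sup>2 + 2 X = 4 + 4 Y\<close>, with \<open>Y\<close> the exchange of the two
  pairs. Hence the norm of \<open>(X + 1) v\<close> is at most three times that of \<open>v\<close>.\<close>

lemma transposition_sum_bound:
  fixes v :: "ix4 \<Rightarrow> complex"
  assumes AB: "\<And>p. p \<in> Q4 d \<Longrightarrow> v (sAB p) = - v p" and CD: "\<And>p. p \<in> Q4 d \<Longrightarrow> v (sCD p) = - v p"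
  shows "(\<Sum>p\<in>Q4 d. (cmod (v p + v (sAC p) + v (sBD p) + v (sAD p) + v (sBC p)))\<^sup>2)
    \<le> 9 * (\<Sum>p\<in>Q4 d. (cmod (v p))\<^sup>2)"
proof -
  define ip where "ip = (\<lambda>f g :: ix4 \<Rightarrow> complex. \<Sum>p\<in>Q4 d. Re (cnj (f p) * g p))"
  define s where "s = (\<Sum>p\<in>Q4 d. (cmod (v p))\<^sup>2)"
  define t where "t = ip v (\<lambda>p. v (sAC p))"
  define y where "y = ip v (\<lambda>p. v (sAC (sBD p)))"
  have inv: "ip (\<lambda>p. f (\<sigma> p)) (\<lambda>p. g (\<sigma> p)) = ip f g"
    if "\<And>p. p \<in> Q4 d \<Longrightarrow> \<sigma> p \<in> Q4 d" "\<And>p. \<sigma> (\<sigma> p) = p" for f g \<sigma>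
    unfolding ip_def using sum_Q4_invol[of d \<sigma> "\<lambda>p. Re (cnj (f p) * g p)"] that by simp
  have cong: "ip f g = ip f' g'" if "\<And>p. p \<in> Q4 d \<Longrightarrow> f p = f' p" "\<And>p. p \<in> Q4 d \<Longrightarrow> g p = g' p" for f g f' g'
    unfolding ip_def using that by simp
  have neg: "ip f (\<lambda>p. - g p) = - ip f g" "ip (\<lambda>p. - f p) g = - ip f g" for f g
    unfolding ip_def sum_negf[symmetric] by simp_all
  have nn: "(\<Sum>p\<in>Q4 d. (cmod (v (\<sigma> p)))\<^sup>2) = s"
    if "\<And>p. p \<in> Q4 d \<Longrightarrow> \<sigma> p \<in> Q4 d" "\<And>p. \<sigma> (\<sigma> p) = p" for \<sigma>
    unfolding s_def using sum_Q4_invol[of d \<sigma> "\<lambda>p. (cmod (v p))\<^sup>2"] that by simp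
  \<comment> \<open>Moves \<rho> to the other side of the inner product. The remaining map factors
    as \<kappa> after \<open>\<tau>'\<close>, where \<kappa> multiplies \<open>v\<close> by the
    scalar \<open>c\<close>.\<close>
  have shift: "ip (\<lambda>p. v (\<rho> p)) (\<lambda>p. v (\<tau> p)) = c * ip v (\<lambda>p. v (\<tau>' p))"
    if \<rho>: "\<And>p. p \<in> Q4 d \<Longrightarrow> \<rho> p \<in> Q4 d" "\<And>p. \<rho> (\<rho> p) = p" and \<tau>': "\<And>p. p \<in> Q4 d \<Longrightarrow> \<tau>' p \<in> Q4 d"
      and e: "\<And>p. \<tau> (\<rho> p) = \<kappa> (\<tau>' p)" and \<kappa>: "\<And>p. p \<in> Q4 d \<Longrightarrow> v (\<kappa> p) = complex_of_real c * v p"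
    for \<rho> \<tau> \<tau>' \<kappa> c
  proof -
    have "ip (\<lambda>p. v (\<rho> p)) (\<lambda>p. v (\<tau> p)) = ip (\<lambda>p. v (\<rho> (\<rho> p))) (\<lambda>p. v (\<tau> (\<rho> p)))"
      by (rule inv[OF \<rho>, symmetric])
    also have "\<dots> = ip v (\<lambda>p. complex_of_real c * v (\<tau>' p))"
      by (rule cong) (simp_all only: \<rho>(2) e \<kappa> \<tau>')
    also have "\<dots> = c * ip v (\<lambda>p. v (\<tau>' p))"
      unfolding ip_def sum_distrib_left by (intro sum.cong refl) (simp add: algebra_simps)
    finally show ?thesis .
  qed
  have comp: "sAC (sAB p) = sAB (sBC p)" "sAC (sCD p) = sCD (sAD p)" "sBC (sCD p) = sCD (sBD p)"
      "sBD (sAC p) = sAC (sBD p)" "sBC (sAD p) = sAB (sCD (sAC (sBD p)))" "sAD (sAC p) = sCD (sAD p)"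
      "sBC (sAC p) = sAB (sBC p)" "sAD (sBD p) = sAB (sAD p)" "sBC (sBD p) = sCD (sBC p)" for p
    by (cases p, simp)+
  have minus: "ip (\<lambda>p. v (\<sigma> p)) g = - ip v g" if "\<And>p. p \<in> Q4 d \<Longrightarrow> v (\<sigma> p) = - v p" for \<sigma> g
    using cong[of "\<lambda>p. v (\<sigma> p)" "\<lambda>p. - v p" g g] that neg by simp
  have tBC: "ip v (\<lambda>p. v (sBC p)) = t"
    using shift[of sAB sBC sAC sAB "- 1"] minus[of sAB "\<lambda>p. v (sAC p)"] by (simp add: comp AB t_def)
  have tAD: "ip v (\<lambda>p. v (sAD p)) = t"
    using shift[of sCD sAD sAC sCD "- 1"] minus[of sCD "\<lambda>p. v (sAC p)"] by (simp add: comp CD t_def)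
  have tBD: "ip v (\<lambda>p. v (sBD p)) = t"
    using shift[of sCD sBD sBC sCD "- 1"] minus[of sCD "\<lambda>p. v (sBC p)"] tBC by (simp add: comp CD)
  have yy: "ip (\<lambda>p. v (sAC p)) (\<lambda>p. v (sBD p)) = y"
    using shift[of sAC "\<lambda>p. sAC (sBD p)" sBD "\<lambda>p. p" 1] by (simp add: comp y_def)
  have yy': "ip (\<lambda>p. v (sAD p)) (\<lambda>p. v (sBC p)) = y"
    using shift[of sAD "\<lambda>p. sAC (sBD p)" sBC "\<lambda>p. sAB (sCD p)" 1] by (simp add: comp AB CD y_def)
  \<comment> \<open>Two transpositions with one common index: their product is again a transposition
    between the pairs, up to a factor \<open>sAB\<close> or \<open>sCD\<close>, which contributes
    the sign.\<close>
  have c1: "ip (\<lambda>p. v (sAC p)) (\<lambda>p. v (sAD p)) = - t"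
    using shift[of sAC sAD sAD sCD "- 1"] by (simp add: comp CD tAD)
  have c2: "ip (\<lambda>p. v (sAC p)) (\<lambda>p. v (sBC p)) = - t"
    using shift[of sAC sBC sBC sAB "- 1"] by (simp add: comp AB tBC)
  have c3: "ip (\<lambda>p. v (sBD p)) (\<lambda>p. v (sAD p)) = - t"
    using shift[of sBD sAD sAD sAB "- 1"] by (simp add: comp AB tAD)
  have c4: "ip (\<lambda>p. v (sBD p)) (\<lambda>p. v (sBC p)) = - t"
    using shift[of sBD sBC sBC sCD "- 1"] by (simp add: comp CD tBC)
  have ys: "y \<le> s"
  proof -
    have "0 \<le> (\<Sum>p\<in>Q4 d. (cmod (v p - v (sAC (sBD p))))\<^sup>2)" by (intro sum_nonneg) simp
    also have "\<dots> = (\<Sum>p\<in>Q4 d. (cmod (v p))\<^sup>2 + (cmod (v (sAC (sBD p))))\<^sup>2 - 2 * Re (cnj (v p) * v (sAC (sBD p))))"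
      unfolding cmod_power2 by (intro sum.cong refl) (simp add: power2_eq_square algebra_simps)
    also have "\<dots> = s + s - 2 * y"
      unfolding sum.distrib sum_subtractf y_def ip_def
      by (subst nn[of "\<lambda>p. sAC (sBD p)"]) (auto simp: s_def sum_distrib_left)
    finally show ?thesis by simp
  qed
  have "(\<Sum>p\<in>Q4 d. (cmod (v p + v (sAC p) + v (sBD p) + v (sAD p) + v (sBC p)))\<^sup>2)
     = s + s + s + s + s + 2 * (t + t + t + t) + 2 * (y + y) + 2 * (- t + - t + - t + - t)"
    unfolding cmod_square_five sum.distrib sum_distrib_left[symmetric]
    using tBC tAD tBD yy yy' c1 c2 c3 c4 nn[of sAC] nn[of sBD] nn[of sAD] nn[of sBC] nn[of "\<lambda>p. p"]
    unfolding t_def ip_def by simp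
  also have "\<dots> = 5 * s + 4 * y" by simp
  also have "\<dots> \<le> 9 * s" using ys by simp
  finally show ?thesis by (simp add: s_def)
qed


section \<open>Tensor powers of the shifted sum of transpositions\<close>

primrec asym4 :: "nat \<Rightarrow> nat \<Rightarrow> (ix4 \<Rightarrow> complex) \<Rightarrow> bool" where
  "asym4 d 0 u = True"
| "asym4 d (Suc n) u = (\<forall>p\<in>Q4 d. asym4 d n (\<lambda>q. u (join4 (d ^ n) p q)) \<and>
     (\<forall>q\<in>Q4 (d ^ n). u (join4 (d ^ n) (sAB p) q) = - u (join4 (d ^ n) p q)
        \<and> u (join4 (d ^ n) (sCD p) q) = - u (join4 (d ^ n) p q)))"

lemma asym4_add: "asym4 d n u \<Longrightarrow> asym4 d n v \<Longrightarrow> asym4 d n (\<lambda>q. u q + v q)"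
  by (induct n arbitrary: u v) auto

lemma asym4_scale: "asym4 d n u \<Longrightarrow> asym4 d n (\<lambda>q. c * u q)"
  by (induct n arbitrary: u) auto

definition sym_part :: "(ix4 \<Rightarrow> ix4 \<Rightarrow> complex) \<Rightarrow> ix4 \<Rightarrow> ix4 \<Rightarrow> complex" where
  "sym_part v p q = 1 / 4 * (v p q + v (sAC p) q + v (sBD p) q + v (sAD p) q + v (sBC p) q)"

fun div4 :: "nat \<Rightarrow> ix4 \<Rightarrow> ix4" where "div4 N (a, b, c, e) = (a div N, b div N, c div N, e div N)"
fun mod4 :: "nat \<Rightarrow> ix4 \<Rightarrow> ix4" where "mod4 N (a, b, c, e) = (a mod N, b mod N, c mod N, e mod N)"

lemma div4_join4: "q \<in> Q4 N \<Longrightarrow> div4 N (join4 N p q) = p"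
  by (cases p; cases q) (auto simp: Q4_def)

lemma mod4_join4: "q \<in> Q4 N \<Longrightarrow> mod4 N (join4 N p q) = q"
  by (cases p; cases q) (auto simp: Q4_def)

text \<open>\<open>sym_power d n\<close> is the \<open>n\<close>-fold tensor power of \<open>(X + 1) / 4\<close>; on antisymmetric tensors it has the
  same quadratic form as the power of \<open>F + 1 / 4\<close>, where \<open>F\<close> transposes the first indices of both pairs.\<close>

primrec sym_power :: "nat \<Rightarrow> nat \<Rightarrow> (ix4 \<Rightarrow> complex) \<Rightarrow> ix4 \<Rightarrow> complex" where
  "sym_power d 0 u = u"
| "sym_power d (Suc n) u = (\<lambda>r. sym_power d n (sym_part (\<lambda>p q. u (join4 (d ^ n) p q)) (div4 (d ^ n) r)) (mod4 (d ^ n) r))"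

lemma sym_power_join4:
  "q \<in> Q4 (d ^ n) \<Longrightarrow> sym_power d (Suc n) u (join4 (d ^ n) p q) = sym_power d n (sym_part (\<lambda>p q. u (join4 (d ^ n) p q)) p) q"
  by (simp add: div4_join4 mod4_join4)

text \<open>\<open>sym_part\<close> acts linearly and on the outermost factor only, so antisymmetry
  in the other factors survives.\<close>

lemma asym4_sym_part:
  assumes "asym4 d (Suc n) u" "p \<in> Q4 d"
  shows "asym4 d n (sym_part (\<lambda>p q. u (join4 (d ^ n) p q)) p)"
  unfolding sym_part_def[abs_def] by (intro asym4_scale asym4_add) (use assms in auto)

text \<open>The norm is bounded one factor at a time: the induction hypothesis for each fixed outer
  index, then the one-factor bound \<open>9 / 16\<close>, the square of \<open>3 / 4\<close>, for
  each fixed inner index.\<close>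

lemma sym_power_norm:
  assumes "asym4 d n u"
  shows "(\<Sum>q\<in>Q4 (d ^ n). (cmod (sym_power d n u q))\<^sup>2) \<le> (9 / 16) ^ n * (\<Sum>q\<in>Q4 (d ^ n). (cmod (u q))\<^sup>2)"
  using assms
proof (induct n arbitrary: u)
  case 0 then show ?case by simp
next
  case (Suc n)
  let ?N = "d ^ n"
  let ?u = "\<lambda>p q. u (join4 ?N p q)"
  have "(\<Sum>q\<in>Q4 (d ^ Suc n). (cmod (sym_power d (Suc n) u q))\<^sup>2)
     = (\<Sum>p\<in>Q4 d. \<Sum>q\<in>Q4 ?N. (cmod (sym_power d n (sym_part ?u p) q))\<^sup>2)"
    unfolding power_Suc sum_Q4_join by (intro sum.cong refl) (simp only: sym_power_join4)
  also have "\<dots> \<le> (\<Sum>p\<in>Q4 d. (9 / 16) ^ n * (\<Sum>q\<in>Q4 ?N. (cmod (sym_part ?u p q))\<^sup>2))"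
    by (intro sum_mono Suc.hyps asym4_sym_part Suc.prems)
  also have "\<dots> = (9 / 16) ^ n * (\<Sum>q\<in>Q4 ?N. \<Sum>p\<in>Q4 d. (cmod (sym_part ?u p q))\<^sup>2)"
    by (subst sum.swap) (simp only: sum_distrib_left)
  also have "\<dots> \<le> (9 / 16) ^ n * (\<Sum>q\<in>Q4 ?N. (9 / 16) * (\<Sum>p\<in>Q4 d. (cmod (?u p q))\<^sup>2))"
  proof (intro mult_left_mono sum_mono)
    fix q assume q: "q \<in> Q4 ?N"
    have "(\<Sum>p\<in>Q4 d. (cmod (sym_part ?u p q))\<^sup>2) = (1 / 16) * (\<Sum>p\<in>Q4 d. (cmod (?u p q + ?u (sAC p) q + ?u (sBD p) q + ?u (sAD p) q + ?u (sBC p) q))\<^sup>2)"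
      unfolding sum_distrib_left by (intro sum.cong refl) (simp add: sym_part_def norm_mult norm_divide power_mult_distrib power_divide)
    also have "\<dots> \<le> (1 / 16) * (9 * (\<Sum>p\<in>Q4 d. (cmod (?u p q))\<^sup>2))"
      by (intro mult_left_mono transposition_sum_bound) (use Suc.prems q in auto)
    finally show "(\<Sum>p\<in>Q4 d. (cmod (sym_part ?u p q))\<^sup>2) \<le> (9 / 16) * (\<Sum>p\<in>Q4 d. (cmod (?u p q))\<^sup>2)" by simp
  qed simp
  also have "\<dots> = (9 / 16) ^ Suc n * (\<Sum>p\<in>Q4 d. \<Sum>q\<in>Q4 ?N. (cmod (?u p q))\<^sup>2)"
    unfolding sum.swap[of _ "Q4 d" "Q4 ?N"] sum_distrib_left[symmetric] by simp
  also have "\<dots> = (9 / 16) ^ Suc n * (\<Sum>q\<in>Q4 (d ^ Suc n). (cmod (u q))\<^sup>2)"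
    by (simp only: power_Suc sum_Q4_join)
  finally show ?case .
qed

text \<open>The sesquilinear form of the power of \<open>F + 1 / 4\<close> with F =
  \<open>sAC\<close>, conjugate-linear in the first argument. No symmetrisation enters, so it can be
  compared with a purity.\<close>

primrec swap_form :: "nat \<Rightarrow> nat \<Rightarrow> (ix4 \<Rightarrow> complex) \<Rightarrow> (ix4 \<Rightarrow> complex) \<Rightarrow> complex" where
  "swap_form d 0 u v = cnj (u (0,0,0,0)) * v (0,0,0,0)"
| "swap_form d (Suc n) u v = (\<Sum>p\<in>Q4 d. swap_form d n (\<lambda>q. u (join4 (d ^ n) p q)) (\<lambda>q. v (join4 (d ^ n) (sAC p) q))
     + 1 / 4 * swap_form d n (\<lambda>q. u (join4 (d ^ n) p q)) (\<lambda>q. v (join4 (d ^ n) p q)))"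

lemma swap_form_cong:
  "(\<And>q. q \<in> Q4 (d ^ n) \<Longrightarrow> u q = u' q) \<Longrightarrow> (\<And>q. q \<in> Q4 (d ^ n) \<Longrightarrow> v q = v' q) \<Longrightarrow> swap_form d n u v = swap_form d n u' v'"
proof (induct n arbitrary: u v u' v')
  case 0
  have "(0,0,0,0) \<in> Q4 (d ^ 0)" by (simp add: Q4_def)
  then show ?case using 0[of "(0,0,0,0)"] by simp
next
  case (Suc n)
  show ?case unfolding swap_form.simps
  proof (intro sum.cong refl arg_cong2[where f = "(+)"] arg_cong2[where f = "(*)"])
    fix p assume p: "p \<in> Q4 d"
    show "swap_form d n (\<lambda>q. u (join4 (d ^ n) p q)) (\<lambda>q. v (join4 (d ^ n) (sAC p) q))
        = swap_form d n (\<lambda>q. u' (join4 (d ^ n) p q)) (\<lambda>q. v' (join4 (d ^ n) (sAC p) q))"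
      by (rule Suc.hyps; rule Suc.prems; simp add: join4_Q4 p)
    show "swap_form d n (\<lambda>q. u (join4 (d ^ n) p q)) (\<lambda>q. v (join4 (d ^ n) p q))
        = swap_form d n (\<lambda>q. u' (join4 (d ^ n) p q)) (\<lambda>q. v' (join4 (d ^ n) p q))"
      by (rule Suc.hyps; rule Suc.prems; simp add: join4_Q4 p)
  qed
qed

lemma swap_form_add: "swap_form d n u (\<lambda>q. v q + w q) = swap_form d n u v + swap_form d n u w"
  by (induct n arbitrary: u v w) (simp_all add: distrib_left sum.distrib)

lemma swap_form_scale: "swap_form d n u (\<lambda>q. c * v q) = c * swap_form d n u v"
  by (induct n arbitrary: u v) (simp_all add: distrib_left sum_distrib_left mult_ac)

lemma swap_form_minus: "swap_form d n (\<lambda>q. - u q) (\<lambda>q. - v q) = swap_form d n u v"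
  by (induct n arbitrary: u v) simp_all

text \<open>Reindexing a sum over \<open>p\<close> by \<open>sAB\<close> or \<open>sCD\<close>
  changes the sign of both arguments. All four transpositions between the pairs therefore contribute
  equally, and their average may stand for \<open>sAC\<close>.\<close>

lemma swap_form_eq_sym_power:
  assumes "asym4 d n u" "asym4 d n v"
  shows "swap_form d n u v = (\<Sum>q\<in>Q4 (d ^ n). cnj (u q) * sym_power d n v q)"
  using assms
proof (induct n arbitrary: u v)
  case 0
  have "Q4 (Suc 0) = {(0,0,0,0)}" by (auto simp: Q4_def)
  then show ?case by simp
next
  case (Suc n)
  let ?N = "d ^ n"
  let ?u = "\<lambda>p q. u (join4 ?N p q)" and ?v = "\<lambda>p q. v (join4 ?N p q)"
  define t where "t = (\<Sum>p\<in>Q4 d. swap_form d n (?u p) (?v (sAC p)))"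
  have flip: "(\<Sum>p\<in>Q4 d. swap_form d n (?u p) (?v (\<tau> p))) = (\<Sum>p\<in>Q4 d. swap_form d n (?u p) (?v (\<tau>' p)))"
    if \<sigma>: "\<sigma> = sAB \<or> \<sigma> = sCD" and \<rho>: "\<rho> = sAB \<or> \<rho> = sCD" and e: "\<And>p. \<tau> (\<sigma> p) = \<rho> (\<tau>' p)" and t': "\<And>p. p \<in> Q4 d \<Longrightarrow> \<tau>' p \<in> Q4 d"
    for \<sigma> \<rho> \<tau> \<tau>'
  proof -
    have "(\<Sum>p\<in>Q4 d. swap_form d n (?u p) (?v (\<tau> p))) = (\<Sum>p\<in>Q4 d. swap_form d n (?u (\<sigma> p)) (?v (\<tau> (\<sigma> p))))"
    proof (rule sum_Q4_invol[symmetric])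
      show "\<sigma> p \<in> Q4 d" if "p \<in> Q4 d" for p using \<sigma> that by (elim disjE) simp_all
      show "\<sigma> (\<sigma> p) = p" for p using \<sigma> by (elim disjE) simp_all
    qed
    also have "\<dots> = (\<Sum>p\<in>Q4 d. swap_form d n (\<lambda>q. - ?u p q) (\<lambda>q. - ?v (\<tau>' p) q))"
    proof (intro sum.cong refl swap_form_cong)
      fix p q assume p: "p \<in> Q4 d" and q: "q \<in> Q4 ?N"
      show "?u (\<sigma> p) q = - ?u p q" using \<sigma> Suc.prems(1) p q by auto
      show "?v (\<tau> (\<sigma> p)) q = - ?v (\<tau>' p) q" unfolding e using \<rho> Suc.prems(2) t'[OF p] q by auto
    qed
    finally show ?thesis by (simp only: swap_form_minus)
  qed
  have BC: "(\<Sum>p\<in>Q4 d. swap_form d n (?u p) (?v (sBC p))) = t" unfolding t_def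
    by (rule flip[of sAB sAB]) auto
  have AD: "(\<Sum>p\<in>Q4 d. swap_form d n (?u p) (?v (sAD p))) = t" unfolding t_def
    by (rule flip[of sCD sCD]) auto
  have BD: "(\<Sum>p\<in>Q4 d. swap_form d n (?u p) (?v (sBD p))) = t" unfolding BC[symmetric]
    by (rule flip[of sCD sCD]) auto
  have "(\<Sum>q\<in>Q4 (d ^ Suc n). cnj (u q) * sym_power d (Suc n) v q) = (\<Sum>p\<in>Q4 d. \<Sum>q\<in>Q4 ?N. cnj (?u p q) * sym_power d n (sym_part ?v p) q)"
    unfolding power_Suc sum_Q4_join by (intro sum.cong refl) (simp only: sym_power_join4)
  also have "\<dots> = (\<Sum>p\<in>Q4 d. swap_form d n (?u p) (sym_part ?v p))"
    by (intro sum.cong refl Suc.hyps[symmetric] asym4_sym_part Suc.prems) (use Suc.prems in auto)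
  also have "\<dots> = (\<Sum>p\<in>Q4 d. 1 / 4 * (swap_form d n (?u p) (?v p) + swap_form d n (?u p) (?v (sAC p)) + swap_form d n (?u p) (?v (sBD p))
       + swap_form d n (?u p) (?v (sAD p)) + swap_form d n (?u p) (?v (sBC p))))"
    unfolding sym_part_def[abs_def] by (simp only: swap_form_scale swap_form_add)
  also have "\<dots> = 1 / 4 * ((\<Sum>p\<in>Q4 d. swap_form d n (?u p) (?v p)) + t + t + t + t)"
    unfolding sum_distrib_left[symmetric] sum.distrib BC AD BD t_def[symmetric] ..
  also have "\<dots> = swap_form d (Suc n) u v"
    unfolding swap_form.simps sum.distrib sum_distrib_left[symmetric] t_def by simp
  finally show ?case ..
qed

text \<open>\<open>kernel_form\<close> is the form \<open>swap_form\<close> on product tensors, rearranged as a positive sesquilinear form in the kernels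
  \<open>r \<otimes> cnj p\<close> and \<open>q \<otimes> cnj s\<close>. Dropping the summands \<open>1 / 4\<close> leaves a purity.\<close>

primrec kernel_form :: "nat \<Rightarrow> nat \<Rightarrow> (ix4 \<Rightarrow> complex) \<Rightarrow> (ix4 \<Rightarrow> complex) \<Rightarrow> complex" where
  "kernel_form d 0 Z Z' = Z (0,0,0,0) * cnj (Z' (0,0,0,0))"
| "kernel_form d (Suc n) Z Z' =
    (\<Sum>x<d. \<Sum>z<d. kernel_form d n (\<lambda>q. \<Sum>y<d. Z (join4 (d ^ n) (z,y,x,y) q)) (\<lambda>q. \<Sum>w<d. Z' (join4 (d ^ n) (z,w,x,w) q)))
    + 1 / 4 * kernel_form d n (\<lambda>q. \<Sum>x<d. \<Sum>y<d. Z (join4 (d ^ n) (x,y,x,y) q)) (\<lambda>q. \<Sum>z<d. \<Sum>w<d. Z' (join4 (d ^ n) (z,w,z,w) q))"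

lemma kernel_form_zero: "kernel_form d n (\<lambda>q. 0) Z' = 0" "kernel_form d n Z (\<lambda>q. 0) = 0"
  by (induct n arbitrary: Z Z') simp_all

lemma kernel_form_add_left: "kernel_form d n (\<lambda>q. f q + g q) Z' = kernel_form d n f Z' + kernel_form d n g Z'"
  by (induct n arbitrary: f g Z') (simp_all add: sum.distrib algebra_simps)

lemma kernel_form_add_right: "kernel_form d n Z (\<lambda>q. f q + g q) = kernel_form d n Z f + kernel_form d n Z g"
  by (induct n arbitrary: f g Z) (simp_all add: sum.distrib algebra_simps)

lemma kernel_form_sum_left: "kernel_form d n (\<lambda>q. \<Sum>a<(m::nat). f a q) Z' = (\<Sum>a<m. kernel_form d n (f a) Z')"
  by (induct m) (simp_all add: kernel_form_zero kernel_form_add_left)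

lemma kernel_form_sum_right: "kernel_form d n Z (\<lambda>q. \<Sum>a<(m::nat). f a q) = (\<Sum>a<m. kernel_form d n Z (f a))"
  by (induct m) (simp_all add: kernel_form_zero kernel_form_add_right)

definition ptens :: "(nat \<Rightarrow> nat \<Rightarrow> complex) \<Rightarrow> (nat \<Rightarrow> nat \<Rightarrow> complex) \<Rightarrow> ix4 \<Rightarrow> complex" where
  "ptens p q = (\<lambda>(i, j, k, l). p i j * q k l)"

definition block :: "nat \<Rightarrow> (nat \<Rightarrow> nat \<Rightarrow> complex) \<Rightarrow> nat \<Rightarrow> nat \<Rightarrow> nat \<Rightarrow> nat \<Rightarrow> complex" where
  "block N p x y = (\<lambda>i j. p (x * N + i) (y * N + j))"

lemma ptens_join4: "(\<lambda>r. ptens p q (join4 N (x,y,z,w) r)) = ptens (block N p x y) (block N q z w)"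
  by (auto simp: ptens_def block_def)

text \<open>In the transposed term \<open>y\<close> joins \<open>r\<close> to the conjugate of
  \<open>p\<close> and \<open>w\<close> joins \<open>q\<close> to the conjugate of \<open>s\<close>,
  while \<open>x\<close> and \<open>z\<close> are shared. In the other term the sums decouple into
  two inner products.\<close>

lemma swap_form_ptens:
  "swap_form d n (ptens p q) (ptens r s) = kernel_form d n (ptens r (\<lambda>i j. cnj (p i j))) (ptens q (\<lambda>i j. cnj (s i j)))"
proof (induct n arbitrary: p q r s)
  case 0 then show ?case by (simp add: ptens_def)
next
  case (Suc n)
  let ?c = "\<lambda>p i j. cnj (p i j :: complex)"
  have c: "block N (?c p) x y = ?c (block N p x y)" for N p x y by (simp add: block_def)
  have 1: "swap_form d (Suc n) (ptens p q) (ptens r s) =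
    (\<Sum>x<d. \<Sum>y<d. \<Sum>z<d. \<Sum>w<d. kernel_form d n (ptens (block (d^n) r z y) (?c (block (d^n) p x y))) (ptens (block (d^n) q z w) (?c (block (d^n) s x w))))
    + 1 / 4 * (\<Sum>x<d. \<Sum>y<d. \<Sum>z<d. \<Sum>w<d. kernel_form d n (ptens (block (d^n) r x y) (?c (block (d^n) p x y))) (ptens (block (d^n) q z w) (?c (block (d^n) s z w))))"
    by (simp only: swap_form.simps sum_Q4 sAC.simps ptens_join4 Suc sum.distrib sum_distrib_left)
  have 2: "kernel_form d (Suc n) (ptens r (?c p)) (ptens q (?c s)) =
    (\<Sum>x<d. \<Sum>z<d. \<Sum>y<d. \<Sum>w<d. kernel_form d n (ptens (block (d^n) r z y) (?c (block (d^n) p x y))) (ptens (block (d^n) q z w) (?c (block (d^n) s x w))))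
    + 1 / 4 * (\<Sum>x<d. \<Sum>y<d. \<Sum>z<d. \<Sum>w<d. kernel_form d n (ptens (block (d^n) r x y) (?c (block (d^n) p x y))) (ptens (block (d^n) q z w) (?c (block (d^n) s z w))))"
    by (simp only: kernel_form.simps kernel_form_sum_left kernel_form_sum_right ptens_join4 c)
  have "(\<Sum>x<d. \<Sum>y<d. \<Sum>z<d. G x y z) = (\<Sum>x<d. \<Sum>z<d. \<Sum>y<d. G x y z)" for G :: "nat \<Rightarrow> nat \<Rightarrow> nat \<Rightarrow> complex"
    by (intro sum.cong refl sum.swap)
  then show ?case unfolding 1 2 by simp
qed

text \<open>For the kernel formed from \<open>p\<close> and its conjugate this is the purity of the
  reduced state of \<open>p\<close>.\<close>

definition ptrace_sq :: "nat \<Rightarrow> (ix4 \<Rightarrow> complex) \<Rightarrow> real" where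
  "ptrace_sq N Z = (\<Sum>i<N. \<Sum>k<N. (cmod (\<Sum>j<N. Z (k, j, i, j)))\<^sup>2)"

lemma kernel_form_ge_ptrace_sq: "ptrace_sq (d ^ n) Z \<le> Re (kernel_form d n Z Z)"
proof (induct n arbitrary: Z)
  case 0 then show ?case by (simp add: ptrace_sq_def cmod_power2) (simp add: power2_eq_square)
next
  case (Suc n)
  let ?N = "d ^ n"
  let ?Y = "\<lambda>x z q. \<Sum>y<d. Z (join4 ?N (z,y,x,y) q)"
  have "ptrace_sq (d ^ Suc n) Z = (\<Sum>x<d. \<Sum>i<?N. \<Sum>z<d. \<Sum>k<?N. (cmod (\<Sum>y<d. \<Sum>j<?N. Z (z * ?N + k, y * ?N + j, x * ?N + i, y * ?N + j)))\<^sup>2)"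
    by (simp only: ptrace_sq_def power_Suc sum_mult_index)
  also have "\<dots> = (\<Sum>x<d. \<Sum>z<d. \<Sum>i<?N. \<Sum>k<?N. (cmod (\<Sum>y<d. \<Sum>j<?N. Z (z * ?N + k, y * ?N + j, x * ?N + i, y * ?N + j)))\<^sup>2)"
    by (intro sum.cong refl sum.swap)
  also have "\<dots> = (\<Sum>x<d. \<Sum>z<d. ptrace_sq ?N (?Y x z))"
    by (simp only: ptrace_sq_def join4.simps sum.swap[of _ "{..<?N}" "{..<d}"])
  also have "\<dots> \<le> (\<Sum>x<d. \<Sum>z<d. Re (kernel_form d n (?Y x z) (?Y x z)))"
    by (intro sum_mono Suc)
  also have "\<dots> \<le> (\<Sum>x<d. \<Sum>z<d. Re (kernel_form d n (?Y x z) (?Y x z)))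
      + 1 / 4 * Re (kernel_form d n (\<lambda>q. \<Sum>x<d. \<Sum>y<d. Z (join4 ?N (x,y,x,y) q)) (\<lambda>q. \<Sum>x<d. \<Sum>y<d. Z (join4 ?N (x,y,x,y) q)))"
  proof -
    have "0 \<le> ptrace_sq ?N (\<lambda>q. \<Sum>x<d. \<Sum>y<d. Z (join4 ?N (x,y,x,y) q))"
      unfolding ptrace_sq_def by (intro sum_nonneg) simp
    then show ?thesis using Suc[of "\<lambda>q. \<Sum>x<d. \<Sum>y<d. Z (join4 ?N (x,y,x,y) q)"] by linarith
  qed
  also have "\<dots> = Re (kernel_form d (Suc n) Z Z)" by simp
  finally show ?case .
qed

section \<open>Antisymmetric bipartite tensors\<close>

primrec asym2 :: "nat \<Rightarrow> nat \<Rightarrow> (nat \<Rightarrow> nat \<Rightarrow> complex) \<Rightarrow> bool" where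
  "asym2 d 0 p = True"
| "asym2 d (Suc n) p = (\<forall>x<d. \<forall>y<d. asym2 d n (block (d ^ n) p x y) \<and>
     (\<forall>i<d ^ n. \<forall>j<d ^ n. block (d ^ n) p y x i j = - block (d ^ n) p x y i j))"

lemma asym2_SucD:
  assumes "asym2 d (Suc n) p" "x < d" "y < d"
  shows "asym2 d n (block (d ^ n) p x y)"
    and "i < d ^ n \<Longrightarrow> j < d ^ n \<Longrightarrow> block (d ^ n) p y x i j = - block (d ^ n) p x y i j"
proof -
  note * = assms(1)[unfolded asym2.simps, THEN spec, THEN mp, OF assms(2), THEN spec, THEN mp, OF assms(3)]
  show "asym2 d n (block (d ^ n) p x y)" by (rule conjunct1[OF *])
  show "block (d ^ n) p y x i j = - block (d ^ n) p x y i j" if "i < d ^ n" "j < d ^ n"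
    by (rule conjunct2[OF *, THEN spec, THEN mp, OF that(1), THEN spec, THEN mp, OF that(2)])
qed

lemma asym4_ptens: "asym2 d n p \<Longrightarrow> asym2 d n q \<Longrightarrow> asym4 d n (ptens p q)"
proof (induct n arbitrary: p q)
  case (Suc n)
  show ?case unfolding asym4.simps
  proof (intro ballI conjI)
    fix a assume a: "a \<in> Q4 d"
    obtain x y z w where A: "a = (x,y,z,w)" by (cases a)
    have l: "x < d" "y < d" "z < d" "w < d" using a by (simp_all add: A Q4_def)
    show "asym4 d n (\<lambda>q'. ptens p q (join4 (d ^ n) a q'))"
      unfolding A ptens_join4
      by (intro Suc.hyps asym2_SucD(1)[OF Suc.prems(1)] asym2_SucD(1)[OF Suc.prems(2)] l)
    fix b assume "b \<in> Q4 (d ^ n)"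
    then obtain i j k m where b: "b = (i,j,k,m)" "i < d ^ n" "j < d ^ n" "k < d ^ n" "m < d ^ n"
      by (cases b) (auto simp: Q4_def)
    have "block (d ^ n) p y x i j = - block (d ^ n) p x y i j" "block (d ^ n) q w z k m = - block (d ^ n) q z w k m"
      by (intro asym2_SucD(2)[OF Suc.prems(1)] asym2_SucD(2)[OF Suc.prems(2)] l b(2-5))+
    then show "ptens p q (join4 (d ^ n) (sAB a) b) = - ptens p q (join4 (d ^ n) a b)"
      "ptens p q (join4 (d ^ n) (sCD a) b) = - ptens p q (join4 (d ^ n) a b)"
      by (simp_all add: A b ptens_def block_def)
  qed
qed simp

text \<open>The purity is at most the form of the power of \<open>F + 1 / 4\<close> at
  \<open>p \<otimes> p\<close>. This tensor is antisymmetric within each copy, so the form may be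
  symmetrised; Cauchy-Schwarz then brings in the norm of \<open>sym_power\<close>.\<close>

lemma purity_bound:
  assumes "asym2 d n p"
  shows "(\<Sum>i<d ^ n. \<Sum>k<d ^ n. (cmod (\<Sum>j<d ^ n. p k j * cnj (p i j)))\<^sup>2)
    \<le> (3 / 4) ^ n * (\<Sum>i<d ^ n. \<Sum>j<d ^ n. (cmod (p i j))\<^sup>2)\<^sup>2"
proof -
  define u where "u = ptens p p"
  define S where "S = (\<Sum>i<d ^ n. \<Sum>j<d ^ n. (cmod (p i j))\<^sup>2)"
  have asym: "asym4 d n u" unfolding u_def by (rule asym4_ptens[OF assms assms])
  have nu: "(\<Sum>q\<in>Q4 (d ^ n). (cmod (u q))\<^sup>2) = S\<^sup>2"
  proof -
    have "(\<Sum>q\<in>Q4 (d ^ n). (cmod (u q))\<^sup>2) = (\<Sum>i<d ^ n. \<Sum>j<d ^ n. (cmod (p i j))\<^sup>2 * S)"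
      unfolding sum_Q4 S_def sum_distrib_left by (simp add: u_def ptens_def norm_mult power_mult_distrib)
    then show ?thesis unfolding sum_distrib_right[symmetric] by (simp add: S_def power2_eq_square)
  qed
  have "(\<Sum>i<d ^ n. \<Sum>k<d ^ n. (cmod (\<Sum>j<d ^ n. p k j * cnj (p i j)))\<^sup>2) = ptrace_sq (d ^ n) (ptens p (\<lambda>i j. cnj (p i j)))"
    by (simp add: ptrace_sq_def ptens_def)
  also have "\<dots> \<le> Re (kernel_form d n (ptens p (\<lambda>i j. cnj (p i j))) (ptens p (\<lambda>i j. cnj (p i j))))" by (rule kernel_form_ge_ptrace_sq)
  also have "\<dots> = Re (swap_form d n u u)" by (simp add: u_def swap_form_ptens)
  also have "\<dots> \<le> cmod (swap_form d n u u)" by (rule complex_Re_le_cmod)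
  also have "\<dots> \<le> (3 / 4) ^ n * S\<^sup>2"
  proof (rule power2_le_imp_le)
    have "(cmod (swap_form d n u u))\<^sup>2 \<le> (\<Sum>q\<in>Q4 (d ^ n). (cmod (cnj (u q)))\<^sup>2) * (\<Sum>q\<in>Q4 (d ^ n). (cmod (sym_power d n u q))\<^sup>2)"
      unfolding swap_form_eq_sym_power[OF asym asym] by (rule Cauchy_Schwarz_complex_sum)
    also have "\<dots> \<le> S\<^sup>2 * ((9 / 16) ^ n * S\<^sup>2)"
      using sym_power_norm[OF asym] unfolding nu complex_mod_cnj by (intro mult_left_mono) auto
    also have "\<dots> = ((3 / 4) ^ n * S\<^sup>2)\<^sup>2"
      by (simp add: power2_eq_square power_mult_distrib[symmetric] algebra_simps)
    finally show "(cmod (swap_form d n u u))\<^sup>2 \<le> ((3 / 4) ^ n * S\<^sup>2)\<^sup>2" .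
  qed simp
  finally show ?thesis by (simp add: S_def)
qed

text \<open>Cauchy-Schwarz twice. The first use removes \<open>g\<close> and leaves the squared norm
  \<open>H\<close> of \<open>p\<close> contracted with \<open>f\<close>. The second treats
  \<open>H\<close> as a quadratic form in \<open>f\<close>, whose matrix is the reduced state with
  Hilbert-Schmidt norm given by the purity. Fourth powers avoid square roots.\<close>

lemma overlap_bound:
  assumes "asym2 d n p"
  defines "N \<equiv> d ^ n"
  shows "(cmod (\<Sum>i<N. \<Sum>j<N. f i * g j * p i j)) ^ 4
    \<le> (3 / 4) ^ n * ((\<Sum>i<N. (cmod (f i))\<^sup>2) * (\<Sum>i<N. (cmod (g i))\<^sup>2) * (\<Sum>i<N. \<Sum>j<N. (cmod (p i j))\<^sup>2))\<^sup>2"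
proof -
  define F where "F = (\<Sum>i<N. (cmod (f i))\<^sup>2)"
  define G where "G = (\<Sum>i<N. (cmod (g i))\<^sup>2)"
  define S where "S = (\<Sum>i<N. \<Sum>j<N. (cmod (p i j))\<^sup>2)"
  define h where "h = (\<lambda>j. \<Sum>i<N. f i * p i j)"
  define H where "H = (\<Sum>j<N. (cmod (h j))\<^sup>2)"
  have nn: "0 \<le> F" "0 \<le> G" "0 \<le> H" by (simp_all add: F_def G_def H_def sum_nonneg)
  have "(\<Sum>i<N. \<Sum>j<N. f i * g j * p i j) = (\<Sum>j<N. g j * h j)"
    unfolding h_def sum_distrib_left by (subst sum.swap) (simp only: mult_ac)
  then have 1: "(cmod (\<Sum>i<N. \<Sum>j<N. f i * g j * p i j))\<^sup>2 \<le> G * H"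
    unfolding G_def H_def by (simp only: Cauchy_Schwarz_complex_sum)
  have "complex_of_real H = (\<Sum>j<N. h j * cnj (h j))"
    unfolding H_def of_real_sum by (intro sum.cong refl) (simp add: complex_norm_square flip: of_real_power)
  also have "\<dots> = (\<Sum>j<N. \<Sum>k<N. \<Sum>i<N. (f k * cnj (f i)) * (p k j * cnj (p i j)))"
    unfolding h_def cnj_sum sum_product by (simp add: mult_ac)
  also have "\<dots> = (\<Sum>k<N. \<Sum>j<N. \<Sum>i<N. (f k * cnj (f i)) * (p k j * cnj (p i j)))" by (rule sum.swap)
  also have "\<dots> = (\<Sum>k<N. \<Sum>i<N. \<Sum>j<N. (f k * cnj (f i)) * (p k j * cnj (p i j)))" by (intro sum.cong refl sum.swap)
  also have "\<dots> = (\<Sum>k<N. \<Sum>i<N. (f k * cnj (f i)) * (\<Sum>j<N. p k j * cnj (p i j)))"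
    by (simp only: sum_distrib_left)
  also have "\<dots> = (\<Sum>(k,i)\<in>{..<N}\<times>{..<N}. (f k * cnj (f i)) * (\<Sum>j<N. p k j * cnj (p i j)))"
    by (rule sum.cartesian_product)
  finally have e: "complex_of_real H = (\<Sum>r\<in>{..<N}\<times>{..<N}. (f (fst r) * cnj (f (snd r))) * (\<Sum>j<N. p (fst r) j * cnj (p (snd r) j)))"
    by (simp only: case_prod_unfold)
  have "H\<^sup>2 = (cmod (complex_of_real H))\<^sup>2" by simp
  also have "\<dots> = (cmod (\<Sum>r\<in>{..<N}\<times>{..<N}. (f (fst r) * cnj (f (snd r))) * (\<Sum>j<N. p (fst r) j * cnj (p (snd r) j))))\<^sup>2"
    by (simp only: e)
  also have "\<dots> \<le> (\<Sum>r\<in>{..<N}\<times>{..<N}. (cmod (f (fst r) * cnj (f (snd r))))\<^sup>2) *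
     (\<Sum>r\<in>{..<N}\<times>{..<N}. (cmod (\<Sum>j<N. p (fst r) j * cnj (p (snd r) j)))\<^sup>2)"
    by (rule Cauchy_Schwarz_complex_sum)
  finally have H2: "H\<^sup>2 \<le> (\<Sum>r\<in>{..<N}\<times>{..<N}. (cmod (f (fst r) * cnj (f (snd r))))\<^sup>2) *
     (\<Sum>r\<in>{..<N}\<times>{..<N}. (cmod (\<Sum>j<N. p (fst r) j * cnj (p (snd r) j)))\<^sup>2)" .
  have F2: "(\<Sum>r\<in>{..<N}\<times>{..<N}. (cmod (f (fst r) * cnj (f (snd r))))\<^sup>2) = F\<^sup>2"
  proof -
    have "F\<^sup>2 = (\<Sum>i<N. \<Sum>k<N. (cmod (f i))\<^sup>2 * (cmod (f k))\<^sup>2)"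
      unfolding F_def power2_eq_square[of "sum _ _"] by (rule sum_product)
    then show ?thesis
      by (simp only: sum.cartesian_product case_prod_unfold norm_mult power_mult_distrib complex_mod_cnj)
  qed
  have "(\<Sum>r\<in>{..<N}\<times>{..<N}. (cmod (\<Sum>j<N. p (fst r) j * cnj (p (snd r) j)))\<^sup>2)
      = (\<Sum>k<N. \<Sum>i<N. (cmod (\<Sum>j<N. p k j * cnj (p i j)))\<^sup>2)"
    by (simp only: sum.cartesian_product case_prod_unfold)
  also have "\<dots> = (\<Sum>i<N. \<Sum>k<N. (cmod (\<Sum>j<N. p k j * cnj (p i j)))\<^sup>2)" by (rule sum.swap)
  also have "\<dots> \<le> (3 / 4) ^ n * S\<^sup>2" unfolding S_def N_def by (rule purity_bound[OF assms(1)])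
  finally have "F\<^sup>2 * (\<Sum>r\<in>{..<N}\<times>{..<N}. (cmod (\<Sum>j<N. p (fst r) j * cnj (p (snd r) j)))\<^sup>2)
      \<le> F\<^sup>2 * ((3 / 4) ^ n * S\<^sup>2)" by (intro mult_left_mono) simp_all
  with H2 have 2: "H\<^sup>2 \<le> F\<^sup>2 * ((3 / 4) ^ n * S\<^sup>2)" unfolding F2 by (rule order_trans)
  have "(cmod (\<Sum>i<N. \<Sum>j<N. f i * g j * p i j)) ^ 4 = ((cmod (\<Sum>i<N. \<Sum>j<N. f i * g j * p i j))\<^sup>2)\<^sup>2"
    unfolding power_mult[symmetric] by simp
  also have "\<dots> \<le> (G * H)\<^sup>2" using 1 by (intro power_mono) simp_all
  also have "\<dots> \<le> G\<^sup>2 * (F\<^sup>2 * ((3 / 4) ^ n * S\<^sup>2))"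
    unfolding power_mult_distrib using 2 by (intro mult_left_mono) simp_all
  also have "\<dots> = (3 / 4) ^ n * (F * G * S)\<^sup>2" by (simp add: power_mult_distrib mult_ac)
  finally show ?thesis by (simp add: F_def G_def S_def)
qed


subsection \<open>Bipartite tensor powers\<close>

lemma index_div_mod:
  fixes k :: nat
  assumes "i < k"
  shows "(x * k + i) div k = x" "(x * k + i) mod k = i"
  using assms by simp_all

lemma sum_product4:
  fixes f g :: "nat \<Rightarrow> nat \<Rightarrow> 'a::comm_semiring_0"
  shows "(\<Sum>x<a. \<Sum>y<b. \<Sum>z<c. \<Sum>w<d. f x y * g z w) = (\<Sum>x<a. \<Sum>y<b. f x y) * (\<Sum>z<c. \<Sum>w<d. g z w)"
  by (simp only: sum_distrib_right) (simp only: sum_distrib_left)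

lemma regroup_index:
  assumes "z < c" "y < b" "w < d"
  shows "regroup b c d ((x * c + z) * (b * d) + (y * d + w)) = (x * b + y) * (c * d) + (z * d + w)"
proof -
  have l: "y * d + w < b * d" using assms by (intro index_less)
  show ?thesis
    unfolding regroup_def Let_def index_div_mod[OF l] index_div_mod[OF assms(1)] index_div_mod[OF assms(3)] ..
qed

lemma bip_tensor_carrier [simp]: "bip_tensor a b c d X Y \<in> carrier_mat ((a * c) * (b * d)) ((a * c) * (b * d))"
  by (simp add: bip_tensor_def)

lemma bip_tensor_index:
  assumes "X \<in> carrier_mat (a * b) (a * b)" "Y \<in> carrier_mat (c * d) (c * d)"
    and "x < a" "z < c" "y < b" "w < d" "x' < a" "z' < c" "y' < b" "w' < d"
  shows "bip_tensor a b c d X Y $$ ((x * c + z) * (b * d) + (y * d + w), (x' * c + z') * (b * d) + (y' * d + w'))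
    = X $$ (x * b + y, x' * b + y') * Y $$ (z * d + w, z' * d + w')"
proof -
  have l: "(x * c + z) * (b * d) + (y * d + w) < (a * c) * (b * d)"
    "(x' * c + z') * (b * d) + (y' * d + w') < (a * c) * (b * d)"
    using assms by (intro index_less; simp)+
  have m: "z * d + w < c * d" "z' * d + w' < c * d" "x * b + y < a * b" "x' * b + y' < a * b"
    using assms by (intro index_less; simp)+
  note t = index_less[OF m(3,1)] index_less[OF m(4,2)]
  have "bip_tensor a b c d X Y $$ ((x * c + z) * (b * d) + (y * d + w), (x' * c + z') * (b * d) + (y' * d + w'))
     = tensor_mat X Y $$ ((x * b + y) * (c * d) + (z * d + w), (x' * b + y') * (c * d) + (z' * d + w'))"
    unfolding bip_tensor_def index_mat(1)[OF l] prod.case regroup_index[OF assms(4-6)] regroup_index[OF assms(8-10)] ..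
  also have "\<dots> = X $$ (x * b + y, x' * b + y') * Y $$ (z * d + w, z' * d + w')"
    using assms(1,2) t m by (simp add: tensor_mat_def index_div_mod[OF m(1)] index_div_mod[OF m(2)])
  finally show ?thesis .
qed

text \<open>Every index below the dimension has this mixed-radix form, and on such indices
  \<open>regroup\<close> disappears.\<close>

lemma bip_tensor_eqI:
  assumes "A \<in> carrier_mat ((a * c) * (b * d)) ((a * c) * (b * d))" "B \<in> carrier_mat ((a * c) * (b * d)) ((a * c) * (b * d))"
    and "\<And>x z y w x' z' y' w'. x < a \<Longrightarrow> z < c \<Longrightarrow> y < b \<Longrightarrow> w < d \<Longrightarrow> x' < a \<Longrightarrow> z' < c \<Longrightarrow> y' < b \<Longrightarrow> w' < d \<Longrightarrow>
      A $$ ((x * c + z) * (b * d) + (y * d + w), (x' * c + z') * (b * d) + (y' * d + w'))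
      = B $$ ((x * c + z) * (b * d) + (y * d + w), (x' * c + z') * (b * d) + (y' * d + w'))"
  shows "A = B"
proof (rule eq_matI)
  fix i j assume "i < dim_row B" "j < dim_col B"
  then have ij: "i < (a * c) * (b * d)" "j < (a * c) * (b * d)" using assms by auto
  have e: "i = (i div (b * d) div c * c + i div (b * d) mod c) * (b * d) + (i mod (b * d) div d * d + i mod (b * d) mod d)" for i
    by (simp only: div_mult_mod_eq)
  have l: "i div (b * d) div c < a" "i div (b * d) mod c < c" "i mod (b * d) div d < b" "i mod (b * d) mod d < d"
    if "i < (a * c) * (b * d)" for i
    using div_mod_less[OF div_mod_less(1)[OF that]] div_mod_less[OF div_mod_less(2)[OF that]] by simp_all
  show "A $$ (i, j) = B $$ (i, j)"
    by (subst (1 2) e[of i], subst (1 2) e[of j]) (rule assms(3)[OF l[OF ij(1)] l[OF ij(2)]])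
qed (use assms in auto)

lemma sum_bip_index:
  fixes f :: "nat \<Rightarrow> 'a::comm_monoid_add"
  shows "(\<Sum>i<(a * c) * (b * d). f i)
    = (\<Sum>x<a. \<Sum>y<b. \<Sum>z<c. \<Sum>w<d. f ((x * c + z) * (b * d) + (y * d + w)))"
  unfolding sum_mult_index[of f "a * c"] sum_mult_index[of _ a c] sum_mult_index[of _ b d]
  by (intro sum.cong refl sum.swap)

lemma bip_tensor_mult:
  assumes X: "X \<in> carrier_mat (a * b) (a * b)" "X' \<in> carrier_mat (a * b) (a * b)"
    and Y: "Y \<in> carrier_mat (c * d) (c * d)" "Y' \<in> carrier_mat (c * d) (c * d)"
  shows "bip_tensor a b c d X Y * bip_tensor a b c d X' Y' = bip_tensor a b c d (X * X') (Y * Y')"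
proof (rule bip_tensor_eqI)
  show "bip_tensor a b c d X Y * bip_tensor a b c d X' Y' \<in> carrier_mat ((a * c) * (b * d)) ((a * c) * (b * d))"
    by (rule mult_carrier_mat[of _ _ "a * c * (b * d)"]) simp_all
  fix x z y w x' z' y' w'
  assume i: "x < a" "z < c" "y < b" "w < d" "x' < a" "z' < c" "y' < b" "w' < d"
  let ?I = "(x * c + z) * (b * d) + (y * d + w)" and ?J = "(x' * c + z') * (b * d) + (y' * d + w')"
  have l: "?I < (a * c) * (b * d)" "?J < (a * c) * (b * d)"
    using i by (intro index_less; simp)+
  have m: "z * d + w < c * d" "z' * d + w' < c * d" "x * b + y < a * b" "x' * b + y' < a * b"
    using i by (intro index_less; simp)+
  have "(bip_tensor a b c d X Y * bip_tensor a b c d X' Y') $$ (?I, ?J)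
     = (\<Sum>k<(a * c) * (b * d). bip_tensor a b c d X Y $$ (?I, k) * bip_tensor a b c d X' Y' $$ (k, ?J))"
    using l by (simp add: scalar_prod_def lessThan_atLeast0 bip_tensor_def)
  also have "\<dots> = (\<Sum>x''<a. \<Sum>y''<b. \<Sum>z''<c. \<Sum>w''<d. (X $$ (x * b + y, x'' * b + y'') * Y $$ (z * d + w, z'' * d + w''))
      * (X' $$ (x'' * b + y'', x' * b + y') * Y' $$ (z'' * d + w'', z' * d + w')))"
    unfolding sum_bip_index by (intro sum.cong refl arg_cong2[where f = "(*)"] bip_tensor_index X Y i) simp_all
  also have "\<dots> = (\<Sum>x''<a. \<Sum>y''<b. X $$ (x * b + y, x'' * b + y'') * X' $$ (x'' * b + y'', x' * b + y')) *
      (\<Sum>z''<c. \<Sum>w''<d. Y $$ (z * d + w, z'' * d + w'') * Y' $$ (z'' * d + w'', z' * d + w'))"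
    by (subst sum_product4[symmetric]) (simp only: mult_ac)
  also have "\<dots> = (\<Sum>k<a * b. X $$ (x * b + y, k) * X' $$ (k, x' * b + y')) * (\<Sum>k<c * d. Y $$ (z * d + w, k) * Y' $$ (k, z' * d + w'))"
    by (simp only: sum_mult_index)
  also have "\<dots> = (X * X') $$ (x * b + y, x' * b + y') * (Y * Y') $$ (z * d + w, z' * d + w')"
    using X Y m by (simp add: scalar_prod_def lessThan_atLeast0)
  also have "\<dots> = bip_tensor a b c d (X * X') (Y * Y') $$ (?I, ?J)"
    by (rule bip_tensor_index[symmetric]) (use X Y i in auto)
  finally show "(bip_tensor a b c d X Y * bip_tensor a b c d X' Y') $$ (?I, ?J) = bip_tensor a b c d (X * X') (Y * Y') $$ (?I, ?J)" .
qed simp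

lemma mtrace_bip_tensor:
  assumes X: "X \<in> carrier_mat (a * b) (a * b)" and Y: "Y \<in> carrier_mat (c * d) (c * d)"
  shows "mtrace (bip_tensor a b c d X Y) = mtrace X * mtrace Y"
proof -
  have "mtrace (bip_tensor a b c d X Y) = (\<Sum>x<a. \<Sum>y<b. \<Sum>z<c. \<Sum>w<d. X $$ (x * b + y, x * b + y) * Y $$ (z * d + w, z * d + w))"
  proof -
    have "mtrace (bip_tensor a b c d X Y) = (\<Sum>i<(a * c) * (b * d). bip_tensor a b c d X Y $$ (i, i))"
      by (simp add: mtrace_def bip_tensor_def)
    then show ?thesis unfolding sum_bip_index
      by (simp only:) (intro sum.cong refl bip_tensor_index X Y; simp)
  qed
  also have "\<dots> = (\<Sum>x<a. \<Sum>y<b. X $$ (x * b + y, x * b + y)) * (\<Sum>z<c. \<Sum>w<d. Y $$ (z * d + w, z * d + w))"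
    by (rule sum_product4)
  also have "\<dots> = mtrace X * mtrace Y" using X Y by (simp add: mtrace_def sum_mult_index)
  finally show ?thesis .
qed

lemma bip_power_carrier [simp]: "bip_power a b X n \<in> carrier_mat (a ^ n * b ^ n) (a ^ n * b ^ n)"
  by (cases n) (simp_all add: bip_tensor_def)

lemma bip_power_mult:
  assumes "X \<in> carrier_mat (a * b) (a * b)" "Y \<in> carrier_mat (a * b) (a * b)"
  shows "bip_power a b X n * bip_power a b Y n = bip_power a b (X * Y) n"
  by (induct n) (simp_all add: bip_tensor_mult assms)

lemma mtrace_bip_power:
  assumes "X \<in> carrier_mat (a * b) (a * b)"
  shows "mtrace (bip_power a b X n) = mtrace X ^ n"
proof (induct n)
  case 0 then show ?case by (simp add: mtrace_def)
next
  case (Suc n) then show ?case by (simp add: mtrace_bip_tensor assms)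
qed

lemma bip_power_index:
  assumes "X \<in> carrier_mat (a * b) (a * b)" "x < a" "y < b" "x' < a" "y' < b"
    "i < a ^ n" "j < b ^ n" "i' < a ^ n" "j' < b ^ n"
  shows "bip_power a b X (Suc n) $$ ((x * a ^ n + i) * b ^ Suc n + (y * b ^ n + j), (x' * a ^ n + i') * b ^ Suc n + (y' * b ^ n + j'))
    = X $$ (x * b + y, x' * b + y') * bip_power a b X n $$ (i * b ^ n + j, i' * b ^ n + j')"
  unfolding bip_power.simps(2) power_Suc by (rule bip_tensor_index) (use assms in auto)

lemma hermitian_bip_tensor:
  assumes "hermitian (a * b) X" "hermitian (c * d) Y"
  shows "hermitian ((a * c) * (b * d)) (bip_tensor a b c d X Y)"
proof -
  have X: "X \<in> carrier_mat (a * b) (a * b)" and Y: "Y \<in> carrier_mat (c * d) (c * d)" using assms by (auto simp: hermitian_def)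
  define H where "H = mat ((a * c) * (b * d)) ((a * c) * (b * d)) (\<lambda>(i,j). cnj (bip_tensor a b c d X Y $$ (j,i)))"
  have "H = bip_tensor a b c d X Y"
  proof (rule bip_tensor_eqI)
    fix x z y w x' z' y' w'
    assume i: "x < a" "z < c" "y < b" "w < d" "x' < a" "z' < c" "y' < b" "w' < d"
    let ?I = "(x * c + z) * (b * d) + (y * d + w)" and ?J = "(x' * c + z') * (b * d) + (y' * d + w')"
    have l: "?I < (a * c) * (b * d)" "?J < (a * c) * (b * d)"
      using i by (intro index_less; simp)+
    have m: "z * d + w < c * d" "z' * d + w' < c * d" "x * b + y < a * b" "x' * b + y' < a * b"
      using i by (intro index_less; simp)+
    have "H $$ (?I, ?J) = cnj (bip_tensor a b c d X Y $$ (?J, ?I))" using l by (simp add: H_def)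
    also have "\<dots> = cnj (X $$ (x' * b + y', x * b + y) * Y $$ (z' * d + w', z * d + w))"
      by (rule arg_cong[OF bip_tensor_index[OF X Y i(5,6,7,8) i(1,2,3,4)]])
    also have "\<dots> = X $$ (x * b + y, x' * b + y') * Y $$ (z * d + w, z' * d + w')"
      using assms m by (simp add: hermitian_def)
    also have "\<dots> = bip_tensor a b c d X Y $$ (?I, ?J)" by (rule bip_tensor_index[OF X Y i, symmetric])
    finally show "H $$ (?I, ?J) = bip_tensor a b c d X Y $$ (?I, ?J)" .
  qed (simp_all add: H_def)
  then have "cnj (bip_tensor a b c d X Y $$ (j,i)) = bip_tensor a b c d X Y $$ (i,j)"
    if "i < (a * c) * (b * d)" "j < (a * c) * (b * d)" for i j
    using that by (metis (no_types, lifting) H_def index_mat(1) prod.case)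
  then show ?thesis by (simp add: hermitian_def)
qed

lemma hermitian_bip_power: "hermitian (a * b) X \<Longrightarrow> hermitian (a ^ n * b ^ n) (bip_power a b X n)"
proof (induct n)
  case 0 then show ?case by (simp add: hermitian_def)
next
  case (Suc n) then show ?case by (simp add: hermitian_bip_tensor)
qed

section \<open>Orthogonal projections\<close>

lemma projection_norm:
  assumes H: "hermitian n P" and I: "P * P = P"
  shows "complex_of_real (\<Sum>i<n. (cmod (\<Sum>j<n. P $$ (i,j) * v j))\<^sup>2) = qform n P v"
proof -
  have P: "P \<in> carrier_mat n n" using H by (simp add: hermitian_def)
  let ?g = "\<lambda>i. \<Sum>j<n. P $$ (i,j) * v j"
  have "complex_of_real (\<Sum>i<n. (cmod (?g i))\<^sup>2) = (\<Sum>i<n. cnj (?g i) * ?g i)" by (simp only: sum_cnj_self)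
  also have "\<dots> = (\<Sum>i<n. \<Sum>j<n. cnj (v j) * (P $$ (j,i) * ?g i))"
  proof (intro sum.cong refl)
    fix i assume i: "i \<in> {..<n}"
    have "cnj (?g i) = (\<Sum>j<n. cnj (v j) * P $$ (j,i))"
      unfolding cnj_sum by (intro sum.cong refl) (use H i in \<open>simp add: hermitian_def\<close>)
    then show "cnj (?g i) * ?g i = (\<Sum>j<n. cnj (v j) * (P $$ (j,i) * ?g i))" by (simp only: sum_distrib_right mult.assoc)
  qed
  also have "\<dots> = (\<Sum>j<n. cnj (v j) * (\<Sum>i<n. P $$ (j,i) * ?g i))"
    by (subst sum.swap) (simp only: sum_distrib_left)
  also have "\<dots> = (\<Sum>j<n. cnj (v j) * ?g j)"
  proof (rule sum.cong[OF refl])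
    fix j assume j: "j \<in> {..<n}"
    have "(\<Sum>i<n. P $$ (j,i) * ?g i) = (\<Sum>k<n. (\<Sum>i<n. P $$ (j,i) * P $$ (i,k)) * v k)"
      unfolding sum_distrib_left sum_distrib_right by (subst sum.swap) (simp only: mult.assoc)
    also have "\<dots> = (\<Sum>k<n. (P * P) $$ (j,k) * v k)"
      by (intro sum.cong refl) (use P j in \<open>simp add: scalar_prod_def lessThan_atLeast0\<close>)
    finally show "cnj (v j) * (\<Sum>i<n. P $$ (j,i) * ?g i) = cnj (v j) * ?g j" by (simp only: I)
  qed
  finally show ?thesis by (simp only: qform_app)
qed

lemma projection_contraction:
  assumes H: "hermitian n P" and I: "P * P = P"
  shows "contraction n P"
proof -
  have "(\<Sum>i<n. (cmod (\<Sum>j<n. P $$ (i,j) * v j))\<^sup>2) \<le> (\<Sum>i<n. (cmod (v i))\<^sup>2)" for v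
  proof -
    let ?g = "\<lambda>i. \<Sum>j<n. P $$ (i,j) * v j"
    define A where "A = (\<Sum>i<n. (cmod (?g i))\<^sup>2)"
    define B where "B = (\<Sum>i<n. (cmod (v i))\<^sup>2)"
    have nn: "0 \<le> A" "0 \<le> B" by (simp_all add: A_def B_def sum_nonneg)
    then have "A = cmod (complex_of_real A)" by simp
    also have "\<dots> = cmod (\<Sum>i<n. cnj (v i) * ?g i)" unfolding A_def projection_norm[OF assms] qform_app ..
    finally have e: "A = cmod (\<Sum>i<n. cnj (v i) * ?g i)" .
    have "A\<^sup>2 \<le> (\<Sum>i<n. (cmod (cnj (v i)))\<^sup>2) * (\<Sum>i<n. (cmod (?g i))\<^sup>2)"
      by (subst e) (rule Cauchy_Schwarz_complex_sum)
    then have "A * A \<le> B * A" by (simp add: A_def B_def power2_eq_square)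
    with nn have "A \<le> B" by (cases "A = 0") simp_all
    then show ?thesis by (simp add: A_def B_def)
  qed
  then show ?thesis using H by (auto simp: contraction_def hermitian_def)
qed


subsection \<open>The cone of separable operators\<close>

definition pure_product :: "nat \<Rightarrow> nat \<Rightarrow> (nat \<Rightarrow> complex) \<Rightarrow> (nat \<Rightarrow> complex) \<Rightarrow> complex mat" where
  "pure_product a b f g = mat (a * b) (a * b)
     (\<lambda>(i, j). f (i div b) * g (i mod b) * cnj (f (j div b) * g (j mod b)))"

text \<open>Rule induction over unnormalised pure products replaces the bookkeeping of weights and
  states in \<open>separable\<close>. For positive dimensions the operators of trace 1 in this cone
  are exactly the separable states, by \<open>separable_sep_cone\<close> and
  \<open>sep_cone_separable\<close>.\<close>

inductive sep_cone :: "nat \<Rightarrow> nat \<Rightarrow> complex mat \<Rightarrow> bool" for a b where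
  sep_cone_zero: "sep_cone a b (0\<^sub>m (a * b) (a * b))"
| sep_cone_add_pure_product: "sep_cone a b M \<Longrightarrow> sep_cone a b (M + pure_product a b f g)"

lemma pure_product_carrier [simp]: "pure_product a b f g \<in> carrier_mat (a * b) (a * b)"
  by (simp add: pure_product_def)

lemma pure_product_index:
  assumes "x < a" "y < b" "x' < a" "y' < b"
  shows "pure_product a b f g $$ (x * b + y, x' * b + y') = f x * g y * cnj (f x' * g y')"
  unfolding pure_product_def using index_less[OF assms(1,2)] index_less[OF assms(3,4)]
  by (simp add: index_div_mod[OF assms(2)] index_div_mod[OF assms(4)] assms)

lemma sep_cone_carrier: "sep_cone a b M \<Longrightarrow> M \<in> carrier_mat (a * b) (a * b)"
  by (induct rule: sep_cone.induct) simp_all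

lemma sep_cone_pure_product: "sep_cone a b (pure_product a b f g)"
proof -
  have "0\<^sub>m (a * b) (a * b) + pure_product a b f g = pure_product a b f g" by (rule left_add_zero_mat) simp
  then show ?thesis using sep_cone_add_pure_product[OF sep_cone_zero, of a b f g] by simp
qed

lemma sep_cone_add:
  assumes "sep_cone a b M" "sep_cone a b N"
  shows "sep_cone a b (M + N)"
  using assms(2)
proof induct
  case sep_cone_zero
  have "M + 0\<^sub>m (a * b) (a * b) = M" by (rule right_add_zero_mat[OF sep_cone_carrier[OF assms(1)]])
  then show ?case using assms(1) by simp
next
  case (sep_cone_add_pure_product N f g)
  have "M + (N + pure_product a b f g) = M + N + pure_product a b f g"
    by (rule assoc_add_mat[symmetric, OF sep_cone_carrier[OF assms(1)] sep_cone_carrier[OF sep_cone_add_pure_product(1)] pure_product_carrier])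
  then show ?case using sep_cone.sep_cone_add_pure_product[OF sep_cone_add_pure_product(2)] by simp
qed

lemma sep_cone_smult:
  assumes "sep_cone a b M" "0 \<le> t"
  shows "sep_cone a b (complex_of_real t \<cdot>\<^sub>m M)"
  using assms(1)
proof induct
  case sep_cone_zero
  have "complex_of_real t \<cdot>\<^sub>m 0\<^sub>m (a * b) (a * b) = 0\<^sub>m (a * b) (a * b)" by (rule eq_matI) auto
  then show ?case using sep_cone.sep_cone_zero by simp
next
  case (sep_cone_add_pure_product N f g)
  have s: "complex_of_real (sqrt t) * complex_of_real (sqrt t) = complex_of_real t"
    unfolding of_real_mult[symmetric] using assms(2) by simp
  have "complex_of_real t \<cdot>\<^sub>m (N + pure_product a b f g) = complex_of_real t \<cdot>\<^sub>m N + complex_of_real t \<cdot>\<^sub>m pure_product a b f g"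
    by (rule add_smult_distrib_left_mat[OF sep_cone_carrier[OF sep_cone_add_pure_product(1)] pure_product_carrier])
  also have "complex_of_real t \<cdot>\<^sub>m pure_product a b f g = pure_product a b (\<lambda>i. complex_of_real (sqrt t) * f i) g"
    by (rule eq_matI) (auto simp: pure_product_def s[symmetric] mult_ac)
  finally show ?case using sep_cone.sep_cone_add_pure_product[OF sep_cone_add_pure_product(2)] by simp
qed

lemma sep_cone_sum:
  assumes "\<And>k. k < N \<Longrightarrow> sep_cone a b (M k)"
  shows "sep_cone a b (mat (a * b) (a * b) (\<lambda>ij. \<Sum>k<(N::nat). M k $$ ij))"
  using assms
proof (induct N)
  case 0
  have "mat (a * b) (a * b) (\<lambda>ij. \<Sum>k<(0::nat). M k $$ ij) = 0\<^sub>m (a * b) (a * b)" by (rule eq_matI) auto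
  then show ?case using sep_cone_zero by simp
next
  case (Suc N)
  have "mat (a * b) (a * b) (\<lambda>ij. \<Sum>k<Suc N. M k $$ ij) = mat (a * b) (a * b) (\<lambda>ij. \<Sum>k<N. M k $$ ij) + M N"
    by (rule eq_matI) (use sep_cone_carrier[OF Suc.prems[of N]] in auto)
  then show ?case using sep_cone_add Suc by simp
qed

lemma mtrace_add:
  assumes "A \<in> carrier_mat n n" "B \<in> carrier_mat n n"
  shows "mtrace (A + B) = mtrace A + mtrace B"
  using assms by (simp add: mtrace_def sum.distrib)

lemma mtrace_mult_pure_product:
  assumes "M \<in> carrier_mat (a * b) (a * b)"
  shows "mtrace (M * pure_product a b f g) = (\<Sum>x<a. \<Sum>y<b. \<Sum>x'<a. \<Sum>y'<b.
    M $$ (x * b + y, x' * b + y') * (f x' * g y' * cnj (f x * g y)))"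
  unfolding mtrace_mult[OF assms pure_product_carrier] sum_mult_index
  by (intro sum.cong refl) (simp add: pure_product_index)

lemma mtrace_pure_product:
  "mtrace (pure_product a b f g) = complex_of_real ((\<Sum>x<a. (cmod (f x))\<^sup>2) * (\<Sum>y<b. (cmod (g y))\<^sup>2))"
proof -
  have "mtrace (pure_product a b f g) = (\<Sum>x<a. \<Sum>y<b. (cnj (f x) * f x) * (cnj (g y) * g y))"
    by (simp add: mtrace_def carrier_matD[OF pure_product_carrier] sum_mult_index pure_product_index mult_ac)
  then show ?thesis by (simp only: cnj_mult_self sum_product of_real_sum of_real_mult)
qed

text \<open>Both sides are additive in \<open>N\<close>, and the last factor of the hypothesis is
  the trace of the pure product. Inequalities on the whole cone thus reduce to product
  vectors.\<close>

lemma sep_cone_mono: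
  assumes M: "M \<in> carrier_mat (a * b) (a * b)" and N: "sep_cone a b N"
    and le: "\<And>f g. Re (mtrace (M * pure_product a b f g)) \<le> c * ((\<Sum>x<a. (cmod (f x))\<^sup>2) * (\<Sum>y<b. (cmod (g y))\<^sup>2))"
  shows "Re (mtrace (M * N)) \<le> c * Re (mtrace N)"
  using N
proof induct
  case sep_cone_zero
  have "M * 0\<^sub>m (a * b) (a * b) = 0\<^sub>m (a * b) (a * b)" by (rule right_mult_zero_mat[OF M])
  then show ?case by (simp add: mtrace_def)
next
  case (sep_cone_add_pure_product N f g)
  have N: "N \<in> carrier_mat (a * b) (a * b)" by (rule sep_cone_carrier[OF sep_cone_add_pure_product(1)])
  have "mtrace (M * (N + pure_product a b f g)) = mtrace (M * N) + mtrace (M * pure_product a b f g)"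
    unfolding mult_add_distrib_mat[OF M N pure_product_carrier]
    by (rule mtrace_add[of _ "a * b"]) (rule mult_carrier_mat[OF M] , simp add: N)+
  moreover have "mtrace (N + pure_product a b f g) = mtrace N + mtrace (pure_product a b f g)"
    by (rule mtrace_add[OF N pure_product_carrier])
  ultimately show ?case using sep_cone_add_pure_product(2) le[of f g] by (simp add: mtrace_pure_product distrib_left)
qed

lemma qform_pure_product:
  "qform (a * b) (pure_product a b f g) v = complex_of_real ((cmod (\<Sum>i<a * b. cnj (f (i div b) * g (i mod b)) * v i))\<^sup>2)"
proof -
  have p: "pure_product a b f g = mat (a * b) (a * b) (\<lambda>(i,j). \<Sum>k<(1::nat). complex_of_real ((\<lambda>_. 1) k) * (\<lambda>_ i. f (i div b) * g (i mod b)) k i * cnj ((\<lambda>_ i. f (i div b) * g (i mod b)) k j))"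
    by (simp add: pure_product_def)
  show ?thesis unfolding p qform_rank_one_sum by simp
qed

lemma psd_add: "psd n A \<Longrightarrow> psd n B \<Longrightarrow> psd n (A + B)"
proof -
  assume A: "psd n A" and B: "psd n B"
  have "qform n (A + B) v = qform n A v + qform n B v" for v
    using psd_carrier[OF A] psd_carrier[OF B] unfolding qform_def
    by (simp add: sum.distrib algebra_simps)
  then show ?thesis using A B by (simp add: psd_iff)
qed

lemma psd_zero: "psd n (0\<^sub>m n n)"
  by (simp add: psd_iff qform_def)

lemma sep_cone_psd: "sep_cone a b M \<Longrightarrow> psd (a * b) M"
proof (induct rule: sep_cone.induct)
  case sep_cone_zero show ?case by (rule psd_zero)
next
  case (sep_cone_add_pure_product M f g)
  have "psd (a * b) (pure_product a b f g)" unfolding psd_iff qform_pure_product by (simp add: less_eq_complex_def)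
  then show ?case using sep_cone_add_pure_product psd_add by simp
qed

lemma mat_cong: "(\<And>i j. i < n \<Longrightarrow> j < m \<Longrightarrow> f (i,j) = g (i,j)) \<Longrightarrow> mat n m f = mat n m g"
  by (rule eq_matI) auto

text \<open>Spectral decompositions of the two factors multiply out to a nonnegative combination of
  pure products.\<close>

lemma sep_cone_tensor_states:
  assumes "psd a S" "psd b T"
  shows "sep_cone a b (tensor_mat S T)"
proof -
  obtain e l where E: "eigenbasis a S e l" and l: "\<forall>k<a. 0 \<le> l k" by (rule psd_spectral[OF assms(1)])
  obtain f m where F: "eigenbasis b T f m" and m: "\<forall>k<b. 0 \<le> m k" by (rule psd_spectral[OF assms(2)])
  have S: "S \<in> carrier_mat a a" and T: "T \<in> carrier_mat b b" using assms by (auto simp: psd_carrier)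
  let ?P = "\<lambda>k k'. complex_of_real (l k * m k') \<cdot>\<^sub>m pure_product a b (e k) (f k')"
  let ?M = "mat (a * b) (a * b) (\<lambda>ij. \<Sum>k<a. (mat (a * b) (a * b) (\<lambda>ij. \<Sum>k'<b. ?P k k' $$ ij)) $$ ij)"
  have "tensor_mat S T = ?M"
  proof (rule eq_matI)
    fix i j assume "i < dim_row ?M" "j < dim_col ?M"
    then have i: "i < a * b" and j: "j < a * b" by auto
    note di = div_mod_less[OF i] and dj = div_mod_less[OF j]
    have "tensor_mat S T $$ (i,j) = S $$ (i div b, j div b) * T $$ (i mod b, j mod b)"
      using S T i j by (simp add: tensor_mat_def)
    also have "\<dots> = (\<Sum>k<a. complex_of_real (l k) * e k (i div b) * cnj (e k (j div b))) *
        (\<Sum>k'<b. complex_of_real (m k') * f k' (i mod b) * cnj (f k' (j mod b)))"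
      by (simp only: eigenbasisD(4)[OF E di(1) dj(1)] eigenbasisD(4)[OF F di(2) dj(2)])
    also have "\<dots> = (\<Sum>k<a. \<Sum>k'<b. ?P k k' $$ (i,j))"
      unfolding sum_product by (intro sum.cong refl) (use i j in \<open>simp add: pure_product_def mult_ac\<close>)
    finally show "tensor_mat S T $$ (i,j) = ?M $$ (i,j)" using i j by simp
  qed (use S T in \<open>simp_all add: tensor_mat_def\<close>)
  moreover have "sep_cone a b ?M"
    by (intro sep_cone_sum sep_cone_smult sep_cone_pure_product) (use l m in simp)
  ultimately show ?thesis by simp
qed

section \<open>Separable states as normalised elements of the cone\<close>

lemma mtrace_mixture:
  assumes st: "\<forall>k<N. s k \<in> states a \<and> t k \<in> states b"
  shows "mtrace (mat (a * b) (a * b) (\<lambda>ij. \<Sum>k<N. complex_of_real (p k) * tensor_mat (s k) (t k) $$ ij))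
    = complex_of_real (\<Sum>k<(N::nat). p k)"
proof -
  have tt: "(\<Sum>i<a * b. tensor_mat (s k) (t k) $$ (i, i)) = 1" if k: "k < N" for k
  proof -
    have c: "s k \<in> carrier_mat a a" "t k \<in> carrier_mat b b"
      using st k by (auto simp: states_def psd_carrier)
    have "(\<Sum>i<a * b. tensor_mat (s k) (t k) $$ (i, i)) = (\<Sum>x<a. \<Sum>y<b. s k $$ (x, x) * t k $$ (y, y))"
      unfolding sum_mult_index
      by (intro sum.cong refl) (use c in \<open>simp add: tensor_mat_def index_less index_div_mod\<close>)
    also have "\<dots> = mtrace (s k) * mtrace (t k)" using c by (simp add: mtrace_def sum_product)
    finally show ?thesis using st k by (simp add: states_def)
  qed
  have "mtrace (mat (a * b) (a * b) (\<lambda>ij. \<Sum>k<N. complex_of_real (p k) * tensor_mat (s k) (t k) $$ ij))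
     = (\<Sum>i<a * b. \<Sum>k<N. complex_of_real (p k) * tensor_mat (s k) (t k) $$ (i, i))"
    by (simp add: mtrace_def)
  also have "\<dots> = (\<Sum>k<N. complex_of_real (p k) * (\<Sum>i<a * b. tensor_mat (s k) (t k) $$ (i, i)))"
    by (subst sum.swap) (simp only: sum_distrib_left)
  also have "\<dots> = (\<Sum>k<N. complex_of_real (p k))" by (intro sum.cong refl) (simp add: tt)
  finally show ?thesis by simp
qed

lemma separable_sep_cone:
  assumes "\<sigma> \<in> separable a b"
  shows "sep_cone a b \<sigma>" and "mtrace \<sigma> = 1"
proof -
  obtain N p s t where \<sigma>: "\<sigma> = mat (a * b) (a * b) (\<lambda>ij. \<Sum>k<N. complex_of_real (p k) * tensor_mat (s k) (t k) $$ ij)"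
    and st: "\<forall>k<(N::nat). 0 \<le> p k \<and> s k \<in> states a \<and> t k \<in> states b" and p: "(\<Sum>k<N. p k) = (1::real)"
    using assms unfolding separable_def by blast
  have c: "s k \<in> carrier_mat a a" "t k \<in> carrier_mat b b" if "k < N" for k
    using st that by (auto simp: states_def psd_carrier)
  have d: "dim_row (tensor_mat (s k) (t k)) = a * b" "dim_col (tensor_mat (s k) (t k)) = a * b" if "k < N" for k
    using c[OF that] by (simp_all add: tensor_mat_def)
  have "\<sigma> = mat (a * b) (a * b) (\<lambda>ij. \<Sum>k<N. (complex_of_real (p k) \<cdot>\<^sub>m tensor_mat (s k) (t k)) $$ ij)"
    unfolding \<sigma> by (intro mat_cong sum.cong refl) (simp add: d)
  also have "sep_cone a b \<dots>"
    by (intro sep_cone_sum sep_cone_smult sep_cone_tensor_states) (use st in \<open>auto simp: states_def\<close>)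
  finally show "sep_cone a b \<sigma>" .
  show "mtrace \<sigma> = 1" unfolding \<sigma> by (subst mtrace_mixture) (use st p in auto)
qed

definition rank_one :: "nat \<Rightarrow> (nat \<Rightarrow> complex) \<Rightarrow> complex mat" where
  "rank_one n f = mat n n (\<lambda>(i,j). \<Sum>k<(1::nat). complex_of_real (1 / (\<Sum>i<n. (cmod (f i))\<^sup>2)) * f i * cnj (f j))"

lemma rank_one_state:
  assumes "(\<Sum>i<n. (cmod (f i))\<^sup>2) \<noteq> 0"
  shows "rank_one n f \<in> states n"
proof -
  have "psd n (rank_one n f)" unfolding rank_one_def
    by (rule psd_rank_one_sum) (simp add: sum_nonneg)
  moreover have "mtrace (rank_one n f) = 1"
  proof -
    define t where "t = (\<Sum>i<n. (cmod (f i))\<^sup>2)"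
    have "mtrace (rank_one n f) = complex_of_real (1 / t) * (\<Sum>i<n. cnj (f i) * f i)"
      by (simp add: mtrace_def rank_one_def t_def[symmetric] sum_divide_distrib mult_ac)
    also have "\<dots> = complex_of_real (1 / t * t)" by (simp only: sum_cnj_self t_def of_real_mult)
    finally show ?thesis using assms by (simp add: t_def)
  qed
  ultimately show ?thesis by (simp add: states_def)
qed

lemma sep_cone_decompose:
  assumes "sep_cone a b M" "0 < a" "0 < b"
  shows "\<exists>(N::nat) p s t. (\<forall>k<N. 0 \<le> p k \<and> s k \<in> states a \<and> t k \<in> states b) \<and>
    M = mat (a * b) (a * b) (\<lambda>ij. \<Sum>k<N. complex_of_real (p k) * tensor_mat (s k) (t k) $$ ij)"
  using assms(1)
proof induct
  case sep_cone_zero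
  have "0\<^sub>m (a * b) (a * b) = mat (a * b) (a * b) (\<lambda>ij. \<Sum>k<(0::nat). complex_of_real (p k) * tensor_mat (s k) (t k) $$ ij)" for p s t
    by (rule eq_matI) auto
  then show ?case by (intro exI[of _ 0]) auto
next
  case (sep_cone_add_pure_product M f g)
  then obtain N :: nat and p s t where st: "\<forall>k<N. 0 \<le> p k \<and> s k \<in> states a \<and> t k \<in> states b"
    and M: "M = mat (a * b) (a * b) (\<lambda>ij. \<Sum>k<N. complex_of_real (p k) * tensor_mat (s k) (t k) $$ ij)" by auto
  define F where "F = (\<Sum>i<a. (cmod (f i))\<^sup>2)"
  define G where "G = (\<Sum>i<b. (cmod (g i))\<^sup>2)"
  have nn: "0 \<le> F" "0 \<le> G" by (simp_all add: F_def G_def sum_nonneg)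
  show ?case
  proof (cases "F * G = 0")
    \<comment> \<open>A vanishing vector cannot be normalised to a state, but its pure product adds
      nothing.\<close>
    case True
    have "f x * g y = 0" if "x < a" "y < b" for x y
    proof -
      from True consider "F = 0" | "G = 0" by auto
      then show ?thesis
      proof cases
        case 1 then have "(cmod (f x))\<^sup>2 = 0" unfolding F_def using that by (subst (asm) sum_nonneg_eq_0_iff) auto
        then show ?thesis by simp
      next
        case 2 then have "(cmod (g y))\<^sup>2 = 0" unfolding G_def using that by (subst (asm) sum_nonneg_eq_0_iff) auto
        then show ?thesis by simp
      qed
    qed
    then have "pure_product a b f g = 0\<^sub>m (a * b) (a * b)"
      by (intro eq_matI) (auto simp: pure_product_def div_mod_less)
    then have "M + pure_product a b f g = M" using sep_cone_carrier[OF sep_cone_add_pure_product(1)] by simp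
    then show ?thesis using sep_cone_add_pure_product(2) by simp
  next
    case False
    then have ne: "F \<noteq> 0" "G \<noteq> 0" by auto
    define p' where "p' = p(N := F * G)"
    define s' where "s' = s(N := rank_one a f)"
    define t' where "t' = t(N := rank_one b g)"
    have 1: "\<forall>k<Suc N. 0 \<le> p' k \<and> s' k \<in> states a \<and> t' k \<in> states b"
      using st nn ne rank_one_state[where n = a and f = f] rank_one_state[where n = b and f = g]
      by (auto simp: p'_def s'_def t'_def F_def G_def less_Suc_eq)
    have pf: "complex_of_real (F * G) * tensor_mat (rank_one a f) (rank_one b g) $$ (i,j) = pure_product a b f g $$ (i,j)"
      if "i < a * b" "j < a * b" for i j
    proof -
      have "complex_of_real (F * G) * tensor_mat (rank_one a f) (rank_one b g) $$ (i,j)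
        = (complex_of_real F * complex_of_real (1 / F)) * (complex_of_real G * complex_of_real (1 / G)) *
           (f (i div b) * g (i mod b) * cnj (f (j div b) * g (j mod b)))"
        using that by (simp add: tensor_mat_def rank_one_def div_mod_less F_def[symmetric] G_def[symmetric])
      then show ?thesis using that ne unfolding of_real_mult[symmetric] by (simp add: pure_product_def)
    qed
    have 2: "M + pure_product a b f g = mat (a * b) (a * b) (\<lambda>ij. \<Sum>k<Suc N. complex_of_real (p' k) * tensor_mat (s' k) (t' k) $$ ij)"
    proof (rule eq_matI)
      fix i j assume "i < dim_row (mat (a * b) (a * b) (\<lambda>ij. \<Sum>k<Suc N. complex_of_real (p' k) * tensor_mat (s' k) (t' k) $$ ij))"
        "j < dim_col (mat (a * b) (a * b) (\<lambda>ij. \<Sum>k<Suc N. complex_of_real (p' k) * tensor_mat (s' k) (t' k) $$ ij))"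
      then have ij: "i < a * b" "j < a * b" by auto
      show "(M + pure_product a b f g) $$ (i,j) = mat (a * b) (a * b) (\<lambda>ij. \<Sum>k<Suc N. complex_of_real (p' k) * tensor_mat (s' k) (t' k) $$ ij) $$ (i,j)"
        using ij pf[OF ij] by (simp add: M p'_def s'_def t'_def carrier_matD[OF pure_product_carrier])
    qed (simp_all add: carrier_matD[OF pure_product_carrier])
    show ?thesis using 1 2 by blast
  qed
qed

lemma sep_cone_separable:
  assumes S: "sep_cone a b M" "0 < a" "0 < b" and tr: "mtrace M = 1"
  shows "M \<in> separable a b"
proof -
  obtain N :: nat and p s t where st: "\<forall>k<N. 0 \<le> p k \<and> s k \<in> states a \<and> t k \<in> states b"
    and M: "M = mat (a * b) (a * b) (\<lambda>ij. \<Sum>k<N. complex_of_real (p k) * tensor_mat (s k) (t k) $$ ij)"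
    using sep_cone_decompose[OF S] by blast
  have "complex_of_real (\<Sum>k<N. p k) = 1" using tr unfolding M by (subst (asm) mtrace_mixture) (use st in auto)
  then have "(\<Sum>k<N. p k) = 1" by (simp only: of_real_eq_1_iff)
  then show ?thesis unfolding separable_def using st M by blast
qed

section \<open>Tensor products of separable operators\<close>

lemma bip_tensor_add_left:
  assumes "X \<in> carrier_mat (a * b) (a * b)" "X' \<in> carrier_mat (a * b) (a * b)" "Y \<in> carrier_mat (c * d) (c * d)"
  shows "bip_tensor a b c d (X + X') Y = bip_tensor a b c d X Y + bip_tensor a b c d X' Y"
proof (rule bip_tensor_eqI)
  fix x z y w x' z' y' w'
  assume i: "x < a" "z < c" "y < b" "w < d" "x' < a" "z' < c" "y' < b" "w' < d"
  let ?I = "(x * c + z) * (b * d) + (y * d + w)" and ?J = "(x' * c + z') * (b * d) + (y' * d + w')"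
  have l: "?I < (a * c) * (b * d)" "?J < (a * c) * (b * d)" using i by (intro index_less; simp)+
  have m: "x * b + y < a * b" "x' * b + y' < a * b" using i by (intro index_less; simp)+
  have s: "X + X' \<in> carrier_mat (a * b) (a * b)" using assms by simp
  show "bip_tensor a b c d (X + X') Y $$ (?I, ?J) = (bip_tensor a b c d X Y + bip_tensor a b c d X' Y) $$ (?I, ?J)"
    using l m assms bip_tensor_index[OF s assms(3) i] bip_tensor_index[OF assms(1,3) i] bip_tensor_index[OF assms(2,3) i]
      carrier_matD[OF bip_tensor_carrier, of a b c d X' Y]
    by (simp add: distrib_right)
qed simp_all

lemma bip_tensor_add_right:
  assumes "X \<in> carrier_mat (a * b) (a * b)" "Y \<in> carrier_mat (c * d) (c * d)" "Y' \<in> carrier_mat (c * d) (c * d)"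
  shows "bip_tensor a b c d X (Y + Y') = bip_tensor a b c d X Y + bip_tensor a b c d X Y'"
proof (rule bip_tensor_eqI)
  fix x z y w x' z' y' w'
  assume i: "x < a" "z < c" "y < b" "w < d" "x' < a" "z' < c" "y' < b" "w' < d"
  let ?I = "(x * c + z) * (b * d) + (y * d + w)" and ?J = "(x' * c + z') * (b * d) + (y' * d + w')"
  have l: "?I < (a * c) * (b * d)" "?J < (a * c) * (b * d)" using i by (intro index_less; simp)+
  have m: "z * d + w < c * d" "z' * d + w' < c * d" using i by (intro index_less; simp)+
  have s: "Y + Y' \<in> carrier_mat (c * d) (c * d)" using assms by simp
  show "bip_tensor a b c d X (Y + Y') $$ (?I, ?J) = (bip_tensor a b c d X Y + bip_tensor a b c d X Y') $$ (?I, ?J)"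
    using l m assms bip_tensor_index[OF assms(1) s i] bip_tensor_index[OF assms(1,2) i] bip_tensor_index[OF assms(1,3) i]
      carrier_matD[OF bip_tensor_carrier, of a b c d X Y']
    by (simp add: distrib_left)
qed simp_all

lemma bip_tensor_zero:
  assumes "X \<in> carrier_mat (a * b) (a * b)" "Y \<in> carrier_mat (c * d) (c * d)"
  shows "bip_tensor a b c d X (0\<^sub>m (c * d) (c * d)) = 0\<^sub>m ((a * c) * (b * d)) ((a * c) * (b * d))"
    and "bip_tensor a b c d (0\<^sub>m (a * b) (a * b)) Y = 0\<^sub>m ((a * c) * (b * d)) ((a * c) * (b * d))"
proof -
  have l: "(x * c + z) * (b * d) + (y * d + w) < (a * c) * (b * d)" "x * b + y < a * b" "z * d + w < c * d"
    if "x < a" "z < c" "y < b" "w < d" for x z y w using that by (intro index_less; simp)+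
  show "bip_tensor a b c d X (0\<^sub>m (c * d) (c * d)) = 0\<^sub>m ((a * c) * (b * d)) ((a * c) * (b * d))"
    by (rule bip_tensor_eqI[where a = a and b = b and c = c and d = d]) (simp_all add: bip_tensor_index[OF assms(1) zero_carrier_mat] l)
  show "bip_tensor a b c d (0\<^sub>m (a * b) (a * b)) Y = 0\<^sub>m ((a * c) * (b * d)) ((a * c) * (b * d))"
    by (rule bip_tensor_eqI[where a = a and b = b and c = c and d = d]) (simp_all add: bip_tensor_index[OF zero_carrier_mat assms(2)] l)
qed

lemma bip_tensor_pure_product:
  "bip_tensor a b c d (pure_product a b f g) (pure_product c d f' g')
    = pure_product (a * c) (b * d) (\<lambda>i. f (i div c) * f' (i mod c)) (\<lambda>j. g (j div d) * g' (j mod d))"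
proof (rule bip_tensor_eqI)
  fix x z y w x' z' y' w'
  assume i: "x < a" "z < c" "y < b" "w < d" "x' < a" "z' < c" "y' < b" "w' < d"
  have m: "x * c + z < a * c" "x' * c + z' < a * c" "y * d + w < b * d" "y' * d + w' < b * d"
    using i by (intro index_less; simp)+
  show "bip_tensor a b c d (pure_product a b f g) (pure_product c d f' g') $$ ((x * c + z) * (b * d) + (y * d + w), (x' * c + z') * (b * d) + (y' * d + w'))
    = pure_product (a * c) (b * d) (\<lambda>i. f (i div c) * f' (i mod c)) (\<lambda>j. g (j div d) * g' (j mod d)) $$ ((x * c + z) * (b * d) + (y * d + w), (x' * c + z') * (b * d) + (y' * d + w'))"
    unfolding bip_tensor_index[OF pure_product_carrier pure_product_carrier i] pure_product_index[OF m(1,3,2,4)]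
      pure_product_index[OF i(1,3,5,7)] pure_product_index[OF i(2,4,6,8)]
    using i by simp
qed simp_all

lemma sep_cone_bip_tensor:
  assumes M: "sep_cone a b M" and N: "sep_cone c d N"
  shows "sep_cone (a * c) (b * d) (bip_tensor a b c d M N)"
  using M
proof induct
  case sep_cone_zero
  show ?case unfolding bip_tensor_zero(2)[OF pure_product_carrier sep_cone_carrier[OF N]] by (rule sep_cone.sep_cone_zero)
next
  case (sep_cone_add_pure_product M f g)
  have "sep_cone (a * c) (b * d) (bip_tensor a b c d (pure_product a b f g) N)"
    using N
  proof induct
    case sep_cone_zero
    show ?case unfolding bip_tensor_zero(1)[OF pure_product_carrier pure_product_carrier] by (rule sep_cone.sep_cone_zero)
  next
    case (sep_cone_add_pure_product N f' g')
    show ?case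
      unfolding bip_tensor_add_right[OF pure_product_carrier sep_cone_carrier[OF sep_cone_add_pure_product(1)] pure_product_carrier] bip_tensor_pure_product
      by (rule sep_cone.sep_cone_add_pure_product[OF sep_cone_add_pure_product(2)])
  qed
  then show ?case
    unfolding bip_tensor_add_left[OF sep_cone_carrier[OF sep_cone_add_pure_product(1)] pure_product_carrier sep_cone_carrier[OF N]]
    using sep_cone_add sep_cone_add_pure_product(2) by blast
qed

lemma sep_cone_one: "sep_cone a b (1\<^sub>m (a * b))"
proof -
  have p: "psd n (1\<^sub>m n)" for n
  proof -
    have "qform n (1\<^sub>m n) v = complex_of_real (\<Sum>i<n. (cmod (v i))\<^sup>2)" for v
    proof -
      have "qform n (1\<^sub>m n) v = (\<Sum>i<n. cnj (v i) * (\<Sum>j<n. if j = i then v j else 0))"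
        unfolding qform_app by (intro sum.cong refl arg_cong2[where f = "(*)"]) auto
      then have "qform n (1\<^sub>m n) v = (\<Sum>i<n. cnj (v i) * v i)" by simp
      then show ?thesis by (simp only: sum_cnj_self)
    qed
    then show ?thesis by (simp add: psd_iff less_eq_complex_def sum_nonneg)
  qed
  have "tensor_mat (1\<^sub>m a) (1\<^sub>m b) = (1\<^sub>m (a * b) :: complex mat)"
  proof (rule eq_matI)
    fix i j assume "i < dim_row (1\<^sub>m (a * b) :: complex mat)" "j < dim_col (1\<^sub>m (a * b) :: complex mat)"
    then have "i < a * b" "j < a * b" by auto
    moreover have "i = j \<longleftrightarrow> i div b = j div b \<and> i mod b = j mod b" by (metis div_mult_mod_eq)
    ultimately show "tensor_mat (1\<^sub>m a) (1\<^sub>m b) $$ (i, j) = (1\<^sub>m (a * b) :: complex mat) $$ (i, j)"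
      by (auto simp: tensor_mat_def div_mod_less)
  qed (simp_all add: tensor_mat_def)
  then show ?thesis using sep_cone_tensor_states[OF p p, of a b] by simp
qed

lemma sep_cone_bip_power: "sep_cone a b X \<Longrightarrow> sep_cone (a ^ n) (b ^ n) (bip_power a b X n)"
proof (induct n)
  case 0 then show ?case using sep_cone_one[of 1 1] by simp
next
  case (Suc n) then show ?case using sep_cone_bip_tensor[OF Suc.prems Suc.hyps] by simp
qed

definition ptranspose :: "nat \<Rightarrow> nat \<Rightarrow> complex mat \<Rightarrow> complex mat" where
  "ptranspose a b M = mat (a * b) (a * b) (\<lambda>(i, j). M $$ (i div b * b + j mod b, j div b * b + i mod b))"

text \<open>Transposing the projector onto \<open>g\<close> gives the projector onto its conjugate,
  so pure products go to pure products.\<close>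

lemma sep_cone_ptranspose: "sep_cone a b M \<Longrightarrow> sep_cone a b (ptranspose a b M)"
proof (induct rule: sep_cone.induct)
  case sep_cone_zero
  have "ptranspose a b (0\<^sub>m (a * b) (a * b)) = 0\<^sub>m (a * b) (a * b)"
    unfolding ptranspose_def by (rule eq_matI) (auto simp: index_less div_mod_less)
  then show ?case using sep_cone.sep_cone_zero by simp
next
  case (sep_cone_add_pure_product M f g)
  have "ptranspose a b (M + pure_product a b f g) = ptranspose a b M + pure_product a b f (\<lambda>y. cnj (g y))"
  proof (rule eq_matI)
    fix i j assume "i < dim_row (ptranspose a b M + pure_product a b f (\<lambda>y. cnj (g y)))" "j < dim_col (ptranspose a b M + pure_product a b f (\<lambda>y. cnj (g y)))"
    then have i: "i < a * b" and j: "j < a * b" by (simp_all add: pure_product_def)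
    note di = div_mod_less[OF i] and dj = div_mod_less[OF j]
    have "pure_product a b f g $$ (i div b * b + j mod b, j div b * b + i mod b) = pure_product a b f (\<lambda>y. cnj (g y)) $$ (i div b * b + i mod b, j div b * b + j mod b)"
      unfolding pure_product_index[OF di(1) dj(2) dj(1) di(2)] pure_product_index[OF di(1) di(2) dj(1) dj(2)] by simp
    moreover have "i div b * b + i mod b = i" "j div b * b + j mod b = j" by simp_all
    ultimately show "ptranspose a b (M + pure_product a b f g) $$ (i,j) = (ptranspose a b M + pure_product a b f (\<lambda>y. cnj (g y))) $$ (i,j)"
      using i j index_less[OF di(1) dj(2)] index_less[OF dj(1) di(2)]
      by (simp add: ptranspose_def carrier_matD[OF pure_product_carrier])
  qed (simp_all add: ptranspose_def pure_product_def)
  then show ?case using sep_cone.sep_cone_add_pure_product[OF sep_cone_add_pure_product(2)] by simp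
qed

section \<open>The test operator as a phase average\<close>

definition charge :: "nat \<Rightarrow> nat \<Rightarrow> nat \<Rightarrow> nat \<Rightarrow> nat \<Rightarrow> int" where
  "charge s x y x' y' = of_bool (x = s) - of_bool (y = s) - of_bool (x' = s) + of_bool (y' = s)"

text \<open>The projector onto \<open>f \<otimes> cnj f\<close>, averaged over the phases 1, \<open>\<i>\<close>, -1, \<open>-\<i>\<close> of each of the first
  \<open>m\<close> entries of \<open>f\<close>: averaging over the phase of \<open>f s\<close> kills the matrix entries of nonzero charge.\<close>

definition phase_average :: "nat \<Rightarrow> nat \<Rightarrow> (nat \<Rightarrow> complex) \<Rightarrow> complex mat" where
  "phase_average K m f = mat (K * K) (K * K) (\<lambda>(i, j).
     f (i div K) * cnj (f (i mod K)) * cnj (f (j div K) * cnj (f (j mod K))) *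
     (if \<forall>s<m. charge s (i div K) (i mod K) (j div K) (j mod K) = 0 then 1 else 0))"

text \<open>A phase on \<open>f m\<close> multiplies the entry by that phase to the power
  \<open>charge m x y x' y'\<close>. The charge lies between -2 and 2, so fourth roots of unity
  detect whether it vanishes; signs alone would miss charge 2.\<close>

lemma average_phases:
  "(\<Sum>k<(4::nat). 1 / 4 * ((f(m := \<i> ^ k * f m)) x * cnj ((f(m := \<i> ^ k * f m)) y) * cnj ((f(m := \<i> ^ k * f m)) x' * cnj ((f(m := \<i> ^ k * f m)) y'))))
    = f x * cnj (f y) * cnj (f x' * cnj (f y')) * (if charge m x y x' y' = 0 then 1 else 0)"
  by (cases "x = m"; cases "y = m"; cases "x' = m"; cases "y' = m")
     (simp_all add: charge_def numeral_eq_Suc lessThan_Suc algebra_simps)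

lemma sep_cone_phase_average: "sep_cone K K (phase_average K m f)"
proof (induct m arbitrary: f)
  case 0
  have "phase_average K 0 f = pure_product K K f (\<lambda>y. cnj (f y))"
    by (simp add: phase_average_def pure_product_def)
  then show ?case using sep_cone_pure_product by simp
next
  case (Suc m)
  let ?f = "\<lambda>k. f(m := \<i> ^ k * f m)"
  have "phase_average K (Suc m) f = mat (K * K) (K * K) (\<lambda>ij. \<Sum>k<(4::nat). (complex_of_real (1 / 4) \<cdot>\<^sub>m phase_average K m (?f k)) $$ ij)"
    (is "_ = ?R")
  proof (rule eq_matI)
    fix i j assume "i < dim_row ?R" "j < dim_col ?R"
    then have ij: "i < K * K" "j < K * K" by auto
    let ?c = "if \<forall>s<m. charge s (i div K) (i mod K) (j div K) (j mod K) = 0 then 1 else (0::complex)"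
    have "?R $$ (i,j) = (\<Sum>k<(4::nat). 1 / 4 * (?f k (i div K) * cnj (?f k (i mod K)) * cnj (?f k (j div K) * cnj (?f k (j mod K))))) * ?c"
      unfolding sum_distrib_right using ij by (simp add: phase_average_def del: fun_upd_apply)
    also have "\<dots> = phase_average K (Suc m) f $$ (i,j)"
      unfolding average_phases using ij by (auto simp: phase_average_def less_Suc_eq)
    finally show "phase_average K (Suc m) f $$ (i,j) = ?R $$ (i,j)" ..
  qed (simp_all add: phase_average_def)
  moreover have "sep_cone K K ?R" by (intro sep_cone_sum sep_cone_smult Suc) simp
  ultimately show ?case by simp
qed

text \<open>Vanishing of all charges says that the multisets \<open>{x, y'}\<close> and
  \<open>{y, x'}\<close> coincide. Testing at the four indices themselves is enough.\<close>

lemma all_charges_zero: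
  assumes "x < K" "y < K" "x' < K" "y' < K"
  shows "(\<forall>s<K. charge s x y x' y' = 0) \<longleftrightarrow> (x = y \<and> x' = y') \<or> (x = x' \<and> y = y')"
proof
  assume *: "\<forall>s<K. charge s x y x' y' = 0"
  have "charge x x y x' y' = 0" "charge y x y x' y' = 0" "charge x' x y x' y' = 0" "charge y' x y x' y' = 0"
    using * assms by auto
  then show "(x = y \<and> x' = y') \<or> (x = x' \<and> y = y')"
    by (auto simp: charge_def of_bool_def split: if_splits)
qed (auto simp: charge_def)

text \<open>This is the operator G: the entries between diagonal pairs make up K \<Phi>, the other
  ones are the projectors onto \<open>|xy>\<close> with distinct \<open>x\<close> and
  \<open>y\<close>.\<close>

definition sep_test :: "nat \<Rightarrow> complex mat" where
  "sep_test K = mat (K * K) (K * K) (\<lambda>(i, j).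
     if (i div K = i mod K \<and> j div K = j mod K) \<or> (i div K = j div K \<and> i mod K = j mod K) then 1 else 0)"

text \<open>The average over all phases of the product vector whose entries are all 1.\<close>

lemma sep_cone_sep_test: "sep_cone K K (sep_test K)"
proof -
  have "sep_test K = phase_average K K (\<lambda>_. 1)"
    unfolding sep_test_def phase_average_def
    by (intro mat_cong) (simp add: all_charges_zero div_mod_less)
  then show ?thesis using sep_cone_phase_average by simp
qed

text \<open>\<open>majorant d\<close> is the partial transpose of \<open>\<bar>A\<bar>\<close>, where \<open>A\<close> is the partial transpose of the antisymmetric state.\<close>

definition majorant :: "nat \<Rightarrow> complex mat" where
  "majorant d = complex_of_real (1 / (real d * (real d - 1))) \<cdot>\<^sub>m (1\<^sub>m (d * d) + complex_of_real (1 - 2 / real d) \<cdot>\<^sub>m swap_op d)"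

lemma swap_op_carrier [simp]: "swap_op d \<in> carrier_mat (d * d) (d * d)"
  by (simp add: swap_op_def)

lemma index_eq_iff: "i = j \<longleftrightarrow> i div b = j div b \<and> i mod b = j mod (b::nat)"
  by (metis div_mult_mod_eq)

text \<open>The partial transpose of G is \<open>1 + F\<close>, except that the entries
  \<open>|xx><xx|\<close> common to both terms are counted once; \<open>?D\<close> supplies the
  second count. With \<open>t = 1 - 2 / d\<close> the bracket \<open>1 + t F\<close> is then the
  nonnegative combination \<open>t (1 + F) + (1 - t) 1\<close>.\<close>

lemma sep_cone_majorant:
  assumes "2 \<le> d"
  shows "sep_cone d d (majorant d)"
proof -
  let ?D = "mat (d * d) (d * d) (\<lambda>ij. \<Sum>x<d. pure_product d d (\<lambda>i. of_bool (i = x)) (\<lambda>i. of_bool (i = x)) $$ ij)"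
  let ?t = "1 - 2 / real d"
  have D: "?D $$ (i,j) = (if i div d = i mod d \<and> j div d = i mod d \<and> j mod d = i mod d then 1 else 0)"
    if "i < d * d" "j < d * d" for i j
  proof -
    have "?D $$ (i,j) = (\<Sum>x<d. pure_product d d (\<lambda>i. of_bool (i = x)) (\<lambda>i. of_bool (i = x)) $$ (i,j))" using that by simp
    also have "\<dots> = (\<Sum>x<d. if x = i div d then (if i div d = i mod d \<and> j div d = i mod d \<and> j mod d = i mod d then 1 else 0) else 0)"
      using that by (intro sum.cong refl) (auto simp: pure_product_def of_bool_def)
    finally show ?thesis using that by (simp add: div_mod_less)
  qed
  have t: "0 \<le> ?t" "0 \<le> 2 / real d" "0 \<le> 1 / (real d * (real d - 1))" using assms by (simp_all add: field_simps)
  define S where "S = ptranspose d d (sep_test d) + ?D"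
  have S: "S \<in> carrier_mat (d * d) (d * d)" by (simp add: S_def)
  have SS: "S $$ (i,j) = 1\<^sub>m (d * d) $$ (i,j) + swap_op d $$ (i,j)" if ij: "i < d * d" "j < d * d" for i j
  proof -
    note di = div_mod_less[OF ij(1)] and dj = div_mod_less[OF ij(2)]
    define p where "p \<longleftrightarrow> i div d = j mod d \<and> i mod d = j div d"
    define q where "q \<longleftrightarrow> i div d = j div d \<and> i mod d = j mod d"
    have "ptranspose d d (sep_test d) $$ (i,j) = (if p \<or> q then 1 else 0)"
      using ij index_less[OF di(1) dj(2)] index_less[OF dj(1) di(2)]
      by (auto simp: ptranspose_def sep_test_def index_div_mod[OF dj(2)] index_div_mod[OF di(2)] di dj p_def q_def)
    moreover have "?D $$ (i,j) = (if p \<and> q then 1 else 0)"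
      unfolding D[OF ij] by (rule if_cong) (auto simp: p_def q_def)
    moreover have "1\<^sub>m (d * d) $$ (i,j) = (if q then 1 else (0::complex))"
      using ij unfolding q_def index_eq_iff[of i j d, symmetric] by simp
    moreover have "swap_op d $$ (i,j) = (if p then 1 else 0)"
      using ij by (simp add: swap_op_def p_def)
    moreover have "S $$ (i,j) = ptranspose d d (sep_test d) $$ (i,j) + ?D $$ (i,j)"
      unfolding S_def by (rule index_add_mat(1)) (use ij in simp_all)
    ultimately show ?thesis by (cases p; cases q) simp_all
  qed
  have "1\<^sub>m (d * d) + complex_of_real ?t \<cdot>\<^sub>m swap_op d = complex_of_real ?t \<cdot>\<^sub>m S + complex_of_real (2 / real d) \<cdot>\<^sub>m 1\<^sub>m (d * d)"
    by (rule eq_matI) (use S in \<open>auto simp: SS carrier_matD[OF swap_op_carrier] algebra_simps\<close>)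
  moreover have "sep_cone d d (complex_of_real (1 / (real d * (real d - 1))) \<cdot>\<^sub>m (complex_of_real ?t \<cdot>\<^sub>m S + complex_of_real (2 / real d) \<cdot>\<^sub>m 1\<^sub>m (d * d)))"
    unfolding S_def by (intro sep_cone_smult sep_cone_add sep_cone_ptranspose sep_cone_sep_test sep_cone_sum sep_cone_pure_product sep_cone_one t)
  ultimately show ?thesis by (simp only: majorant_def)
qed

lemma mtrace_swap_op: "mtrace (swap_op d) = of_nat d"
proof -
  have "mtrace (swap_op d) = (\<Sum>x<d. \<Sum>y<d. swap_op d $$ (x * d + y, x * d + y))"
    by (simp add: mtrace_def carrier_matD[OF swap_op_carrier] sum_mult_index)
  also have "\<dots> = (\<Sum>x<d. \<Sum>y<d. if y = x then 1 else 0)"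
    by (intro sum.cong refl) (auto simp: swap_op_def index_less)
  finally show ?thesis by simp
qed

lemma mtrace_smult: "mtrace (c \<cdot>\<^sub>m A) = c * mtrace A" if "A \<in> carrier_mat n n"
  using that by (simp add: mtrace_def sum_distrib_left)

lemma mtrace_one: "mtrace (1\<^sub>m n) = of_nat n" by (simp add: mtrace_def)

text \<open>Partial transposition turns the swap into d times the projector onto the maximally
  entangled vector. The antisymmetric state becomes an operator with eigenvalue
  \<open>1 / (d (d - 1))\<close> of multiplicity \<open>d^2 - 1\<close> and eigenvalue
  \<open>- 1 / d\<close> once, and the moduli sum to this trace.\<close>

lemma mtrace_majorant:
  assumes "2 \<le> d"
  shows "mtrace (majorant d) = complex_of_real (1 + 2 / real d)"
proof -
  have "mtrace (majorant d) = complex_of_real (1 / (real d * (real d - 1)) * (real d * real d + (1 - 2 / real d) * real d))"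
    unfolding majorant_def
    by (simp add: mtrace_smult[of _ "d * d"] mtrace_add[of _ "d * d"] mtrace_one mtrace_swap_op)
  also have "1 / (real d * (real d - 1)) * (real d * real d + (1 - 2 / real d) * real d) = 1 + 2 / real d"
    using assms by (simp add: field_simps)
  finally show ?thesis .
qed


subsection \<open>The antisymmetric state\<close>

lemma one_mat_index:
  assumes "x < d" "y < d" "x' < d" "y' < d"
  shows "1\<^sub>m (d * d) $$ (x * d + y, x' * d + y') = (if x = x' \<and> y = y' then 1 else 0)"
proof -
  have "x * d + y = x' * d + y' \<longleftrightarrow> x = x' \<and> y = y'"
    unfolding index_eq_iff[of "x * d + y" "x' * d + y'" d]
    by (simp only: index_div_mod[OF assms(2)] index_div_mod[OF assms(4)])
  then show ?thesis using index_less[OF assms(1,2)] index_less[OF assms(3,4)] by simp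
qed

lemma swap_op_index:
  assumes "x < d" "y < d" "x' < d" "y' < d"
  shows "swap_op d $$ (x * d + y, x' * d + y') = (if y = x' \<and> x = y' then 1 else 0)"
  using index_less[OF assms(1,2)] index_less[OF assms(3,4)]
  by (simp only: swap_op_def index_mat prod.case index_div_mod[OF assms(2)] index_div_mod[OF assms(4)] conj_commute)

lemma sum_delta2:
  fixes g :: "nat \<Rightarrow> nat \<Rightarrow> 'a::comm_monoid_add"
  assumes "x < a" "y < b"
  shows "(\<Sum>x'<a. \<Sum>y'<b. if x = x' \<and> y = y' then g x' y' else 0) = g x y"
proof -
  have "(\<Sum>x'<a. \<Sum>y'<b. if x = x' \<and> y = y' then g x' y' else 0) = (\<Sum>x'<a. if x' = x then (\<Sum>y'<b. if y' = y then g x' y' else 0) else 0)"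
    by (intro sum.cong refl) (auto intro!: sum.cong)
  then show ?thesis using assms by simp
qed

definition asym_proj :: "nat \<Rightarrow> complex mat" where
  "asym_proj d = complex_of_real (1 / 2) \<cdot>\<^sub>m (1\<^sub>m (d * d) - swap_op d)"

lemma asym_proj_carrier [simp]: "asym_proj d \<in> carrier_mat (d * d) (d * d)"
  by (simp add: asym_proj_def minus_carrier_mat)

lemma asym_proj_index:
  assumes "x < d" "y < d" "x' < d" "y' < d"
  shows "asym_proj d $$ (x * d + y, x' * d + y')
    = 1 / 2 * ((if x = x' \<and> y = y' then 1 else 0) - (if y = x' \<and> x = y' then 1 else 0))"
proof -
  have "asym_proj d $$ (x * d + y, x' * d + y')
    = 1 / 2 * (1\<^sub>m (d * d) $$ (x * d + y, x' * d + y') - swap_op d $$ (x * d + y, x' * d + y'))"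
    using index_less[OF assms(1,2)] index_less[OF assms(3,4)] by (simp add: asym_proj_def carrier_matD[OF swap_op_carrier])
  then show ?thesis unfolding one_mat_index[OF assms] swap_op_index[OF assms] .
qed

lemma half_diff_if_mult:
  "(1 / 2 * ((if P then 1 else 0) - (if Q then 1 else 0))) * g = 1 / 2 * ((if P then g else 0) - (if Q then g else (0::complex)))"
  by simp

lemma asym_proj_apply:
  assumes "x < d" "y < d"
  shows "(\<Sum>a<d. \<Sum>b<d. asym_proj d $$ (x * d + y, a * d + b) * g a b) = 1 / 2 * (g x y - g y x)"
proof -
  have "(\<Sum>a<d. \<Sum>b<d. asym_proj d $$ (x * d + y, a * d + b) * g a b)
      = (\<Sum>a<d. \<Sum>b<d. 1 / 2 * ((if x = a \<and> y = b then g a b else 0) - (if y = a \<and> x = b then g a b else 0)))"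
    by (intro sum.cong refl) (simp only: asym_proj_index assms lessThan_iff half_diff_if_mult)
  also have "\<dots> = 1 / 2 * ((\<Sum>a<d. \<Sum>b<d. if x = a \<and> y = b then g a b else 0) - (\<Sum>a<d. \<Sum>b<d. if y = a \<and> x = b then g a b else 0))"
    by (simp only: sum_distrib_left[symmetric] sum_subtractf)
  finally show ?thesis unfolding sum_delta2[OF assms] sum_delta2[OF assms(2,1)] .
qed

lemma asym_proj_symmetric:
  assumes "x < d" "y < d" "x' < d" "y' < d"
  shows "cnj (asym_proj d $$ (x' * d + y', x * d + y)) = asym_proj d $$ (x * d + y, x' * d + y')"
proof -
  have *: "cnj (1 / 2 * ((if P' then 1 else 0) - (if Q' then 1 else 0))) = 1 / 2 * ((if P then 1 else 0) - (if Q then 1 else 0))"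
    if "P' = P" "Q' = Q" for P Q P' Q' using that by simp
  show ?thesis unfolding asym_proj_index[OF assms] asym_proj_index[OF assms(3,4,1,2)]
    by (rule *) blast+
qed

lemma hermitian_asym_proj: "hermitian (d * d) (asym_proj d)"
proof -
  have "cnj (asym_proj d $$ (j, i)) = asym_proj d $$ (i, j)" if ij: "i < d * d" "j < d * d" for i j
  proof -
    note di = div_mod_less[OF ij(1)] and dj = div_mod_less[OF ij(2)]
    show ?thesis using asym_proj_symmetric[OF di dj] by (simp only: div_mult_mod_eq)
  qed
  then show ?thesis by (simp add: hermitian_def)
qed

lemma asym_proj_mult:
  assumes A: "A \<in> carrier_mat (d * d) (d * d)"
    and as: "\<And>x y x' y'. x < d \<Longrightarrow> y < d \<Longrightarrow> x' < d \<Longrightarrow> y' < d \<Longrightarrow>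
       A $$ (y * d + x, x' * d + y') = - (A $$ (x * d + y, x' * d + y'))"
  shows "asym_proj d * A = A"
proof (rule eq_matI)
  fix i j assume "i < dim_row A" "j < dim_col A"
  then have ij: "i < d * d" "j < d * d" using A by auto
  note di = div_mod_less[OF ij(1)] and dj = div_mod_less[OF ij(2)]
  have "(asym_proj d * A) $$ (i, j) = (\<Sum>k<d * d. asym_proj d $$ (i, k) * A $$ (k, j))"
    using ij A carrier_matD[OF asym_proj_carrier, of d] by (simp add: scalar_prod_def lessThan_atLeast0)
  also have "\<dots> = (\<Sum>a<d. \<Sum>b<d. asym_proj d $$ (i div d * d + i mod d, a * d + b) * A $$ (a * d + b, j div d * d + j mod d))"
    by (simp only: sum_mult_index div_mult_mod_eq)
  also have "\<dots> = A $$ (i div d * d + i mod d, j div d * d + j mod d)"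
    unfolding asym_proj_apply[OF di] as[OF di dj] by simp
  finally show "(asym_proj d * A) $$ (i, j) = A $$ (i, j)" by (simp only: div_mult_mod_eq)
qed (use A carrier_matD[OF asym_proj_carrier, of d] in simp_all)

lemma asym_proj_idem: "asym_proj d * asym_proj d = asym_proj d"
  by (rule asym_proj_mult[OF asym_proj_carrier])
     (simp only: asym_proj_index mult_minus_right[symmetric] minus_diff_eq)

lemma antisymmetric_state_carrier [simp]: "antisymmetric_state d \<in> carrier_mat (d * d) (d * d)"
  by (simp add: antisymmetric_state_def minus_carrier_mat)

lemma antisymmetric_state_index:
  assumes "x < d" "y < d" "x' < d" "y' < d"
  shows "antisymmetric_state d $$ (x * d + y, x' * d + y')
    = complex_of_real (1 / (real d * (real d - 1))) * ((if x = x' \<and> y = y' then 1 else 0) - (if y = x' \<and> x = y' then 1 else 0))"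
proof -
  have "antisymmetric_state d $$ (x * d + y, x' * d + y')
    = complex_of_real (1 / (real d * (real d - 1))) * (1\<^sub>m (d * d) $$ (x * d + y, x' * d + y') - swap_op d $$ (x * d + y, x' * d + y'))"
    using index_less[OF assms(1,2)] index_less[OF assms(3,4)]
    by (simp add: antisymmetric_state_def carrier_matD[OF swap_op_carrier])
  then show ?thesis unfolding one_mat_index[OF assms] swap_op_index[OF assms] .
qed

lemma majorant_index:
  assumes "x < d" "y < d" "x' < d" "y' < d"
  shows "majorant d $$ (x * d + y, x' * d + y')
    = complex_of_real (1 / (real d * (real d - 1))) * ((if x = x' \<and> y = y' then 1 else 0)
      + complex_of_real (1 - 2 / real d) * (if y = x' \<and> x = y' then 1 else 0))"
proof -
  have "majorant d $$ (x * d + y, x' * d + y')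
    = complex_of_real (1 / (real d * (real d - 1))) * (1\<^sub>m (d * d) $$ (x * d + y, x' * d + y')
      + complex_of_real (1 - 2 / real d) * swap_op d $$ (x * d + y, x' * d + y'))"
    using index_less[OF assms(1,2)] index_less[OF assms(3,4)]
    by (simp add: majorant_def carrier_matD[OF swap_op_carrier])
  then show ?thesis unfolding one_mat_index[OF assms] swap_op_index[OF assms] .
qed

lemma asym_proj_antisymmetric_state: "asym_proj d * antisymmetric_state d = antisymmetric_state d"
  by (rule asym_proj_mult[OF antisymmetric_state_carrier])
     (simp only: antisymmetric_state_index mult_minus_right[symmetric] minus_diff_eq)

lemma mtrace_antisymmetric_state:
  assumes "2 \<le> d"
  shows "mtrace (antisymmetric_state d) = 1"
proof -
  have "mtrace (antisymmetric_state d) = complex_of_real (1 / (real d * (real d - 1))) * (\<Sum>x<d. \<Sum>y<d. 1 - (if y = x then 1 else 0))"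
    unfolding sum_distrib_left mtrace_def carrier_matD(1)[OF antisymmetric_state_carrier] sum_mult_index
    by (intro sum.cong refl) (simp add: antisymmetric_state_index)
  also have "(\<Sum>x<d. \<Sum>y<d. 1 - (if y = x then 1 else 0)) = complex_of_real (real d * (real d - 1))"
    by (simp add: sum_subtractf algebra_simps)
  finally show ?thesis using assms unfolding of_real_mult[symmetric] by simp
qed

section \<open>The range of the antisymmetric projector\<close>

lemma asym2_cong:
  "(\<And>i j. i < d ^ n \<Longrightarrow> j < d ^ n \<Longrightarrow> p i j = q i j) \<Longrightarrow> asym2 d n q \<Longrightarrow> asym2 d n p"
proof (induct n arbitrary: p q)
  case (Suc n)
  have b: "block (d ^ n) p x y i j = block (d ^ n) q x y i j" if "x < d" "y < d" "i < d ^ n" "j < d ^ n" for x y i j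
    unfolding block_def by (rule Suc.prems(1)) (use that index_less in auto)
  show ?case unfolding asym2.simps
  proof (intro allI impI conjI)
    fix x y assume xy: "x < d" "y < d"
    show "asym2 d n (block (d ^ n) p x y)"
      by (rule Suc.hyps[OF b[OF xy] asym2_SucD(1)[OF Suc.prems(2) xy]])
    fix i j assume ij: "i < d ^ n" "j < d ^ n"
    show "block (d ^ n) p y x i j = - block (d ^ n) p x y i j"
      unfolding b[OF xy ij] b[OF xy(2,1) ij] by (rule asym2_SucD(2)[OF Suc.prems(2) xy ij])
  qed
qed simp

definition bip_apply :: "nat \<Rightarrow> complex mat \<Rightarrow> (nat \<Rightarrow> nat \<Rightarrow> complex) \<Rightarrow> nat \<Rightarrow> nat \<Rightarrow> complex" where
  "bip_apply N M v i j = (\<Sum>i'<N. \<Sum>j'<N. M $$ (i * N + j, i' * N + j') * v i' j')"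

text \<open>The projector of the outermost factor makes each block of the image half a difference of
  two images under the smaller power. By linearity such a difference is itself an image, so the
  induction hypothesis, for arbitrary \<open>v\<close>, applies to it.\<close>

lemma asym2_range: "asym2 d n (bip_apply (d ^ n) (bip_power d d (asym_proj d) n) v)"
proof (induct n arbitrary: v)
  case (Suc n)
  let ?N = "d ^ n" and ?W = "bip_power d d (asym_proj d)"
  let ?p = "bip_apply (d ^ Suc n) (?W (Suc n)) v"
  let ?g = "\<lambda>x y i j. bip_apply ?N (?W n) (block ?N v x y) i j"
  have b: "block ?N ?p x y i j = 1 / 2 * (?g x y i j - ?g y x i j)"
    if "x < d" "y < d" "i < ?N" "j < ?N" for x y i j
  proof -
    have "block ?N ?p x y i j = (\<Sum>x'<d. \<Sum>i'<?N. \<Sum>y'<d. \<Sum>j'<?N.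
       ?W (Suc n) $$ ((x * ?N + i) * d ^ Suc n + (y * ?N + j), (x' * ?N + i') * d ^ Suc n + (y' * ?N + j')) * block ?N v x' y' i' j')"
      unfolding block_def bip_apply_def power_Suc sum_mult_index ..
    also have "\<dots> = (\<Sum>x'<d. \<Sum>i'<?N. \<Sum>y'<d. \<Sum>j'<?N.
       asym_proj d $$ (x * d + y, x' * d + y') * (?W n $$ (i * ?N + j, i' * ?N + j') * block ?N v x' y' i' j'))"
      by (intro sum.cong refl, subst bip_power_index) (use that in simp_all)
    also have "\<dots> = (\<Sum>x'<d. \<Sum>y'<d. \<Sum>i'<?N. \<Sum>j'<?N.
       asym_proj d $$ (x * d + y, x' * d + y') * (?W n $$ (i * ?N + j, i' * ?N + j') * block ?N v x' y' i' j'))"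
      by (intro sum.cong refl sum.swap)
    also have "\<dots> = (\<Sum>x'<d. \<Sum>y'<d. asym_proj d $$ (x * d + y, x' * d + y') * ?g x' y' i j)"
      by (simp only: bip_apply_def sum_distrib_left)
    finally show ?thesis unfolding asym_proj_apply[OF that(1,2)] .
  qed
  have lin: "1 / 2 * (?g x y i j - ?g y x i j) = bip_apply ?N (?W n) (\<lambda>i j. 1 / 2 * (block ?N v x y i j - block ?N v y x i j)) i j" for x y i j
    unfolding bip_apply_def by (simp only: sum_distrib_left sum_subtractf[symmetric] right_diff_distrib mult_ac)
  show ?case unfolding asym2.simps
  proof (intro allI impI conjI)
    fix x y assume xy: "x < d" "y < d"
    show "asym2 d n (block ?N ?p x y)"
      by (rule asym2_cong[OF _ Suc[of "\<lambda>i j. 1 / 2 * (block ?N v x y i j - block ?N v y x i j)"]])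
         (simp only: b[OF xy] lin)
    fix i j assume ij: "i < ?N" "j < ?N"
    show "block ?N ?p y x i j = - block ?N ?p x y i j"
      unfolding b[OF xy ij] b[OF xy(2,1) ij] by (simp only: mult_minus_right[symmetric] minus_diff_eq)
  qed
qed simp

text \<open>For \<open>p = W (f \<otimes> g)\<close> the expectation \<open>T\<close> of the
  projector is both the squared norm of \<open>p\<close> and the overlap of \<open>p\<close> with
  the product vector. The overlap bound applied to \<open>p\<close> reads
  \<open>T ^ 4 \<le> (3 / 4) ^ n * (F * G * T)\<^sup>2\<close>, and \<open>T\<^sup>2\<close>
  cancels.\<close>

lemma antisymmetric_overlap_pure_product:
  defines "W \<equiv> \<lambda>d n. bip_power d d (asym_proj d) n"
  shows "Re (mtrace (W d n * pure_product (d ^ n) (d ^ n) f g))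
    \<le> sqrt ((3 / 4) ^ n) * ((\<Sum>x<d ^ n. (cmod (f x))\<^sup>2) * (\<Sum>y<d ^ n. (cmod (g y))\<^sup>2))"
proof -
  define N where "N = d ^ n"
  define F where "F = (\<Sum>x<N. (cmod (f x))\<^sup>2)"
  define G where "G = (\<Sum>x<N. (cmod (g x))\<^sup>2)"
  define p where "p = bip_apply N (W d n) (\<lambda>i j. f i * g j)"
  define T where "T = (\<Sum>i<N. \<Sum>j<N. (cmod (p i j))\<^sup>2)"
  have nn: "0 \<le> F" "0 \<le> G" "0 \<le> T" by (simp_all add: F_def G_def T_def sum_nonneg)
  have Wc: "W d n \<in> carrier_mat (N * N) (N * N)" by (simp add: W_def N_def)
  have H: "hermitian (N * N) (W d n)" unfolding W_def N_def by (rule hermitian_bip_power[OF hermitian_asym_proj])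
  have I: "W d n * W d n = W d n" unfolding W_def by (simp add: bip_power_mult asym_proj_idem)
  have m: "mtrace (W d n * pure_product N N f g) = (\<Sum>i<N. \<Sum>j<N. cnj (f i) * cnj (g j) * p i j)"
    unfolding mtrace_mult_pure_product[OF Wc] p_def bip_apply_def sum_distrib_left by (simp add: mult_ac)
  let ?v = "\<lambda>k. f (k div N) * g (k mod N)"
  have pv: "(\<Sum>k<N * N. W d n $$ (i, k) * ?v k) = p (i div N) (i mod N)" for i
    unfolding sum_mult_index p_def bip_apply_def by (intro sum.cong refl) (simp add: index_div_mod)
  have "qform (N * N) (W d n) ?v = (\<Sum>i<N. \<Sum>j<N. cnj (f i) * cnj (g j) * p i j)"
    unfolding qform_app pv unfolding sum_mult_index by (intro sum.cong refl) (simp add: index_div_mod)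
  moreover have "qform (N * N) (W d n) ?v = complex_of_real T"
    unfolding projection_norm[OF H I, symmetric] pv unfolding T_def sum_mult_index
    by (intro arg_cong[where f = complex_of_real] sum.cong refl) (simp add: index_div_mod)
  ultimately have T: "(\<Sum>i<N. \<Sum>j<N. cnj (f i) * cnj (g j) * p i j) = complex_of_real T" by simp
  have as: "asym2 d n p" unfolding p_def N_def W_def by (rule asym2_range)
  have "T ^ 4 = (cmod (\<Sum>i<N. \<Sum>j<N. cnj (f i) * cnj (g j) * p i j)) ^ 4" unfolding T using nn by simp
  also have "\<dots> \<le> (3 / 4) ^ n * (F * G * T)\<^sup>2"
    using overlap_bound[OF as, of "\<lambda>i. cnj (f i)" "\<lambda>i. cnj (g i)"] unfolding N_def[symmetric] by (simp add: F_def G_def T_def)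
  finally have T4: "T ^ 4 \<le> (3 / 4) ^ n * (F * G * T)\<^sup>2" .
  have "T \<le> sqrt ((3 / 4) ^ n) * (F * G)"
  proof (cases "T = 0")
    case True then show ?thesis using nn by simp
  next
    case False
    have "T\<^sup>2 * T\<^sup>2 \<le> ((3 / 4) ^ n * (F * G)\<^sup>2) * T\<^sup>2"
      using T4 by (simp add: power_mult_distrib power2_eq_square eval_nat_numeral mult_ac)
    then have "T\<^sup>2 \<le> (3 / 4) ^ n * (F * G)\<^sup>2"
      by (rule mult_right_le_imp_le) (use False in simp)
    also have "\<dots> = (sqrt ((3 / 4) ^ n) * (F * G))\<^sup>2" by (simp add: power_mult_distrib)
    finally show ?thesis by (rule power2_le_imp_le) (use nn in simp)
  qed
  then show ?thesis unfolding N_def[symmetric] m T by (simp add: F_def G_def)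
qed


section \<open>Domination after partial transposition\<close>

text \<open>The sesquilinear form of the partial transpose of the operator with matrix \<open>B\<close>.\<close>

definition pform :: "nat \<Rightarrow> (ix4 \<Rightarrow> complex) \<Rightarrow> (nat \<Rightarrow> nat \<Rightarrow> complex) \<Rightarrow> (nat \<Rightarrow> nat \<Rightarrow> complex) \<Rightarrow> complex" where
  "pform N B u w = (\<Sum>i<N. \<Sum>j<N. \<Sum>i'<N. \<Sum>j'<N. cnj (u i j') * B (i, j, i', j') * w i' j)"

definition entries :: "nat \<Rightarrow> complex mat \<Rightarrow> ix4 \<Rightarrow> complex" where
  "entries N M = (\<lambda>(i, j, i', j'). M $$ (i * N + j, i' * N + j'))"

text \<open>A product vector remains one under partial transposition, with \<open>g\<close>
  conjugated, so positivity of \<open>pform\<close> controls expectations in product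
  vectors.\<close>

lemma mtrace_pure_product_pform:
  assumes "M \<in> carrier_mat (N * N) (N * N)"
  shows "mtrace (M * pure_product N N f g) = pform N (entries N M) (\<lambda>i j. f i * cnj (g j)) (\<lambda>i j. f i * cnj (g j))"
  unfolding mtrace_mult_pure_product[OF assms] pform_def entries_def
  by (intro sum.cong refl) simp

lemma pform_diff_right: "pform N B u (\<lambda>i j. v i j - w i j) = pform N B u v - pform N B u w"
  unfolding pform_def by (simp only: right_diff_distrib sum_subtractf)

lemma pform_diff_left: "pform N B (\<lambda>i j. v i j - w i j) u = pform N B v u - pform N B w u"
  unfolding pform_def complex_cnj_diff by (simp only: left_diff_distrib sum_subtractf)

lemma pform_sum_right: "pform N B u (\<lambda>i j. \<Sum>x<(m::nat). v x i j) = (\<Sum>x<m. pform N B u (v x))"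
proof (induct m)
  case (Suc m)
  have "pform N B u (\<lambda>i j. \<Sum>x<Suc m. v x i j) = pform N B u (\<lambda>i j. \<Sum>x<m. v x i j) + pform N B u (v m)"
    unfolding pform_def sum.lessThan_Suc by (simp only: distrib_left sum.distrib)
  then show ?case using Suc by simp
qed (simp add: pform_def)

lemma pform_sum_left: "pform N B (\<lambda>i j. \<Sum>x<(m::nat). v x i j) u = (\<Sum>x<m. pform N B (v x) u)"
proof (induct m)
  case (Suc m)
  have "pform N B (\<lambda>i j. \<Sum>x<Suc m. v x i j) u = pform N B (\<lambda>i j. \<Sum>x<m. v x i j) u + pform N B (v m) u"
    unfolding pform_def sum.lessThan_Suc complex_cnj_add by (simp only: distrib_right sum.distrib)
  then show ?case using Suc by simp
qed (simp add: pform_def)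

lemma pform_scale: "pform N (\<lambda>q. c * B q) u w = c * pform N B u w"
  unfolding pform_def sum_distrib_left by (simp only: mult_ac)

lemma pform_add: "pform N (\<lambda>q. B q + B' q) u w = pform N B u w + pform N B' u w"
  unfolding pform_def by (simp only: distrib_left distrib_right sum.distrib)

lemma pform_cong: "(\<And>q. q \<in> Q4 N \<Longrightarrow> B q = B' q) \<Longrightarrow> pform N B u w = pform N B' u w"
  unfolding pform_def by (intro sum.cong refl) (simp add: Q4_def)

lemma pform_join:
  "pform (d * N) B u w = (\<Sum>x<d. \<Sum>y<d. \<Sum>x'<d. \<Sum>y'<d.
     pform N (\<lambda>q. B (join4 N (x, y, x', y') q)) (block N u x y') (block N w x' y))"
proof -
  let ?F = "\<lambda>(i, j, i', j'). cnj (u i j') * B (i, j, i', j') * w i' j"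
  have "pform (d * N) B u w = (\<Sum>r\<in>Q4 (d * N). ?F r)" by (simp only: pform_def sum_Q4 prod.case)
  also have "\<dots> = (\<Sum>p\<in>Q4 d. \<Sum>q\<in>Q4 N. ?F (join4 N p q))" by (rule sum_Q4_join)
  also have "\<dots> = (\<Sum>x<d. \<Sum>y<d. \<Sum>x'<d. \<Sum>y'<d.
     pform N (\<lambda>q. B (join4 N (x, y, x', y') q)) (block N u x y') (block N w x' y))"
    by (simp only: pform_def sum_Q4 join4.simps prod.case block_def)
  finally show ?thesis .
qed

text \<open>Cauchy--Schwarz for the positive form \<open>B\<close>, applied to \<open>d\<close> vectors and their sum.\<close>

lemma pform_sum_le:
  assumes "\<And>v. 0 \<le> Re (pform N B v v)"
  shows "Re (pform N B (\<lambda>i j. \<Sum>x<(d::nat). v x i j) (\<lambda>i j. \<Sum>x<d. v x i j)) \<le> real d * (\<Sum>x<d. Re (pform N B (v x) (v x)))"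
proof -
  let ?b = "\<lambda>x y. Re (pform N B (v x) (v y))"
  have "0 \<le> (\<Sum>x<d. \<Sum>y<d. Re (pform N B (\<lambda>i j. v x i j - v y i j) (\<lambda>i j. v x i j - v y i j)))"
    by (intro sum_nonneg assms)
  also have "\<dots> = (\<Sum>x<d. \<Sum>y<d. ?b x x - ?b x y - (?b y x - ?b y y))"
    by (simp only: pform_diff_left pform_diff_right minus_complex.simps)
  also have "\<dots> = real d * (\<Sum>x<d. ?b x x) - (\<Sum>x<d. \<Sum>y<d. ?b x y) - ((\<Sum>x<d. \<Sum>y<d. ?b y x) - real d * (\<Sum>y<d. ?b y y))"
    by (simp add: sum_subtractf sum_distrib_left)
  also have "(\<Sum>x<d. \<Sum>y<d. ?b y x) = (\<Sum>x<d. \<Sum>y<d. ?b x y)" by (rule sum.swap)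
  finally have "(\<Sum>x<d. \<Sum>y<d. ?b x y) \<le> real d * (\<Sum>x<d. ?b x x)" by simp
  moreover have "Re (pform N B (\<lambda>i j. \<Sum>x<d. v x i j) (\<lambda>i j. \<Sum>x<d. v x i j)) = (\<Sum>x<d. \<Sum>y<d. ?b x y)"
    by (simp only: pform_sum_left pform_sum_right Re_sum)
  ultimately show ?thesis by simp
qed

text \<open>Partial transposition is left to \<open>pform\<close>. The sign is a parameter because
  the induction step for \<open>s\<close> calls on both \<open>s\<close> and
  \<open>- s\<close>.\<close>

definition signed_sum :: "nat \<Rightarrow> real \<Rightarrow> nat \<Rightarrow> ix4 \<Rightarrow> complex" where
  "signed_sum d s n = (\<lambda>q. entries (d ^ n) (bip_power d d (majorant d) n) q
     + complex_of_real s * entries (d ^ n) (bip_power d d (antisymmetric_state d) n) q)"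

text \<open>\<open>P\<close> and \<open>Q\<close> stand for the entries of the identity and the
  swap, \<open>A\<close> and \<open>B\<close> for entries of the powers. Half the sum of majorant
  and antisymmetric state is \<open>c (1 - F / d)\<close>, half their difference is
  \<open>F / d^2\<close>; the coefficients agree because \<open>c - c / d = 1 / d^2\<close>.\<close>

lemma signed_sum_identity:
  fixes A B :: complex
  assumes "d \<ge> 2"
  defines "c \<equiv> 1 / (real d * (real d - 1))"
  shows "complex_of_real c * ((if P then 1 else 0) + complex_of_real (1 - 2 / real d) * (if Q then 1 else 0)) * A
      + complex_of_real s * (complex_of_real c * ((if P then 1 else 0) - (if Q then 1 else 0)) * B)
    = complex_of_real (c * (if P then 1 else 0)) * (A + complex_of_real s * B)
      + (complex_of_real (- (c / real d) * (if Q then 1 else 0)) * (A + complex_of_real s * B)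
      + complex_of_real (1 / (real d)\<^sup>2 * (if Q then 1 else 0)) * (A + complex_of_real (- s) * B))"
proof -
  have e: "c * (1 - 2 / real d) = - (c / real d) + 1 / (real d)\<^sup>2" "- c = - (c / real d) - 1 / (real d)\<^sup>2"
    using assms by (simp_all add: field_simps power2_eq_square)
  have e': "complex_of_real c * complex_of_real (1 - 2 / real d) = complex_of_real (- (c / real d)) + complex_of_real (1 / (real d)\<^sup>2)"
    "- complex_of_real c = complex_of_real (- (c / real d)) - complex_of_real (1 / (real d)\<^sup>2)"
    unfolding of_real_mult[symmetric] of_real_add[symmetric] of_real_minus[symmetric] of_real_diff[symmetric] e by (rule refl)+
  define u where "u = complex_of_real (- (c / real d))"
  define w where "w = complex_of_real (1 / (real d)\<^sup>2)"
  define t where "t = complex_of_real (1 - 2 / real d)"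
  have f: "complex_of_real c * t = u + w" unfolding u_def w_def t_def by (rule e'(1))
  have "- complex_of_real c = u - w" unfolding u_def w_def by (rule e'(2))
  then have "- (- complex_of_real c) = - (u - w)" by (simp only:)
  then have f2: "complex_of_real c = w - u" by (simp only: minus_minus minus_diff_eq)
  have "(complex_of_real c * t) * A + complex_of_real s * (- complex_of_real c * B)
    = u * (A + complex_of_real s * B) + w * (A - complex_of_real s * B)"
    unfolding f unfolding f2 by (simp add: algebra_simps)
  then have g: "complex_of_real c * t * A - complex_of_real s * (complex_of_real c * B) = u * (A + complex_of_real s * B) + w * (A - complex_of_real s * B)" by simp
  show ?thesis unfolding of_real_mult[of _ "if _ then _ else _"] u_def[symmetric] w_def[symmetric] t_def[symmetric]
    using g by (cases P; cases Q) (simp_all add: algebra_simps)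
qed

lemma signed_sum_join4:
  assumes "2 \<le> d" "x < d" "y < d" "x' < d" "y' < d" "q \<in> Q4 (d ^ n)"
  defines "c \<equiv> 1 / (real d * (real d - 1))"
  shows "signed_sum d s (Suc n) (join4 (d ^ n) (x, y, x', y') q)
    = complex_of_real (c * (if x = x' \<and> y = y' then 1 else 0)) * signed_sum d s n q
      + (complex_of_real (- (c / real d) * (if y = x' \<and> x = y' then 1 else 0)) * signed_sum d s n q
      + complex_of_real (1 / (real d)\<^sup>2 * (if y = x' \<and> x = y' then 1 else 0)) * signed_sum d (- s) n q)"
proof -
  obtain i j i' j' where q: "q = (i, j, i', j')" and l: "i < d ^ n" "j < d ^ n" "i' < d ^ n" "j' < d ^ n"
    using assms(6) by (cases q) (auto simp: Q4_def)
  have ent: "entries (d ^ Suc n) (bip_power d d X (Suc n)) (join4 (d ^ n) (x, y, x', y') q)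
      = X $$ (x * d + y, x' * d + y') * entries (d ^ n) (bip_power d d X n) q" if "X \<in> carrier_mat (d * d) (d * d)" for X
    unfolding entries_def q join4.simps prod.case by (rule bip_power_index[OF that assms(2-5) l])
  have sc: "majorant d \<in> carrier_mat (d * d) (d * d)" by (simp add: majorant_def)
  show ?thesis
    unfolding signed_sum_def ent[OF sc] ent[OF antisymmetric_state_carrier] majorant_index[OF assms(2-5)]
      antisymmetric_state_index[OF assms(2-5)] c_def
    by (rule signed_sum_identity[OF assms(1)])
qed

text \<open>With \<open>S\<close> and \<open>A\<close> the partial transposes of \<open>majorant d\<close> and of the antisymmetric state,
  \<open>S \<otimes> S\<^sub>n \<plusminus> A \<otimes> A\<^sub>n\<close> is half of \<open>(S + A) \<otimes> (S\<^sub>n \<plusminus> A\<^sub>n) + (S - A) \<otimes> (S\<^sub>n \<mp> A\<^sub>n)\<close>, and \<open>S \<plusminus> A\<close> are positive.\<close>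

lemma signed_sum_positive:
  assumes d: "2 \<le> d" and s: "s = 1 \<or> s = - 1"
  shows "0 \<le> Re (pform (d ^ n) (signed_sum d s n) v v)"
  using s
proof (induct n arbitrary: s v)
  case 0
  have "pform 1 (signed_sum d s 0) v v = complex_of_real ((1 + s) * (cmod (v 0 0))\<^sup>2)"
    by (simp add: pform_def signed_sum_def entries_def mult.commute mult.left_commute cnj_mult_self[symmetric] del: of_real_power)
  then show ?case using 0 by auto
next
  case (Suc n)
  let ?N = "d ^ n"
  define c where "c = 1 / (real d * (real d - 1))"
  define P where "P = (\<lambda>s u w. pform ?N (signed_sum d s n) u w)"
  define b where "b = (\<lambda>x y. block ?N v x y)"
  define w where "w = (\<lambda>i j. \<Sum>x<d. b x x i j)"
  have cpos: "0 \<le> c" using d by (simp add: c_def)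
  have "pform (d ^ Suc n) (signed_sum d s (Suc n)) v v = (\<Sum>x<d. \<Sum>y<d. \<Sum>x'<d. \<Sum>y'<d.
     complex_of_real (c * (if x = x' \<and> y = y' then 1 else 0)) * P s (b x y') (b x' y)
      + (complex_of_real (- (c / real d) * (if y = x' \<and> x = y' then 1 else 0)) * P s (b x y') (b x' y)
      + complex_of_real (1 / (real d)\<^sup>2 * (if y = x' \<and> x = y' then 1 else 0)) * P (- s) (b x y') (b x' y)))"
    unfolding power_Suc pform_join
  proof (intro sum.cong refl)
    fix x y x' y' assume l: "x \<in> {..<d}" "y \<in> {..<d}" "x' \<in> {..<d}" "y' \<in> {..<d}"
    have "pform ?N (\<lambda>q. signed_sum d s (Suc n) (join4 ?N (x, y, x', y') q)) (block ?N v x y') (block ?N v x' y)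
      = pform ?N (\<lambda>q. complex_of_real (c * (if x = x' \<and> y = y' then 1 else 0)) * signed_sum d s n q
      + (complex_of_real (- (c / real d) * (if y = x' \<and> x = y' then 1 else 0)) * signed_sum d s n q
      + complex_of_real (1 / (real d)\<^sup>2 * (if y = x' \<and> x = y' then 1 else 0)) * signed_sum d (- s) n q)) (block ?N v x y') (block ?N v x' y)"
      unfolding c_def by (rule pform_cong, rule signed_sum_join4[OF d]) (use l in simp_all)
    then show "pform ?N (\<lambda>q. signed_sum d s (Suc n) (join4 ?N (x, y, x', y') q)) (block ?N v x y') (block ?N v x' y)
      = complex_of_real (c * (if x = x' \<and> y = y' then 1 else 0)) * P s (b x y') (b x' y)
      + (complex_of_real (- (c / real d) * (if y = x' \<and> x = y' then 1 else 0)) * P s (b x y') (b x' y)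
      + complex_of_real (1 / (real d)\<^sup>2 * (if y = x' \<and> x = y' then 1 else 0)) * P (- s) (b x y') (b x' y))"
      by (simp only: pform_add pform_scale P_def b_def)
  qed
  also have "\<dots> = complex_of_real c * (\<Sum>x<d. \<Sum>y<d. P s (b x y) (b x y))
      + (complex_of_real (- (c / real d)) * (\<Sum>x<d. \<Sum>y<d. P s (b x x) (b y y))
      + complex_of_real (1 / (real d)\<^sup>2) * (\<Sum>x<d. \<Sum>y<d. P (- s) (b x x) (b y y)))"
  proof -
    have 1: "(\<Sum>x<d. \<Sum>y<d. \<Sum>x'<d. \<Sum>y'<d. complex_of_real (k * (if x = x' \<and> y = y' then 1 else 0)) * f x y x' y')
       = complex_of_real k * (\<Sum>x<d. \<Sum>y<d. f x y x y)" for k f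
    proof -
      have "(\<Sum>x<d. \<Sum>y<d. \<Sum>x'<d. \<Sum>y'<d. complex_of_real (k * (if x = x' \<and> y = y' then 1 else 0)) * f x y x' y')
        = (\<Sum>x<d. \<Sum>y<d. \<Sum>x'<d. \<Sum>y'<d. if x = x' \<and> y = y' then complex_of_real k * f x y x' y' else 0)"
        by (intro sum.cong refl) simp
      also have "\<dots> = (\<Sum>x<d. \<Sum>y<d. complex_of_real k * f x y x y)"
        by (intro sum.cong refl sum_delta2) simp_all
      finally show ?thesis by (simp only: sum_distrib_left)
    qed
    have 2: "(\<Sum>x<d. \<Sum>y<d. \<Sum>x'<d. \<Sum>y'<d. complex_of_real (k * (if y = x' \<and> x = y' then 1 else 0)) * f x y x' y')
       = complex_of_real k * (\<Sum>x<d. \<Sum>y<d. f x y y x)" for k f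
    proof -
      have "(\<Sum>x<d. \<Sum>y<d. \<Sum>x'<d. \<Sum>y'<d. complex_of_real (k * (if y = x' \<and> x = y' then 1 else 0)) * f x y x' y')
        = (\<Sum>x<d. \<Sum>y<d. \<Sum>x'<d. \<Sum>y'<d. if y = x' \<and> x = y' then complex_of_real k * f x y x' y' else 0)"
        by (intro sum.cong refl) simp
      also have "\<dots> = (\<Sum>x<d. \<Sum>y<d. complex_of_real k * f x y y x)"
        by (intro sum.cong refl sum_delta2) simp_all
      finally show ?thesis by (simp only: sum_distrib_left)
    qed
    show ?thesis by (simp only: sum.distrib 1 2)
  qed
  \<comment> \<open>After partial transposition the swap couples only diagonal blocks, and its form
    depends on nothing but their sum \<open>w\<close>.\<close>
  also have "(\<Sum>x<d. \<Sum>y<d. P s (b x x) (b y y)) = P s w w"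
    unfolding P_def w_def pform_sum_left pform_sum_right ..
  also have "(\<Sum>x<d. \<Sum>y<d. P (- s) (b x x) (b y y)) = P (- s) w w"
    unfolding P_def w_def pform_sum_left pform_sum_right ..
  finally have "Re (pform (d ^ Suc n) (signed_sum d s (Suc n)) v v)
     = c * (\<Sum>x<d. \<Sum>y<d. Re (P s (b x y) (b x y))) - c / real d * Re (P s w w) + 1 / (real d)\<^sup>2 * Re (P (- s) w w)"
    by (simp add: Re_sum)
  moreover have "0 \<le> Re (P (- s) w w)" unfolding P_def by (rule Suc.hyps) (use Suc.prems in auto)
  \<comment> \<open>Positivity of the summand from \<open>c (1 - F / d)\<close>: Cauchy-Schwarz for
    the \<open>d\<close> diagonal blocks in \<open>w\<close> costs a factor \<open>d\<close>,
    cancelled by \<open>1 / d\<close>, and the off-diagonal blocks only enlarge the right-hand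
    side.\<close>
  moreover have "c / real d * Re (P s w w) \<le> c * (\<Sum>x<d. \<Sum>y<d. Re (P s (b x y) (b x y)))"
  proof -
    have nn: "0 \<le> Re (P s u u)" for u unfolding P_def by (rule Suc.hyps[OF Suc.prems])
    have "Re (P s w w) \<le> real d * (\<Sum>x<d. Re (P s (b x x) (b x x)))"
      unfolding P_def w_def by (rule pform_sum_le) (rule Suc.hyps[OF Suc.prems])
    also have "\<dots> \<le> real d * (\<Sum>x<d. \<Sum>y<d. Re (P s (b x y) (b x y)))"
      by (intro mult_left_mono sum_mono member_le_sum nn) auto
    finally have "c / real d * Re (P s w w) \<le> c / real d * (real d * (\<Sum>x<d. \<Sum>y<d. Re (P s (b x y) (b x y))))"
      by (intro mult_left_mono) (use cpos in simp_all)
    then show ?thesis using d by simp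
  qed
  ultimately show ?case by simp
qed

text \<open>The case \<open>s = - 1\<close> of the positivity, at a product vector; the case
  \<open>s = 1\<close> serves the induction.\<close>

lemma antisymmetric_le_majorant_pure_product:
  assumes "2 \<le> d"
  shows "Re (mtrace (bip_power d d (antisymmetric_state d) n * pure_product (d ^ n) (d ^ n) f g))
    \<le> Re (mtrace (bip_power d d (majorant d) n * pure_product (d ^ n) (d ^ n) f g))"
proof -
  let ?v = "\<lambda>i j. f i * cnj (g j)"
  have "pform (d ^ n) (signed_sum d (- 1) n) ?v ?v
      = mtrace (bip_power d d (majorant d) n * pure_product (d ^ n) (d ^ n) f g) + complex_of_real (- 1) * mtrace (bip_power d d (antisymmetric_state d) n * pure_product (d ^ n) (d ^ n) f g)"
    unfolding signed_sum_def pform_add pform_scale mtrace_pure_product_pform[OF bip_power_carrier] ..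
  then show ?thesis using signed_sum_positive[OF assms, of "- 1" n ?v] by simp
qed


subsection \<open>Dually non-entangling maps\<close>

definition unit_mat :: "nat \<Rightarrow> nat \<Rightarrow> nat \<Rightarrow> complex mat" where
  "unit_mat n i j = mat n n (\<lambda>(a, b). if a = i \<and> b = j then 1 else 0)"

lemma unit_mat_carrier [simp]: "unit_mat n i j \<in> carrier_mat n n"
  by (simp add: unit_mat_def)

text \<open>Induction over the entries of \<open>Y\<close> in row order, with \<open>T k\<close>
  keeping the first \<open>k\<close> of them; finite sums of matrices are thereby avoided.\<close>

lemma linear_functional_expand:
  fixes L :: "complex mat \<Rightarrow> complex"
  assumes add: "\<And>X Y. X \<in> carrier_mat n n \<Longrightarrow> Y \<in> carrier_mat n n \<Longrightarrow> L (X + Y) = L X + L Y"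
    and scale: "\<And>c X. X \<in> carrier_mat n n \<Longrightarrow> L (c \<cdot>\<^sub>m X) = c * L X"
    and Y: "Y \<in> carrier_mat n n"
  shows "L Y = (\<Sum>i<n. \<Sum>j<n. Y $$ (i, j) * L (unit_mat n i j))"
proof -
  define T where "T = (\<lambda>k. mat n n (\<lambda>(a, b). if a * n + b < k then Y $$ (a, b) else 0))"
  have T: "T k \<in> carrier_mat n n" for k by (simp add: T_def)
  have "L (T k) = (\<Sum>r<k. Y $$ (r div n, r mod n) * L (unit_mat n (r div n) (r mod n)))" if "k \<le> n * n" for k
    using that
  proof (induct k)
    case 0
    have "T 0 = 0 \<cdot>\<^sub>m unit_mat n 0 0" unfolding T_def unit_mat_def by (rule eq_matI) auto
    then show ?case using scale[of "unit_mat n 0 0" 0] by simp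
  next
    case (Suc k)
    then have k: "k < n * n" by simp
    have "T (Suc k) = T k + Y $$ (k div n, k mod n) \<cdot>\<^sub>m unit_mat n (k div n) (k mod n)" (is "_ = ?R")
    proof (rule eq_matI)
      fix a b assume "a < dim_row ?R" "b < dim_col ?R"
      then have ab: "a < n" "b < n" by (simp_all add: unit_mat_def)
      have "a * n + b = k \<longleftrightarrow> a = k div n \<and> b = k mod n"
        unfolding index_eq_iff[of "a * n + b" k n] index_div_mod[OF ab(2)] ..
      then show "T (Suc k) $$ (a, b) = ?R $$ (a, b)"
        using ab by (auto simp: T_def unit_mat_def less_Suc_eq)
    qed (simp_all add: T_def unit_mat_def)
    then have "L (T (Suc k)) = L (T k) + Y $$ (k div n, k mod n) * L (unit_mat n (k div n) (k mod n))"
      by (simp add: add T scale)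
    then show ?case using Suc by simp
  qed
  then have "L (T (n * n)) = (\<Sum>r<n * n. Y $$ (r div n, r mod n) * L (unit_mat n (r div n) (r mod n)))" by simp
  also have "\<dots> = (\<Sum>i<n. \<Sum>j<n. Y $$ (i, j) * L (unit_mat n i j))"
    unfolding sum_mult_index by (intro sum.cong refl) (simp add: index_div_mod)
  also have "T (n * n) = Y"
    by (rule eq_matI) (use Y in \<open>auto simp: T_def index_less\<close>)
  finally show ?thesis .
qed

lemma mtrace_mult_unit_mat:
  assumes "Z \<in> carrier_mat n n" "i < n" "j < n"
  shows "mtrace (Z * unit_mat n i j) = Z $$ (j, i)"
proof -
  have "mtrace (Z * unit_mat n i j) = (\<Sum>a<n. \<Sum>b<n. if j = a \<and> i = b then Z $$ (a, b) else 0)"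
    unfolding mtrace_mult[OF assms(1) unit_mat_carrier]
    by (intro sum.cong refl) (auto simp: unit_mat_def)
  then show ?thesis unfolding sum_delta2[OF assms(3,2)] .
qed

lemma mtrace_mult_add:
  assumes "X \<in> carrier_mat n n" "A \<in> carrier_mat n n" "B \<in> carrier_mat n n"
  shows "mtrace (X * (A + B)) = mtrace (X * A) + mtrace (X * B)"
  unfolding mult_add_distrib_mat[OF assms]
  by (rule mtrace_add[OF mult_carrier_mat[OF assms(1,2)] mult_carrier_mat[OF assms(1,3)]])

lemma mtrace_mult_smult:
  assumes "X \<in> carrier_mat n n" "A \<in> carrier_mat n n"
  shows "mtrace (X * (c \<cdot>\<^sub>m A)) = c * mtrace (X * A)"
  unfolding mult_smult_distrib[OF assms] by (rule mtrace_smult[OF mult_carrier_mat[OF assms]])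

lemma mtrace_smult_mult:
  assumes "X \<in> carrier_mat n n" "A \<in> carrier_mat n n"
  shows "mtrace ((c \<cdot>\<^sub>m X) * A) = c * mtrace (X * A)"
  unfolding mult_smult_assoc_mat[OF assms] by (rule mtrace_smult[OF mult_carrier_mat[OF assms]])

lemma mtrace_mult_diff:
  assumes "X \<in> carrier_mat n n" "A \<in> carrier_mat n n" "B \<in> carrier_mat n n"
  shows "mtrace (X * (A - B)) = mtrace (X * A) - mtrace (X * B)"
  unfolding mtrace_mult[OF assms(1,2)] mtrace_mult[OF assms(1,3)] mtrace_mult[OF assms(1) minus_carrier_mat[OF assms(3)]]
    sum_subtractf[symmetric]
  by (intro sum.cong refl) (use assms in \<open>simp add: right_diff_distrib\<close>)

text \<open>\<open>adjoint_map\<close> is a definite description. Values on matrix units supply a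
  candidate, and traces against matrix units recover every entry, whence uniqueness.\<close>

lemma adjoint_map_props:
  assumes lin: "linear_map n m \<Xi>" and X: "X \<in> carrier_mat m m"
  shows "adjoint_map n \<Xi> X \<in> carrier_mat n n"
    and "Y \<in> carrier_mat n n \<Longrightarrow> mtrace (X * \<Xi> Y) = mtrace (adjoint_map n \<Xi> X * Y)"
proof -
  have c: "\<Xi> Y \<in> carrier_mat m m" if "Y \<in> carrier_mat n n" for Y using lin that by (simp add: linear_map_def)
  define Z where "Z = mat n n (\<lambda>(i, j). mtrace (X * \<Xi> (unit_mat n j i)))"
  have Z: "Z \<in> carrier_mat n n" by (simp add: Z_def)
  have e: "mtrace (X * \<Xi> Y) = mtrace (Z * Y)" if Y: "Y \<in> carrier_mat n n" for Y
  proof -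
    have "mtrace (X * \<Xi> Y) = (\<Sum>i<n. \<Sum>j<n. Y $$ (i, j) * mtrace (X * \<Xi> (unit_mat n i j)))"
    proof (rule linear_functional_expand[OF _ _ Y])
      fix A B :: "complex mat" assume AB: "A \<in> carrier_mat n n" "B \<in> carrier_mat n n"
      then have "\<Xi> (A + B) = \<Xi> A + \<Xi> B" using lin by (simp add: linear_map_def)
      then show "mtrace (X * \<Xi> (A + B)) = mtrace (X * \<Xi> A) + mtrace (X * \<Xi> B)"
        using mtrace_mult_add[OF X c[OF AB(1)] c[OF AB(2)]] by simp
    next
      fix k and A :: "complex mat" assume A: "A \<in> carrier_mat n n"
      then have "\<Xi> (k \<cdot>\<^sub>m A) = k \<cdot>\<^sub>m \<Xi> A" using lin by (simp add: linear_map_def)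
      then show "mtrace (X * \<Xi> (k \<cdot>\<^sub>m A)) = k * mtrace (X * \<Xi> A)"
        using mtrace_mult_smult[OF X c[OF A]] by simp
    qed
    also have "\<dots> = (\<Sum>j<n. \<Sum>i<n. Z $$ (j, i) * Y $$ (i, j))"
      by (subst sum.swap) (simp add: Z_def mult.commute)
    finally show ?thesis unfolding mtrace_mult[OF Z Y] .
  qed
  have "adjoint_map n \<Xi> X = Z" unfolding adjoint_map_def
  proof (rule the_equality)
    show "Z \<in> carrier_mat n n \<and> (\<forall>Y\<in>carrier_mat n n. mtrace (X * \<Xi> Y) = mtrace (Z * Y))" using Z e by simp
    fix Z' assume Z': "Z' \<in> carrier_mat n n \<and> (\<forall>Y\<in>carrier_mat n n. mtrace (X * \<Xi> Y) = mtrace (Z' * Y))"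
    then have Z'c: "Z' \<in> carrier_mat n n" by simp
    show "Z' = Z"
    proof (rule eq_matI)
      fix i j assume "i < dim_row Z" "j < dim_col Z"
      then have ij: "i < n" "j < n" using Z by auto
      have "mtrace (Z' * unit_mat n j i) = mtrace (Z * unit_mat n j i)" 
        using bspec[OF conjunct2[OF Z'] unit_mat_carrier[of n j i]] e[OF unit_mat_carrier[of n j i]] by (simp only:)
      then show "Z' $$ (i, j) = Z $$ (i, j)"
        unfolding mtrace_mult_unit_mat[OF Z'c ij(2,1)] mtrace_mult_unit_mat[OF Z ij(2,1)] .
    qed (use Z Z'c in auto)
  qed
  then show "adjoint_map n \<Xi> X \<in> carrier_mat n n"
    and "Y \<in> carrier_mat n n \<Longrightarrow> mtrace (X * \<Xi> Y) = mtrace (adjoint_map n \<Xi> X * Y)" using Z e by simp_all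
qed

lemma completely_positive_psd:
  assumes cp: "completely_positive n m \<Xi>" and X: "psd n X"
  shows "psd m (\<Xi> X)"
proof -
  have Xc: "X \<in> carrier_mat n n" by (rule psd_carrier[OF X])
  then have c: "\<Xi> X \<in> carrier_mat m m" using cp by (simp add: completely_positive_def linear_map_def)
  have "psd (1 * n) X" using X by simp
  then have "psd (1 * m) (ampliation 1 n m \<Xi> X)" using cp unfolding completely_positive_def by blast
  moreover have "ampliation 1 n m \<Xi> X = \<Xi> X"
  proof (rule eq_matI)
    fix i j assume "i < dim_row (\<Xi> X)" "j < dim_col (\<Xi> X)"
    then have ij: "i < m" "j < m" using c by auto
    have "mat n n (\<lambda>(x, y). X $$ (0 * n + x, 0 * n + y)) = X" by (rule eq_matI) (use Xc in auto)
    then show "ampliation 1 n m \<Xi> X $$ (i, j) = \<Xi> X $$ (i, j)" using ij by (simp add: ampliation_def)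
  qed (use c in \<open>simp_all add: ampliation_def\<close>)
  ultimately show ?thesis by simp
qed

section \<open>Traces and the operator order\<close>

lemma mtrace_mult_spectral:
  assumes X: "X \<in> carrier_mat n n" and Y: "Y \<in> carrier_mat n n" and E: "eigenbasis n Y e l"
  shows "mtrace (X * Y) = (\<Sum>k<n. complex_of_real (l k) * qform n X (e k))"
proof -
  have "mtrace (X * Y) = (\<Sum>i<n. \<Sum>j<n. \<Sum>k<n. complex_of_real (l k) * (cnj (e k i) * X $$ (i, j) * e k j))"
    unfolding mtrace_mult[OF X Y]
    by (intro sum.cong refl) (simp add: eigenbasisD(4)[OF E] sum_distrib_left mult_ac)
  also have "\<dots> = (\<Sum>i<n. \<Sum>k<n. \<Sum>j<n. complex_of_real (l k) * (cnj (e k i) * X $$ (i, j) * e k j))"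
    by (intro sum.cong refl sum.swap)
  also have "\<dots> = (\<Sum>k<n. \<Sum>i<n. \<Sum>j<n. complex_of_real (l k) * (cnj (e k i) * X $$ (i, j) * e k j))"
    by (rule sum.swap)
  finally show ?thesis by (simp only: qform_def sum_distrib_left)
qed

lemma mtrace_psd_mult_nonneg:
  assumes X: "psd n X" and Y: "psd n Y"
  shows "0 \<le> Re (mtrace (X * Y))"
proof -
  obtain e l where E: "eigenbasis n Y e l" and l: "\<forall>k<n. 0 \<le> l k" by (rule psd_spectral[OF Y])
  have "0 \<le> Re (qform n X v)" for v using X by (simp add: psd_iff less_eq_complex_def)
  then show ?thesis unfolding mtrace_mult_spectral[OF psd_carrier[OF X] psd_carrier[OF Y] E]
    using l by (auto intro!: sum_nonneg)
qed

lemma mtrace_loewner_mono: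
  assumes X: "psd n X" and AB: "loewner_le n A B"
  shows "Re (mtrace (X * A)) \<le> Re (mtrace (X * B))"
proof -
  have c: "A \<in> carrier_mat n n" "B \<in> carrier_mat n n" and p: "psd n (B - A)" using AB by (auto simp: loewner_le_def)
  show ?thesis using mtrace_psd_mult_nonneg[OF X p] mtrace_mult_diff[OF psd_carrier[OF X] c(2,1)] by simp
qed

text \<open>No eigenvalue exceeds the trace. This crude bound makes the set in
  \<open>robustness\<close> nonempty for every state, so that its infimum is meaningful.\<close>

lemma psd_le_trace:
  assumes Y: "psd n Y"
  shows "loewner_le n Y (mtrace Y \<cdot>\<^sub>m 1\<^sub>m n)"
proof -
  obtain e l where E: "eigenbasis n Y e l" and l: "\<forall>k<n. 0 \<le> l k" by (rule psd_spectral[OF Y])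
  have Yc: "Y \<in> carrier_mat n n" by (rule psd_carrier[OF Y])
  define t where "t = (\<Sum>k<n. l k)"
  have "mtrace Y = (\<Sum>i<n. \<Sum>k<n. complex_of_real (l k) * (cnj (e k i) * e k i))"
    using Yc unfolding mtrace_def by (intro sum.cong) (simp_all add: eigenbasisD(4)[OF E] mult_ac)
  also have "\<dots> = (\<Sum>k<n. complex_of_real (l k) * (\<Sum>i<n. cnj (e k i) * e k i))"
    by (subst sum.swap) (simp only: sum_distrib_left)
  finally have t: "mtrace Y = complex_of_real t" by (simp add: eigenbasisD(2)[OF E] t_def)
  have Ye: "Y = mat n n (\<lambda>(i,j). \<Sum>k<n. complex_of_real (l k) * e k i * cnj (e k j))"
    by (rule eq_matI) (use Yc eigenbasisD(4)[OF E] in auto)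
  have "0 \<le> qform n (mtrace Y \<cdot>\<^sub>m 1\<^sub>m n - Y) v" for v
  proof -
    define V where "V = (\<Sum>i<n. (cmod (v i))\<^sup>2)"
    have "qform n (mtrace Y \<cdot>\<^sub>m 1\<^sub>m n - Y) v = (\<Sum>i<n. \<Sum>j<n. (if j = i then mtrace Y * (cnj (v i) * v j) else 0) - cnj (v i) * Y $$ (i, j) * v j)"
      unfolding qform_def by (intro sum.cong refl) (use Yc in \<open>auto simp: algebra_simps\<close>)
    also have "\<dots> = mtrace Y * (\<Sum>i<n. cnj (v i) * v i) - qform n Y v"
      by (simp add: sum_subtractf qform_def sum_distrib_left)
    also have "\<dots> = complex_of_real (t * V - (\<Sum>k<n. l k * (cmod (\<Sum>i<n. cnj (e k i) * v i))\<^sup>2))"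
      by (subst Ye) (simp only: qform_rank_one_sum t sum_cnj_self V_def of_real_mult of_real_diff)
    finally have q: "qform n (mtrace Y \<cdot>\<^sub>m 1\<^sub>m n - Y) v = complex_of_real (t * V - (\<Sum>k<n. l k * (cmod (\<Sum>i<n. cnj (e k i) * v i))\<^sup>2))" .
    have "(\<Sum>k<n. l k * (cmod (\<Sum>i<n. cnj (e k i) * v i))\<^sup>2) \<le> (\<Sum>k<n. l k * V)"
    proof (intro sum_mono mult_left_mono)
      fix k assume k: "k \<in> {..<n}"
      show "0 \<le> l k" using l k by simp
      have "(cmod (\<Sum>i<n. cnj (e k i) * v i))\<^sup>2 \<le> (\<Sum>i<n. (cmod (cnj (e k i)))\<^sup>2) * V"
        unfolding V_def by (rule Cauchy_Schwarz_complex_sum)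
      moreover have "complex_of_real (\<Sum>i<n. (cmod (e k i))\<^sup>2) = 1"
        using eigenbasisD(2)[OF E, of k k] k by (simp only: sum_cnj_self) simp
      ultimately show "(cmod (\<Sum>i<n. cnj (e k i) * v i))\<^sup>2 \<le> V" by (simp only: complex_mod_cnj of_real_eq_1_iff mult_1)
    qed
    also have "\<dots> = t * V" by (simp add: t_def sum_distrib_right)
    finally show ?thesis unfolding q by (simp add: less_eq_complex_def)
  qed
  then show ?thesis using Yc by (simp add: loewner_le_def psd_iff minus_carrier_mat)
qed

lemma maximally_mixed_separable:
  assumes "0 < a" "0 < b"
  shows "complex_of_real (1 / (real a * real b)) \<cdot>\<^sub>m 1\<^sub>m (a * b) \<in> separable a b"
proof (rule sep_cone_separable)
  show "sep_cone a b (complex_of_real (1 / (real a * real b)) \<cdot>\<^sub>m 1\<^sub>m (a * b))"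
    by (intro sep_cone_smult sep_cone_one) simp
  show "mtrace (complex_of_real (1 / (real a * real b)) \<cdot>\<^sub>m 1\<^sub>m (a * b)) = 1"
    unfolding mtrace_smult[OF one_carrier_mat] mtrace_one using assms by simp
qed (use assms in auto)

text \<open>A slack \<open>e\<close> replaces the compactness argument for attaining the minimum.
  The set is nonempty because a state is below the identity, which is \<open>a * b\<close> times the
  maximally mixed state.\<close>

lemma robustness_witness:
  assumes ab: "0 < a" "0 < b" and \<rho>: "psd (a * b) \<rho>" "mtrace \<rho> = 1"
    and le: "robustness a b \<rho> \<le> \<delta>" and e: "0 < e"
  obtains r \<sigma> where "0 \<le> r" "r \<le> \<delta> + e" "\<sigma> \<in> separable a b" "loewner_le (a * b) \<rho> (complex_of_real (1 + r) \<cdot>\<^sub>m \<sigma>)"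
proof -
  let ?R = "{r. 0 \<le> r \<and> (\<exists>\<sigma> \<in> separable a b. loewner_le (a * b) \<rho> (complex_of_real (1 + r) \<cdot>\<^sub>m \<sigma>))}"
  let ?\<sigma> = "complex_of_real (1 / (real a * real b)) \<cdot>\<^sub>m 1\<^sub>m (a * b)"
  have "complex_of_real (1 + (real a * real b - 1)) \<cdot>\<^sub>m ?\<sigma> = mtrace \<rho> \<cdot>\<^sub>m 1\<^sub>m (a * b)"
    by (rule eq_matI) (use ab in \<open>simp_all add: \<rho>(2)\<close>)
  then have "loewner_le (a * b) \<rho> (complex_of_real (1 + (real a * real b - 1)) \<cdot>\<^sub>m ?\<sigma>)"
    using psd_le_trace[OF \<rho>(1)] by simp
  moreover have "0 \<le> real a * real b - 1" using mult_mono[of 1 "real a" 1 "real b"] ab by simp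
  ultimately have "real a * real b - 1 \<in> ?R" using maximally_mixed_separable[OF ab] by blast
  then have ne: "?R \<noteq> {}" by blast
  have "Inf ?R < \<delta> + e" using le e unfolding robustness_def by linarith
  from cInf_lessD[OF ne this] show ?thesis using that by force
qed

lemma robustness_separable:
  assumes "\<sigma> \<in> separable a b"
  shows "robustness a b \<sigma> \<le> 0"
  unfolding robustness_def
proof (rule cInf_lower)
  have c: "\<sigma> \<in> carrier_mat (a * b) (a * b)" by (rule sep_cone_carrier[OF separable_sep_cone(1)[OF assms]])
  have "complex_of_real (1 + 0) \<cdot>\<^sub>m \<sigma> - \<sigma> = 0\<^sub>m (a * b) (a * b)" by (rule eq_matI) (use c in auto)
  then have "loewner_le (a * b) \<sigma> (complex_of_real (1 + 0) \<cdot>\<^sub>m \<sigma>)"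
    using c psd_zero[of "a * b"] by (simp add: loewner_le_def)
  then show "0 \<in> {r. 0 \<le> r \<and> (\<exists>\<tau> \<in> separable a b. loewner_le (a * b) \<sigma> (complex_of_real (1 + r) \<cdot>\<^sub>m \<tau>))}"
    using assms by blast
qed (auto intro!: bdd_belowI[of _ 0])

text \<open>The Kraus operators are \<open>|0><x|\<close>: the form of the ampliation is a sum over
  \<open>x\<close> of values of the form of \<open>X\<close>, at vectors supported where the inner
  index is \<open>x\<close>.\<close>

lemma completely_positive_replacement:
  assumes m: "0 < m" and \<sigma>c: "\<sigma> \<in> carrier_mat m m"
    and \<sigma>i: "\<And>i j. i < m \<Longrightarrow> j < m \<Longrightarrow> \<sigma> $$ (i, j) = (if i = 0 \<and> j = 0 then 1 else 0)"
  shows "completely_positive n m (\<lambda>X. mtrace X \<cdot>\<^sub>m \<sigma>)"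
proof -
  define \<Theta> where "\<Theta> = (\<lambda>X :: complex mat. mtrace X \<cdot>\<^sub>m \<sigma>)"
  have lin: "linear_map n m \<Theta>"
    unfolding linear_map_def \<Theta>_def using \<sigma>c
    by (auto simp: mtrace_add[of _ n] mtrace_smult[of _ n] add_smult_distrib_right_mat[of _ m m])
  have "psd (k * m) (ampliation k n m \<Theta> X)" if X: "psd (k * n) X" for k X
  proof -
    have "0 \<le> qform (k * m) (ampliation k n m \<Theta> X) v" for v
    proof -
      let ?B = "\<lambda>I J. \<Sum>x<n. X $$ (I * n + x, J * n + x)"
      have amp: "ampliation k n m \<Theta> X $$ (I * m + i, J * m + j) = (if 0 = i \<and> 0 = j then ?B I J else 0)"
        if "I < k" "J < k" "i < m" "j < m" for I J i j
        using that \<sigma>c by (simp add: ampliation_def \<Theta>_def index_less index_div_mod[of _ m] \<sigma>i mtrace_def)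
      have "qform (k * m) (ampliation k n m \<Theta> X) v
        = (\<Sum>I<k. \<Sum>i<m. \<Sum>J<k. \<Sum>j<m. if 0 = i \<and> 0 = j then cnj (v (I * m + i)) * ?B I J * v (J * m + j) else 0)"
        unfolding qform_def sum_mult_index by (intro sum.cong refl) (simp add: amp)
      also have "\<dots> = (\<Sum>I<k. \<Sum>J<k. \<Sum>i<m. \<Sum>j<m. if 0 = i \<and> 0 = j then cnj (v (I * m + i)) * ?B I J * v (J * m + j) else 0)"
        by (intro sum.cong refl sum.swap)
      also have "\<dots> = (\<Sum>I<k. \<Sum>J<k. cnj (v (I * m + 0)) * ?B I J * v (J * m + 0))"
        by (intro sum.cong refl sum_delta2 m)
      also have "\<dots> = (\<Sum>I<k. \<Sum>J<k. \<Sum>x<n. cnj (v (I * m)) * X $$ (I * n + x, J * n + x) * v (J * m))"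
        by (simp add: sum_distrib_left sum_distrib_right)
      also have "\<dots> = (\<Sum>I<k. \<Sum>x<n. \<Sum>J<k. cnj (v (I * m)) * X $$ (I * n + x, J * n + x) * v (J * m))"
        by (intro sum.cong refl sum.swap)
      also have "\<dots> = (\<Sum>x<n. \<Sum>I<k. \<Sum>J<k. cnj (v (I * m)) * X $$ (I * n + x, J * n + x) * v (J * m))"
        by (rule sum.swap)
      also have "\<dots> = (\<Sum>x<n. qform (k * n) X (\<lambda>r. if r mod n = x then v (r div n * m) else 0))"
      proof (intro sum.cong refl)
        fix x assume "x \<in> {..<n}"
        then have x: "x < n" by simp
        let ?w = "\<lambda>r. if r mod n = x then v (r div n * m) else 0"
        have "qform (k * n) X ?w = (\<Sum>I<k. \<Sum>i<n. \<Sum>J<k. \<Sum>j<n. if x = i \<and> x = j then cnj (v (I * m)) * X $$ (I * n + i, J * n + j) * v (J * m) else 0)"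
          unfolding qform_def sum_mult_index by (intro sum.cong refl) (auto simp: index_div_mod[of _ n])
        also have "\<dots> = (\<Sum>I<k. \<Sum>J<k. \<Sum>i<n. \<Sum>j<n. if x = i \<and> x = j then cnj (v (I * m)) * X $$ (I * n + i, J * n + j) * v (J * m) else 0)"
          by (intro sum.cong refl sum.swap)
        also have "\<dots> = (\<Sum>I<k. \<Sum>J<k. cnj (v (I * m)) * X $$ (I * n + x, J * n + x) * v (J * m))"
          by (intro sum.cong refl sum_delta2 x)
        finally show "(\<Sum>I<k. \<Sum>J<k. cnj (v (I * m)) * X $$ (I * n + x, J * n + x) * v (J * m)) = qform (k * n) X ?w" ..
      qed
      finally show ?thesis using X by (simp add: psd_iff sum_nonneg)
    qed
    then show ?thesis by (simp add: psd_iff ampliation_def)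
  qed
  then show ?thesis unfolding \<Theta>_def[symmetric] using lin by (simp add: completely_positive_def)
qed

text \<open>The infimum over an empty set of reals is an unspecified number, so it matters that replacing
  every state by a fixed product state is an element of \<open>DNE\<close>.\<close>

lemma DNE_nonempty:
  assumes ab: "0 < a" "0 < b" "0 < a'" "0 < b'" and \<delta>: "0 \<le> \<delta>"
  shows "DNE \<delta> a b a' b' \<noteq> {}"
proof -
  let ?n = "a * b" and ?m = "a' * b'"
  have m: "0 < ?m" using ab by simp
  define \<sigma> where "\<sigma> = pure_product a' b' (\<lambda>i. of_bool (i = 0)) (\<lambda>i. of_bool (i = 0))"
  have \<sigma>c: "\<sigma> \<in> carrier_mat ?m ?m" by (simp add: \<sigma>_def)
  have \<sigma>i: "\<sigma> $$ (i, j) = (if i = 0 \<and> j = 0 then 1 else 0)" if "i < ?m" "j < ?m" for i j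
  proof -
    have z: "k = 0 \<longleftrightarrow> k div b' = 0 \<and> k mod b' = 0" for k using index_eq_iff[of k 0 b'] by simp
    show ?thesis unfolding \<sigma>_def pure_product_def z[of i] z[of j] using that
      by (cases "i div b' = 0"; cases "i mod b' = 0"; cases "j div b' = 0"; cases "j mod b' = 0") simp_all
  qed
  have \<sigma>t: "mtrace \<sigma> = 1"
  proof -
    have "mtrace \<sigma> = (\<Sum>i<?m. if i = 0 then 1 else 0)"
      unfolding mtrace_def carrier_matD(1)[OF \<sigma>c] by (intro sum.cong refl) (simp add: \<sigma>i)
    then show ?thesis using ab by simp
  qed
  have \<sigma>s: "\<sigma> \<in> separable a' b'"
    by (rule sep_cone_separable[OF _ ab(3,4) \<sigma>t]) (simp add: \<sigma>_def sep_cone_pure_product)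
  define \<Theta> where "\<Theta> = (\<lambda>X :: complex mat. mtrace X \<cdot>\<^sub>m \<sigma>)"
  have cp: "completely_positive ?n ?m \<Theta>"
    unfolding \<Theta>_def by (rule completely_positive_replacement[OF m \<sigma>c \<sigma>i])
  then have lin: "linear_map ?n ?m \<Theta>" by (simp add: completely_positive_def)
  have tp: "trace_preserving ?n \<Theta>" unfolding trace_preserving_def \<Theta>_def mtrace_smult[OF \<sigma>c] \<sigma>t by simp
  have ne: "robustness a' b' (\<Theta> \<tau>) \<le> \<delta>" if "\<tau> \<in> separable a b" for \<tau>
  proof -
    have "\<Theta> \<tau> = \<sigma>" unfolding \<Theta>_def separable_sep_cone(2)[OF that] by (rule eq_matI) simp_all
    then show ?thesis using robustness_separable[OF \<sigma>s] \<delta> by simp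
  qed
  have "adjoint_map ?n \<Theta> X \<in> cone (separable a b)" if X: "X \<in> separable a' b'" for X
  proof -
    have Xp: "psd ?m X" by (rule sep_cone_psd[OF separable_sep_cone(1)[OF X]])
    then have Xc: "X \<in> carrier_mat ?m ?m" by (rule psd_carrier)
    define t where "t = Re (mtrace (X * \<sigma>))"
    have tq: "mtrace (X * \<sigma>) = qform ?m X (\<lambda>k. if k = 0 then 1 else 0)"
    proof -
      have "mtrace (X * \<sigma>) = (\<Sum>i<?m. \<Sum>j<?m. if 0 = i \<and> 0 = j then X $$ (i, j) else 0)"
        unfolding mtrace_mult[OF Xc \<sigma>c] by (intro sum.cong refl) (simp add: \<sigma>i)
      then show ?thesis unfolding sum_delta2[OF m m] qform_one[OF m] by simp
    qed
    have "0 \<le> mtrace (X * \<sigma>)" unfolding tq using Xp by (simp add: psd_iff)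
    then have t: "mtrace (X * \<sigma>) = complex_of_real t" "0 \<le> t" by (simp_all add: t_def less_eq_complex_def complex_eq_iff)
    note adj = adjoint_map_props[OF lin Xc]
    \<comment> \<open>The adjoint of a replacement map takes only multiples of the identity as
      values, so it lands in the cone over the maximally mixed state.\<close>
    have "adjoint_map ?n \<Theta> X = complex_of_real t \<cdot>\<^sub>m 1\<^sub>m ?n"
    proof (rule eq_matI)
      fix i j assume "i < dim_row (complex_of_real t \<cdot>\<^sub>m 1\<^sub>m ?n)" "j < dim_col (complex_of_real t \<cdot>\<^sub>m 1\<^sub>m ?n)"
      then have ij: "i < ?n" "j < ?n" by auto
      have "adjoint_map ?n \<Theta> X $$ (i, j) = mtrace (X * \<Theta> (unit_mat ?n j i))"
        using mtrace_mult_unit_mat[OF adj(1) ij(2,1)] adj(2)[OF unit_mat_carrier] by simp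
      also have "\<dots> = mtrace (unit_mat ?n j i) * complex_of_real t"
        unfolding \<Theta>_def mtrace_mult_smult[OF Xc \<sigma>c] t(1) ..
      also have "mtrace (unit_mat ?n j i) = mtrace (1\<^sub>m ?n * unit_mat ?n j i)"
        by (simp add: left_mult_one_mat[OF unit_mat_carrier])
      also have "\<dots> = 1\<^sub>m ?n $$ (i, j)" by (rule mtrace_mult_unit_mat[OF one_carrier_mat ij(2,1)])
      finally show "adjoint_map ?n \<Theta> X $$ (i, j) = (complex_of_real t \<cdot>\<^sub>m 1\<^sub>m ?n) $$ (i, j)" using ij by simp
    qed (use adj(1) in auto)
    also have "\<dots> = complex_of_real (t * (real a * real b)) \<cdot>\<^sub>m (complex_of_real (1 / (real a * real b)) \<cdot>\<^sub>m 1\<^sub>m ?n)"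
      by (rule eq_matI) (use ab in simp_all)
    finally have e: "adjoint_map ?n \<Theta> X = complex_of_real (t * (real a * real b)) \<cdot>\<^sub>m (complex_of_real (1 / (real a * real b)) \<cdot>\<^sub>m 1\<^sub>m ?n)" .
    show ?thesis unfolding cone_def
    proof (intro CollectI exI conjI)
      show "0 \<le> t * (real a * real b)" using t(2) by simp
    qed (rule e, rule maximally_mixed_separable[OF ab(1,2)])
  qed
  then have "adjoint_map ?n \<Theta> ` separable a' b' \<subseteq> cone (separable a b)" by (rule image_subsetI)
  then have "\<Theta> \<in> DNE \<delta> a b a' b'" unfolding DNE_def using cp tp ne by simp
  then show ?thesis by blast
qed

section \<open>Powers of the Bell state\<close>

lemma Phi2_carrier [simp]: "Phi2 \<in> carrier_mat (2 * 2) (2 * 2)"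
  by (simp add: Phi2_def ket_bra_def Phi2_ket_def tensor_vec_def)

lemma Phi2_index:
  assumes "x < 2" "y < 2" "x' < 2" "y' < 2"
  shows "Phi2 $$ (x * 2 + y, x' * 2 + y') = (if x = y \<and> x' = y' then 1 / 2 else 0)"
proof -
  have k: "Phi2_ket $ (x * 2 + y) = (if x = y then complex_of_real (1 / sqrt 2) else 0)" if "x < 2" "y < 2" for x y
    using that by (auto simp: Phi2_ket_def tensor_vec_def less_2_cases_iff)
  have s: "complex_of_real (1 / sqrt 2) * complex_of_real (1 / sqrt 2) = 1 / 2"
    unfolding of_real_mult[symmetric] by simp
  have d: "dim_vec Phi2_ket = 2 * 2" by (simp add: Phi2_ket_def tensor_vec_def)
  have "Phi2 $$ (x * 2 + y, x' * 2 + y') = Phi2_ket $ (x * 2 + y) * cnj (Phi2_ket $ (x' * 2 + y'))"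
    using index_less[OF assms(1,2)] index_less[OF assms(3,4)] by (simp add: Phi2_def ket_bra_def d)
  then show ?thesis unfolding k[OF assms(1,2)] k[OF assms(3,4)] using s by simp
qed

text \<open>The leading binary digits of the indices belong to the first Bell pair. Agreement of all
  digits is equality of the numbers, so the power is the maximally entangled state of local
  dimension \<open>2 ^ m\<close>.\<close>

lemma Phi_power_index:
  assumes "x < 2 ^ m" "y < 2 ^ m" "x' < 2 ^ m" "y' < 2 ^ m"
  shows "bip_power 2 2 Phi2 m $$ (x * 2 ^ m + y, x' * 2 ^ m + y') = (if x = y \<and> x' = y' then 1 / 2 ^ m else 0)"
  using assms
proof (induct m arbitrary: x y x' y')
  case 0 then show ?case by simp
next
  case (Suc m)
  let ?K = "2 ^ m :: nat"
  have l: "k div ?K < 2" "k mod ?K < ?K" if "k < 2 ^ Suc m" for k using that div_mod_less[of k 2 ?K] by simp_all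
  have "bip_power 2 2 Phi2 (Suc m) $$ ((x div ?K * ?K + x mod ?K) * 2 ^ Suc m + (y div ?K * ?K + y mod ?K),
      (x' div ?K * ?K + x' mod ?K) * 2 ^ Suc m + (y' div ?K * ?K + y' mod ?K))
    = Phi2 $$ (x div ?K * 2 + y div ?K, x' div ?K * 2 + y' div ?K) * bip_power 2 2 Phi2 m $$ (x mod ?K * ?K + y mod ?K, x' mod ?K * ?K + y' mod ?K)"
    by (rule bip_power_index[OF Phi2_carrier l(1)[OF Suc.prems(1)] l(1)[OF Suc.prems(2)] l(1)[OF Suc.prems(3)] l(1)[OF Suc.prems(4)]
       l(2)[OF Suc.prems(1)] l(2)[OF Suc.prems(2)] l(2)[OF Suc.prems(3)] l(2)[OF Suc.prems(4)]])
  also have "\<dots> = (if x div ?K = y div ?K \<and> x' div ?K = y' div ?K then 1 / 2 else 0) * (if x mod ?K = y mod ?K \<and> x' mod ?K = y' mod ?K then 1 / 2 ^ m else 0)"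
    unfolding Phi2_index[OF l(1)[OF Suc.prems(1)] l(1)[OF Suc.prems(2)] l(1)[OF Suc.prems(3)] l(1)[OF Suc.prems(4)]]
      Suc.hyps[OF l(2)[OF Suc.prems(1)] l(2)[OF Suc.prems(2)] l(2)[OF Suc.prems(3)] l(2)[OF Suc.prems(4)]] ..
  also have "\<dots> = (if (x div ?K = y div ?K \<and> x mod ?K = y mod ?K) \<and> (x' div ?K = y' div ?K \<and> x' mod ?K = y' mod ?K) then 1 / 2 ^ Suc m else 0)"
    by simp
  also have "\<dots> = (if x = y \<and> x' = y' then 1 / 2 ^ Suc m else 0)"
    by (simp only: index_eq_iff[of x y ?K, symmetric] index_eq_iff[of x' y' ?K, symmetric])
  finally show ?case by (simp only: div_mult_mod_eq)
qed

definition max_entangled :: "nat \<Rightarrow> complex mat" where "max_entangled m = bip_power 2 2 Phi2 m"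

lemma max_entangled_carrier [simp]: "max_entangled m \<in> carrier_mat (2 ^ m * 2 ^ m) (2 ^ m * 2 ^ m)"
  unfolding max_entangled_def by simp

lemma max_entangled_index:
  assumes "x < 2 ^ m" "y < 2 ^ m" "x' < 2 ^ m" "y' < 2 ^ m"
  shows "max_entangled m $$ (x * 2 ^ m + y, x' * 2 ^ m + y') = (if x = y \<and> x' = y' then 1 / 2 ^ m else 0)"
  unfolding max_entangled_def by (rule Phi_power_index[OF assms])

lemma mtrace_max_entangled: "mtrace (max_entangled m) = 1"
proof -
  have "mtrace (max_entangled m) = (\<Sum>x<(2 ^ m :: nat). \<Sum>y<2 ^ m. if y = x then 1 / 2 ^ m else 0)"
    unfolding mtrace_def carrier_matD(1)[OF max_entangled_carrier] sum_mult_index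
    by (intro sum.cong refl) (simp add: max_entangled_index)
  then show ?thesis by simp
qed

lemma qform_pairs:
  "qform (K * K) X v = (\<Sum>x<K. \<Sum>y<K. \<Sum>x'<K. \<Sum>y'<K. cnj (v (x * K + y)) * X $$ (x * K + y, x' * K + y') * v (x' * K + y'))"
  unfolding qform_def sum_mult_index ..

lemma qform_diagonal_block:
  fixes K :: nat
  assumes "\<And>x y x' y'. x < K \<Longrightarrow> y < K \<Longrightarrow> x' < K \<Longrightarrow> y' < K \<Longrightarrow> X $$ (x * K + y, x' * K + y') = (if x = y \<and> x' = y' then c else 0)"
  shows "qform (K * K) X v = c * complex_of_real ((cmod (\<Sum>x<K. v (x * K + x)))\<^sup>2)"
proof -
  have "qform (K * K) X v = (\<Sum>x<K. \<Sum>y<K. \<Sum>x'<K. \<Sum>y'<K. if x = y \<and> x' = y' then cnj (v (x * K + y)) * c * v (x' * K + y') else 0)"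
    unfolding qform_pairs by (intro sum.cong refl) (simp add: assms)
  also have "\<dots> = (\<Sum>x<K. \<Sum>y<K. if y = x then (\<Sum>x'<K. cnj (v (x * K + x)) * c * v (x' * K + x')) else 0)"
  proof (intro sum.cong refl)
    fix x y
    show "(\<Sum>x'<K. \<Sum>y'<K. if x = y \<and> x' = y' then cnj (v (x * K + y)) * c * v (x' * K + y') else 0)
       = (if y = x then (\<Sum>x'<K. cnj (v (x * K + x)) * c * v (x' * K + x')) else 0)"
    proof (cases "x = y")
      case True
      then have "(\<Sum>x'<K. \<Sum>y'<K. if x = y \<and> x' = y' then cnj (v (x * K + y)) * c * v (x' * K + y') else 0)
        = (\<Sum>x'<K. \<Sum>y'<K. if y' = x' then cnj (v (x * K + x)) * c * v (x' * K + x') else 0)"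
        by (intro sum.cong refl) auto
      then show ?thesis using True by simp
    qed simp
  qed
  also have "\<dots> = (\<Sum>x<K. \<Sum>x'<K. c * (cnj (v (x * K + x)) * v (x' * K + x')))"
    by (simp add: mult_ac)
  also have "\<dots> = c * ((\<Sum>x<K. cnj (v (x * K + x))) * (\<Sum>x'<K. v (x' * K + x')))"
    by (simp only: sum_product) (simp only: sum_distrib_left)
  also have "(\<Sum>x<K. cnj (v (x * K + x))) = cnj (\<Sum>x<K. v (x * K + x))" by simp
  finally show ?thesis by (simp only: cnj_mult_self)
qed

lemma hermitian_pairsI:
  assumes "X \<in> carrier_mat (K * K) (K * K)"
    and "\<And>x y x' y'. x < K \<Longrightarrow> y < K \<Longrightarrow> x' < K \<Longrightarrow> y' < K \<Longrightarrow> cnj (X $$ (x' * K + y', x * K + y)) = X $$ (x * K + y, x' * K + y')"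
  shows "hermitian (K * K) X"
proof -
  have "cnj (X $$ (j, i)) = X $$ (i, j)" if ij: "i < K * K" "j < K * K" for i j
    using assms(2)[OF div_mod_less[OF ij(1)] div_mod_less[OF ij(2)]] by (simp only: div_mult_mod_eq)
  then show ?thesis using assms(1) by (simp add: hermitian_def)
qed

lemma max_entangled_projection: "hermitian (2 ^ m * 2 ^ m) (max_entangled m)" "max_entangled m * max_entangled m = max_entangled m"
proof -
  let ?K = "2 ^ m :: nat"
  show "hermitian (?K * ?K) (max_entangled m)"
    by (rule hermitian_pairsI[OF max_entangled_carrier]) (simp add: max_entangled_index)
  show "max_entangled m * max_entangled m = max_entangled m"
  proof (rule eq_matI)
    fix i j assume "i < dim_row (max_entangled m)" "j < dim_col (max_entangled m)"
    then have ij: "i < ?K * ?K" "j < ?K * ?K" using carrier_matD[OF max_entangled_carrier, of m] by simp_all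
    note di = div_mod_less[OF ij(1)] and dj = div_mod_less[OF ij(2)]
    define x y x' y' where xy: "x = i div ?K" "y = i mod ?K" "x' = j div ?K" "y' = j mod ?K"
    have l: "x < ?K" "y < ?K" "x' < ?K" "y' < ?K" using di dj by (simp_all only: xy)
    have e: "i = x * ?K + y" "j = x' * ?K + y'" by (simp_all only: xy div_mult_mod_eq)
    have "(max_entangled m * max_entangled m) $$ (i, j) = (\<Sum>k<?K * ?K. max_entangled m $$ (i, k) * max_entangled m $$ (k, j))"
      using ij carrier_matD[OF max_entangled_carrier, of m] by (simp add: scalar_prod_def lessThan_atLeast0)
    also have "\<dots> = (\<Sum>a<?K. \<Sum>b<?K. if b = a then (if x = y \<and> x' = y' then 1 / 2 ^ m * (1 / 2 ^ m) else 0) else 0)"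
      unfolding sum_mult_index e by (intro sum.cong refl) (simp add: max_entangled_index l)
    also have "\<dots> = max_entangled m $$ (i, j)" unfolding e max_entangled_index[OF l] by simp
    finally show "(max_entangled m * max_entangled m) $$ (i, j) = max_entangled m $$ (i, j)" .
  qed (use carrier_matD[OF max_entangled_carrier, of m] in simp_all)
qed

text \<open>\<open>P\<close> is a test passed by \<open>Y\<close> with certainty. Duality for a mere
  contraction lacks the factor 1/2 available for projectors and states; the small error chosen later
  absorbs this.\<close>

lemma trace_norm_lower:
  assumes P: "contraction n P" and X: "X \<in> carrier_mat n n" and Y: "Y \<in> carrier_mat n n" and PY: "mtrace (P * Y) = 1"
  shows "1 - trace_norm (X - Y) \<le> Re (mtrace (P * X))"
proof -
  have Pc: "P \<in> carrier_mat n n" using P by (simp add: contraction_def)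
  have "cmod (mtrace (P * (X - Y))) \<le> trace_norm (X - Y)" by (rule trace_norm_ge[OF minus_carrier_mat[OF Y] P])
  then show ?thesis unfolding mtrace_mult_diff[OF Pc X Y] PY
    using abs_Re_le_cmod[of "mtrace (P * X) - 1"] by simp
qed

section \<open>Bounds for the test operator\<close>

lemma sep_test_carrier [simp]: "sep_test K \<in> carrier_mat (K * K) (K * K)" by (simp add: sep_test_def)

lemma sep_test_index:
  assumes "x < K" "y < K" "x' < K" "y' < K"
  shows "sep_test K $$ (x * K + y, x' * K + y') = (if (x = y \<and> x' = y') \<or> (x = x' \<and> y = y') then 1 else 0)"
  using index_less[OF assms(1,2)] index_less[OF assms(3,4)]
  by (simp only: sep_test_def index_mat prod.case index_div_mod[OF assms(2)] index_div_mod[OF assms(4)])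

lemma mtrace_sep_test: "mtrace (sep_test K) = complex_of_real ((real K)\<^sup>2)"
proof -
  have "mtrace (sep_test K) = (\<Sum>x<K. \<Sum>y<K. 1)"
    unfolding mtrace_def carrier_matD(1)[OF sep_test_carrier] sum_mult_index
    by (intro sum.cong refl) (simp add: sep_test_index)
  then show ?thesis by (simp add: power2_eq_square)
qed

lemma sep_test_ge_max_entangled: "loewner_le (2 ^ m * 2 ^ m) (complex_of_real (2 ^ m) \<cdot>\<^sub>m max_entangled m) (sep_test (2 ^ m))"
proof -
  let ?K = "2 ^ m :: nat"
  let ?D = "sep_test ?K - complex_of_real (2 ^ m) \<cdot>\<^sub>m max_entangled m"
  have D: "?D $$ (x * ?K + y, x' * ?K + y') = (if x = x' \<and> y = y' then (if x = y then 0 else 1) else 0)"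
    if l: "x < ?K" "y < ?K" "x' < ?K" "y' < ?K" for x y x' y'
  proof -
    have "?D $$ (x * ?K + y, x' * ?K + y') = sep_test ?K $$ (x * ?K + y, x' * ?K + y') - complex_of_real (2 ^ m) * max_entangled m $$ (x * ?K + y, x' * ?K + y')"
      using index_less[OF l(1,2)] index_less[OF l(3,4)] carrier_matD[OF max_entangled_carrier, of m] by simp
    then show ?thesis unfolding sep_test_index[OF l] max_entangled_index[OF l]
      by (cases "x = y"; cases "x' = y'"; cases "x = x'"; cases "y = y'") simp_all
  qed
  have "0 \<le> qform (?K * ?K) ?D v" for v
  proof -
    have "qform (?K * ?K) ?D v = (\<Sum>x<?K. \<Sum>y<?K. \<Sum>x'<?K. \<Sum>y'<?K. if x = x' \<and> y = y' then cnj (v (x * ?K + y)) * (if x = y then 0 else 1) * v (x' * ?K + y') else 0)"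
      unfolding qform_pairs by (intro sum.cong refl, subst D) simp_all
    also have "\<dots> = (\<Sum>x<?K. \<Sum>y<?K. cnj (v (x * ?K + y)) * (if x = y then 0 else 1) * v (x * ?K + y))"
      by (intro sum.cong refl sum_delta2) simp_all
    also have "\<dots> = (\<Sum>x<?K. \<Sum>y<?K. complex_of_real (if x = y then 0 else (cmod (v (x * ?K + y)))\<^sup>2))"
      by (intro sum.cong refl) (simp add: cnj_mult_self del: of_real_power)
    finally show ?thesis by (auto intro!: sum_nonneg simp: less_eq_complex_def)
  qed
  then show ?thesis by (simp add: loewner_le_def psd_iff minus_carrier_mat)
qed

text \<open>The projectors onto \<open>|xy>\<close> contribute at most the product of the squared
  norms. So does the entangled part, which is the squared modulus of the sum of all
  \<open>f x * g x\<close>, by Cauchy-Schwarz.\<close>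

lemma sep_test_pure_product_le:
  "Re (mtrace (sep_test K * pure_product K K f g)) \<le> 2 * ((\<Sum>x<K. (cmod (f x))\<^sup>2) * (\<Sum>y<K. (cmod (g y))\<^sup>2))"
proof -
  let ?H = "\<lambda>x y x' y'. f x' * g y' * cnj (f x * g y)"
  have "mtrace (sep_test K * pure_product K K f g) = (\<Sum>x<K. \<Sum>y<K. \<Sum>x'<K. \<Sum>y'<K. sep_test K $$ (x * K + y, x' * K + y') * ?H x y x' y')"
    by (rule mtrace_mult_pure_product[OF sep_test_carrier])
  also have "\<dots> = (\<Sum>x<K. \<Sum>y<K. \<Sum>x'<K. \<Sum>y'<K. (if x = x' \<and> y = y' then ?H x y x' y' * (if x = y then 0 else 1) else 0)
      + (if x = y then (if x' = y' then ?H x y x' y' else 0) else 0))"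
    by (intro sum.cong refl) (simp add: sep_test_index)
  also have "\<dots> = (\<Sum>x<K. \<Sum>y<K. \<Sum>x'<K. \<Sum>y'<K. if x = x' \<and> y = y' then ?H x y x' y' * (if x = y then 0 else 1) else 0)
      + (\<Sum>x<K. \<Sum>y<K. \<Sum>x'<K. \<Sum>y'<K. if x = y then (if x' = y' then ?H x y x' y' else 0) else 0)"
    by (simp only: sum.distrib)
  also have "(\<Sum>x<K. \<Sum>y<K. \<Sum>x'<K. \<Sum>y'<K. if x = x' \<and> y = y' then ?H x y x' y' * (if x = y then 0 else 1) else 0)
      = (\<Sum>x<K. \<Sum>y<K. ?H x y x y * (if x = y then 0 else 1))"
    by (intro sum.cong refl sum_delta2) simp_all
  also have "(\<Sum>x<K. \<Sum>y<K. \<Sum>x'<K. \<Sum>y'<K. if x = y then (if x' = y' then ?H x y x' y' else 0) else 0)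
      = (\<Sum>x<K. \<Sum>x'<K. ?H x x x' x')"
  proof (rule sum.cong[OF refl])
    fix x assume x: "x \<in> {..<K}"
    have "(\<Sum>y<K. \<Sum>x'<K. \<Sum>y'<K. if x = y then (if x' = y' then ?H x y x' y' else 0) else 0)
      = (\<Sum>y<K. if x = y then (\<Sum>x'<K. \<Sum>y'<K. if x' = y' then ?H x y x' y' else 0) else 0)"
      by (intro sum.cong refl) simp
    also have "\<dots> = (\<Sum>x'<K. \<Sum>y'<K. if x' = y' then ?H x x x' y' else 0)" using x by simp
    finally show "(\<Sum>y<K. \<Sum>x'<K. \<Sum>y'<K. if x = y then (if x' = y' then ?H x y x' y' else 0) else 0) = (\<Sum>x'<K. ?H x x x' x')"
      by simp
  qed
  also have "\<dots> = (\<Sum>x<K. \<Sum>x'<K. cnj (f x * g x) * (f x' * g x'))"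
    by (simp only: mult_ac)
  also have "\<dots> = complex_of_real ((cmod (\<Sum>x<K. f x * g x))\<^sup>2)"
    unfolding cnj_mult_self[symmetric] cnj_sum sum_product ..
  also have "(\<Sum>x<K. \<Sum>y<K. ?H x y x y * (if x = y then 0 else 1)) = (\<Sum>x<K. \<Sum>y<K. complex_of_real ((cmod (f x))\<^sup>2 * (cmod (g y))\<^sup>2 * (if x = y then 0 else 1)))"
    by (intro sum.cong refl) (simp add: cnj_mult_self[symmetric] mult_ac del: of_real_power)
  finally have "Re (mtrace (sep_test K * pure_product K K f g)) = (\<Sum>x<K. \<Sum>y<K. (cmod (f x))\<^sup>2 * (cmod (g y))\<^sup>2 * (if x = y then 0 else 1)) + (cmod (\<Sum>x<K. f x * g x))\<^sup>2"
    by (simp only: of_real_sum[symmetric] of_real_add[symmetric] Re_complex_of_real)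
  also have "(\<Sum>x<K. \<Sum>y<K. (cmod (f x))\<^sup>2 * (cmod (g y))\<^sup>2 * (if x = y then 0 else 1)) \<le> (\<Sum>x<K. \<Sum>y<K. (cmod (f x))\<^sup>2 * (cmod (g y))\<^sup>2)"
    by (intro sum_mono) simp
  also have "\<dots> = (\<Sum>x<K. (cmod (f x))\<^sup>2) * (\<Sum>y<K. (cmod (g y))\<^sup>2)" by (simp only: sum_product)
  finally show ?thesis using Cauchy_Schwarz_complex_sum[of f g "{..<K}"] by simp
qed

section \<open>The classically correlated operator\<close>

definition classical :: "nat \<Rightarrow> complex mat" where
  "classical K = mat (K * K) (K * K) (\<lambda>ij. \<Sum>x<K. pure_product K K (\<lambda>i. of_bool (i = x)) (\<lambda>i. of_bool (i = x)) $$ ij)"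

lemma classical_carrier [simp]: "classical K \<in> carrier_mat (K * K) (K * K)" by (simp add: classical_def)

lemma sep_cone_classical: "sep_cone K K (classical K)"
  unfolding classical_def by (intro sep_cone_sum sep_cone_pure_product)

lemma classical_index:
  assumes "x < K" "y < K" "x' < K" "y' < K"
  shows "classical K $$ (x * K + y, x' * K + y') = (if x = x' \<and> y = y' then (if x = y then 1 else 0) else 0)"
proof -
  have "classical K $$ (x * K + y, x' * K + y') = (\<Sum>z<K. if z = x then (if x = x' \<and> y = y' \<and> x = y then 1 else 0) else 0)"
    unfolding classical_def index_mat(1)[OF index_less[OF assms(1,2)] index_less[OF assms(3,4)]]
    by (intro sum.cong refl) (auto simp: pure_product_index[OF assms])
  then show ?thesis using assms by simp
qed

lemma mtrace_classical: "mtrace (classical K) = of_nat K"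
proof -
  have "mtrace (classical K) = (\<Sum>x<K. \<Sum>y<K. if y = x then 1 else 0)"
    unfolding mtrace_def carrier_matD(1)[OF classical_carrier] sum_mult_index
    by (intro sum.cong refl) (simp add: classical_index)
  then show ?thesis by simp
qed

text \<open>Cauchy-Schwarz for the sum of the \<open>2 ^ m\<close> diagonal coefficients loses a
  factor \<open>2 ^ m\<close>, which is the normalisation of the entangled state.\<close>

lemma max_entangled_le_classical: "loewner_le (2 ^ m * 2 ^ m) (max_entangled m) (classical (2 ^ m))"
proof -
  let ?K = "2 ^ m :: nat"
  let ?D = "classical ?K - max_entangled m"
  have "0 \<le> qform (?K * ?K) ?D v" for v
  proof -
    let ?w = "\<lambda>x. v (x * ?K + x)"
    have c: "qform (?K * ?K) (classical ?K) v = complex_of_real (\<Sum>x<?K. (cmod (?w x))\<^sup>2)"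
    proof -
      have "qform (?K * ?K) (classical ?K) v = (\<Sum>x<?K. \<Sum>y<?K. \<Sum>x'<?K. \<Sum>y'<?K. if x = x' \<and> y = y' then cnj (v (x * ?K + y)) * (if x = y then 1 else 0) * v (x' * ?K + y') else 0)"
        unfolding qform_pairs by (intro sum.cong refl) (simp add: classical_index)
      also have "\<dots> = (\<Sum>x<?K. \<Sum>y<?K. cnj (v (x * ?K + y)) * (if x = y then 1 else 0) * v (x * ?K + y))"
        by (intro sum.cong refl sum_delta2) simp_all
      also have "\<dots> = (\<Sum>x<?K. \<Sum>y<?K. if y = x then cnj (?w x) * ?w x else 0)"
        by (intro sum.cong refl) simp
      also have "\<dots> = (\<Sum>x<?K. cnj (?w x) * ?w x)" by simp
      finally show ?thesis by (simp only: sum_cnj_self)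
    qed
    have p: "qform (?K * ?K) (max_entangled m) v = (1 / 2 ^ m) * complex_of_real ((cmod (\<Sum>x<?K. ?w x))\<^sup>2)"
      by (rule qform_diagonal_block) (rule max_entangled_index)
    have "qform (?K * ?K) ?D v = qform (?K * ?K) (classical ?K) v - qform (?K * ?K) (max_entangled m) v"
      unfolding qform_def sum_subtractf[symmetric]
      by (intro sum.cong refl) (use carrier_matD[OF max_entangled_carrier, of m] in \<open>simp add: algebra_simps\<close>)
    also have "\<dots> = complex_of_real ((\<Sum>x<?K. (cmod (?w x))\<^sup>2) - (1 / 2 ^ m) * (cmod (\<Sum>x<?K. ?w x))\<^sup>2)"
      unfolding c p by simp
    finally have q: "qform (?K * ?K) ?D v = complex_of_real ((\<Sum>x<?K. (cmod (?w x))\<^sup>2) - (1 / 2 ^ m) * (cmod (\<Sum>x<?K. ?w x))\<^sup>2)" .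
    have "(cmod (\<Sum>x<?K. 1 * ?w x))\<^sup>2 \<le> (\<Sum>x<?K. (cmod 1)\<^sup>2) * (\<Sum>x<?K. (cmod (?w x))\<^sup>2)"
      by (rule Cauchy_Schwarz_complex_sum)
    then have "(cmod (\<Sum>x<?K. ?w x))\<^sup>2 \<le> 2 ^ m * (\<Sum>x<?K. (cmod (?w x))\<^sup>2)" by simp
    then show ?thesis unfolding q by (simp add: less_eq_complex_def field_simps)
  qed
  then show ?thesis by (simp add: loewner_le_def psd_iff minus_carrier_mat)
qed


subsection \<open>One-shot bounds and rates\<close>

lemma bip_power_smult:
  assumes "X \<in> carrier_mat (a * b) (a * b)"
  shows "bip_power a b (c \<cdot>\<^sub>m X) n = c ^ n \<cdot>\<^sub>m bip_power a b X n"
proof (induct n)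
  case 0 show ?case by (rule eq_matI) auto
next
  case (Suc n)
  have B: "bip_power a b X n \<in> carrier_mat (a ^ n * b ^ n) (a ^ n * b ^ n)" by simp
  show ?case unfolding bip_power.simps(2) Suc
  proof (rule bip_tensor_eqI[where a = a and b = b and c = "a ^ n" and d = "b ^ n"])
    fix x z y w x' z' y' w'
    assume i: "x < a" "z < a ^ n" "y < b" "w < b ^ n" "x' < a" "z' < a ^ n" "y' < b" "w' < b ^ n"
    let ?I = "(x * a ^ n + z) * (b * b ^ n) + (y * b ^ n + w)" and ?J = "(x' * a ^ n + z') * (b * b ^ n) + (y' * b ^ n + w')"
    have l: "?I < (a * a ^ n) * (b * b ^ n)" "?J < (a * a ^ n) * (b * b ^ n)"
      using i by (intro index_less; simp)+
    have m: "z * b ^ n + w < a ^ n * b ^ n" "z' * b ^ n + w' < a ^ n * b ^ n" "x * b + y < a * b" "x' * b + y' < a * b"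
      using i by (intro index_less; simp)+
    have cX: "c \<cdot>\<^sub>m X \<in> carrier_mat (a * b) (a * b)" "c ^ n \<cdot>\<^sub>m bip_power a b X n \<in> carrier_mat (a ^ n * b ^ n) (a ^ n * b ^ n)"
      using assms by simp_all
    have "bip_tensor a b (a ^ n) (b ^ n) (c \<cdot>\<^sub>m X) (c ^ n \<cdot>\<^sub>m bip_power a b X n) $$ (?I, ?J)
      = (c * X $$ (x * b + y, x' * b + y')) * (c ^ n * bip_power a b X n $$ (z * b ^ n + w, z' * b ^ n + w'))"
      unfolding bip_tensor_index[OF cX i] using assms m carrier_matD[OF B] by simp
    also have "\<dots> = c ^ Suc n * bip_tensor a b (a ^ n) (b ^ n) X (bip_power a b X n) $$ (?I, ?J)"
      unfolding bip_tensor_index[OF assms B i] by (simp add: mult_ac)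
    also have "\<dots> = (c ^ Suc n \<cdot>\<^sub>m bip_tensor a b (a ^ n) (b ^ n) X (bip_power a b X n)) $$ (?I, ?J)"
      using l carrier_matD[OF bip_tensor_carrier, of a b "a ^ n" "b ^ n" X "bip_power a b X n"] by simp
    finally show "bip_tensor a b (a ^ n) (b ^ n) (c \<cdot>\<^sub>m X) (c ^ n \<cdot>\<^sub>m bip_power a b X n) $$ (?I, ?J)
      = (c ^ Suc n \<cdot>\<^sub>m bip_tensor a b (a ^ n) (b ^ n) X (bip_power a b X n)) $$ (?I, ?J)" .
  qed simp_all
qed

lemma psd_smult: "psd n X \<Longrightarrow> 0 \<le> t \<Longrightarrow> psd n (complex_of_real t \<cdot>\<^sub>m X)"
proof -
  assume X: "psd n X" and t: "0 \<le> t"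
  have "qform n (complex_of_real t \<cdot>\<^sub>m X) v = complex_of_real t * qform n X v" for v
    unfolding qform_def sum_distrib_left by (intro sum.cong refl) (use psd_carrier[OF X] in \<open>simp add: mult_ac\<close>)
  then show ?thesis using X t by (simp add: psd_iff less_eq_complex_def)
qed

lemma psd_projection: "hermitian n P \<Longrightarrow> P * P = P \<Longrightarrow> psd n P"
proof -
  assume P: "hermitian n P" "P * P = P"
  have "0 \<le> qform n P v" for v
    unfolding projection_norm[OF P, symmetric] less_eq_complex_def by (simp add: sum_nonneg del: of_real_sum)
  then show ?thesis using P by (simp add: psd_iff hermitian_def)
qed

lemma asym_power_projection:
  "hermitian (d ^ n * d ^ n) (bip_power d d (asym_proj d) n)"
  "bip_power d d (asym_proj d) n * bip_power d d (asym_proj d) n = bip_power d d (asym_proj d) n"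
  by (rule hermitian_bip_power[OF hermitian_asym_proj]) (simp add: bip_power_mult asym_proj_idem)

lemma antisymmetric_state_eq:
  assumes "2 \<le> d"
  shows "antisymmetric_state d = complex_of_real (2 / (real d * (real d - 1))) \<cdot>\<^sub>m asym_proj d"
proof -
  define M where "M = 1\<^sub>m (d * d) - swap_op d"
  have M: "M \<in> carrier_mat (d * d) (d * d)" by (simp add: M_def minus_carrier_mat)
  have k: "1 / (complex_of_nat d * (complex_of_nat d - 1)) * x
      = complex_of_real (2 / (real d * (real d - 1))) * (complex_of_real (1 / 2) * x)" for x
    by (simp add: divide_simps)
  show ?thesis unfolding antisymmetric_state_def asym_proj_def M_def[symmetric]
    by (rule eq_matI) (use carrier_matD[OF M] in \<open>simp_all only: index_smult_mat k\<close>)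
qed

lemma psd_antisymmetric_power:
  assumes "2 \<le> d"
  shows "psd (d ^ n * d ^ n) (bip_power d d (antisymmetric_state d) n)"
proof -
  have "bip_power d d (antisymmetric_state d) n = complex_of_real ((2 / (real d * (real d - 1))) ^ n) \<cdot>\<^sub>m bip_power d d (asym_proj d) n"
    unfolding antisymmetric_state_eq[OF assms] bip_power_smult[OF asym_proj_carrier] of_real_power ..
  then show ?thesis using psd_smult[OF psd_projection[OF asym_power_projection[of d n]], of "(2 / (real d * (real d - 1))) ^ n"] assms by simp
qed

lemma mtrace_antisymmetric_power: "2 \<le> d \<Longrightarrow> mtrace (bip_power d d (antisymmetric_state d) n) = 1"
  by (simp add: mtrace_bip_power mtrace_antisymmetric_state)

lemma antisymmetric_overlap_separable:
  assumes "\<tau> \<in> separable (d ^ n) (d ^ n)"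
  shows "Re (mtrace (bip_power d d (asym_proj d) n * \<tau>)) \<le> sqrt ((3 / 4) ^ n)"
  using sep_cone_mono[OF bip_power_carrier separable_sep_cone(1)[OF assms] antisymmetric_overlap_pure_product] separable_sep_cone(2)[OF assms] by simp

section \<open>Dually non-entangling maps and separable functionals\<close>

lemma DNE_D:
  assumes "\<Xi> \<in> DNE \<delta> a b a' b'"
  shows "linear_map (a * b) (a' * b') \<Xi>"
    and "X \<in> carrier_mat (a * b) (a * b) \<Longrightarrow> \<Xi> X \<in> carrier_mat (a' * b') (a' * b')"
    and "X \<in> carrier_mat (a * b) (a * b) \<Longrightarrow> \<Xi> (c \<cdot>\<^sub>m X) = c \<cdot>\<^sub>m \<Xi> X"
    and "psd (a * b) X \<Longrightarrow> psd (a' * b') (\<Xi> X)"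
    and "X \<in> carrier_mat (a * b) (a * b) \<Longrightarrow> mtrace (\<Xi> X) = mtrace X"
    and "\<sigma> \<in> separable a b \<Longrightarrow> robustness a' b' (\<Xi> \<sigma>) \<le> \<delta>"
    and "\<sigma> \<in> separable a' b' \<Longrightarrow> sep_cone a b (adjoint_map (a * b) \<Xi> \<sigma>)"
proof -
  have cp: "completely_positive (a * b) (a' * b') \<Xi>" and tp: "trace_preserving (a * b) \<Xi>"
    and r: "\<forall>\<sigma> \<in> separable a b. robustness a' b' (\<Xi> \<sigma>) \<le> \<delta>"
    and ad: "adjoint_map (a * b) \<Xi> ` separable a' b' \<subseteq> cone (separable a b)"
    using assms by (simp_all add: DNE_def)
  show lin: "linear_map (a * b) (a' * b') \<Xi>" using cp by (simp add: completely_positive_def)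
  show "X \<in> carrier_mat (a * b) (a * b) \<Longrightarrow> \<Xi> X \<in> carrier_mat (a' * b') (a' * b')" using lin by (simp add: linear_map_def)
  show "X \<in> carrier_mat (a * b) (a * b) \<Longrightarrow> \<Xi> (c \<cdot>\<^sub>m X) = c \<cdot>\<^sub>m \<Xi> X" using lin by (simp add: linear_map_def)
  show "psd (a * b) X \<Longrightarrow> psd (a' * b') (\<Xi> X)" by (rule completely_positive_psd[OF cp])
  show "X \<in> carrier_mat (a * b) (a * b) \<Longrightarrow> mtrace (\<Xi> X) = mtrace X" using tp by (simp add: trace_preserving_def)
  show "\<sigma> \<in> separable a b \<Longrightarrow> robustness a' b' (\<Xi> \<sigma>) \<le> \<delta>" using r by blast
  assume "\<sigma> \<in> separable a' b'"
  then have "adjoint_map (a * b) \<Xi> \<sigma> \<in> cone (separable a b)" using ad by blast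
  then obtain t \<tau> where "adjoint_map (a * b) \<Xi> \<sigma> = complex_of_real t \<cdot>\<^sub>m \<tau>" "0 \<le> t" "\<tau> \<in> separable a b"
    unfolding cone_def by blast
  then show "sep_cone a b (adjoint_map (a * b) \<Xi> \<sigma>)" using sep_cone_smult[OF separable_sep_cone(1)] by simp
qed

text \<open>The robustness condition puts the image of a separable state below \<open>1 + r\<close>
  times a separable state, with \<open>r\<close> as close to \<delta> as desired or smaller, and a
  positive \<open>M\<close> respects this order.\<close>

lemma DNE_separable_functional:
  assumes \<Xi>: "\<Xi> \<in> DNE \<delta> a b a' b'" and \<sigma>: "\<sigma> \<in> separable a b" and pos: "0 < a'" "0 < b'"
    and M: "psd (a' * b') M" and le: "\<And>\<tau>. \<tau> \<in> separable a' b' \<Longrightarrow> Re (mtrace (M * \<tau>)) \<le> c"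
  shows "Re (mtrace (M * \<Xi> \<sigma>)) \<le> (1 + \<delta>) * c"
proof -
  have \<sigma>p: "psd (a * b) \<sigma>" by (rule sep_cone_psd[OF separable_sep_cone(1)[OF \<sigma>]])
  have p: "psd (a' * b') (\<Xi> \<sigma>)" by (rule DNE_D(4)[OF \<Xi> \<sigma>p])
  have t: "mtrace (\<Xi> \<sigma>) = 1" using DNE_D(5)[OF \<Xi> psd_carrier[OF \<sigma>p]] separable_sep_cone(2)[OF \<sigma>] by simp
  have Mc: "M \<in> carrier_mat (a' * b') (a' * b')" by (rule psd_carrier[OF M])
  have c0: "0 \<le> c"
    using le[OF maximally_mixed_separable[OF pos]] mtrace_psd_mult_nonneg[OF M sep_cone_psd[OF separable_sep_cone(1)[OF maximally_mixed_separable[OF pos]]]]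
    by linarith
  have "Re (mtrace (M * \<Xi> \<sigma>)) \<le> (1 + \<delta>) * c + e" if e: "0 < e" for e
  proof -
    \<comment> \<open>Dividing by \<open>c + 1\<close> instead of \<open>c\<close> keeps the slack
      defined for \<open>c = 0\<close> and its product with \<open>c\<close> below
      \<open>e\<close>.\<close>
    have e': "0 < e / (c + 1)" using e c0 by simp
    obtain r \<tau> where r: "0 \<le> r" "r \<le> \<delta> + e / (c + 1)" and \<tau>: "\<tau> \<in> separable a' b'"
      and lo: "loewner_le (a' * b') (\<Xi> \<sigma>) (complex_of_real (1 + r) \<cdot>\<^sub>m \<tau>)"
      by (rule robustness_witness[OF pos p t DNE_D(6)[OF \<Xi> \<sigma>] e'])
    have "Re (mtrace (M * \<Xi> \<sigma>)) \<le> Re (mtrace (M * (complex_of_real (1 + r) \<cdot>\<^sub>m \<tau>)))"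
      by (rule mtrace_loewner_mono[OF M lo])
    also have "\<dots> = (1 + r) * Re (mtrace (M * \<tau>))"
      unfolding mtrace_mult_smult[OF Mc sep_cone_carrier[OF separable_sep_cone(1)[OF \<tau>]]] by simp
    also have "\<dots> \<le> (1 + r) * c" using le[OF \<tau>] r by (intro mult_left_mono) simp_all
    also have "\<dots> \<le> (1 + (\<delta> + e / (c + 1))) * c" using r c0 by (intro mult_right_mono) simp_all
    also have "\<dots> = (1 + \<delta>) * c + e * (c / (c + 1))" by (simp add: algebra_simps)
    also have "\<dots> \<le> (1 + \<delta>) * c + e * 1" using e c0 by (intro add_left_mono mult_left_mono) simp_all
    finally show ?thesis by simp
  qed
  then show ?thesis by (rule field_le_epsilon)
qed

lemma sep_cone_normalize:
  assumes "sep_cone a b S" "mtrace S = complex_of_real t" "0 < t" "0 < a" "0 < b"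
  shows "complex_of_real (1 / t) \<cdot>\<^sub>m S \<in> separable a b" "S = complex_of_real t \<cdot>\<^sub>m (complex_of_real (1 / t) \<cdot>\<^sub>m S)"
proof -
  have S: "S \<in> carrier_mat (a * b) (a * b)" by (rule sep_cone_carrier[OF assms(1)])
  show "complex_of_real (1 / t) \<cdot>\<^sub>m S \<in> separable a b"
    by (rule sep_cone_separable[OF sep_cone_smult[OF assms(1)] assms(4,5)]) (use assms(2,3) mtrace_smult[OF S] in simp_all)
  show "S = complex_of_real t \<cdot>\<^sub>m (complex_of_real (1 / t) \<cdot>\<^sub>m S)"
    by (rule eq_matI) (use S assms(3) in simp_all)
qed

lemma one_shot_cost_bound:
  assumes d: "2 \<le> d" and \<Lambda>: "\<Lambda> \<in> DNE \<delta> (2 ^ m) (2 ^ m) (d ^ n) (d ^ n)"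
  shows "1 - trace_norm (\<Lambda> (max_entangled m) - bip_power d d (antisymmetric_state d) n) \<le> 2 ^ m * ((1 + \<delta>) * sqrt ((3 / 4) ^ n))"
proof -
  let ?K = "2 ^ m :: nat" and ?N = "d ^ n"
  let ?W = "bip_power d d (asym_proj d) n" and ?\<rho> = "bip_power d d (antisymmetric_state d) n"
  have N: "0 < ?N" using d by simp
  have Wp: "psd (?N * ?N) ?W" by (rule psd_projection[OF asym_power_projection])
  have Wc: "?W \<in> carrier_mat (?N * ?N) (?N * ?N)" by simp
  have W\<rho>: "mtrace (?W * ?\<rho>) = 1"
    by (simp add: bip_power_mult asym_proj_antisymmetric_state mtrace_antisymmetric_power[OF d])
  define \<sigma> where "\<sigma> = complex_of_real (1 / real ?K) \<cdot>\<^sub>m classical ?K"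
  have \<sigma>: "\<sigma> \<in> separable ?K ?K" "classical ?K = complex_of_real (real ?K) \<cdot>\<^sub>m \<sigma>"
    unfolding \<sigma>_def by (rule sep_cone_normalize[OF sep_cone_classical]; simp add: mtrace_classical)+
  have \<sigma>c: "\<sigma> \<in> carrier_mat (?K * ?K) (?K * ?K)" by (rule sep_cone_carrier[OF separable_sep_cone(1)[OF \<sigma>(1)]])
  let ?D = "classical ?K - max_entangled m"
  have D: "psd (?K * ?K) ?D" using max_entangled_le_classical[of m] by (simp add: loewner_le_def)
  have Dc: "?D \<in> carrier_mat (?K * ?K) (?K * ?K)" by (rule psd_carrier[OF D])
  \<comment> \<open>The order is carried through \<Lambda> by this sum: linearity is stated for
    sums, and the positive difference has a positive image.\<close>
  have "classical ?K = max_entangled m + ?D" by (rule eq_matI) (use carrier_matD[OF max_entangled_carrier, of m] carrier_matD[OF classical_carrier, of ?K] in simp_all)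
  then have "\<Lambda> (classical ?K) = \<Lambda> (max_entangled m) + \<Lambda> ?D"
    using DNE_D(1)[OF \<Lambda>] max_entangled_carrier[of m] Dc unfolding linear_map_def by metis
  then have split: "mtrace (?W * \<Lambda> (classical ?K)) = mtrace (?W * \<Lambda> (max_entangled m)) + mtrace (?W * \<Lambda> ?D)"
    using mtrace_mult_add[OF Wc DNE_D(2)[OF \<Lambda> max_entangled_carrier] DNE_D(2)[OF \<Lambda> Dc]] by simp
  have "1 - trace_norm (\<Lambda> (max_entangled m) - ?\<rho>) \<le> Re (mtrace (?W * \<Lambda> (max_entangled m)))"
    by (rule trace_norm_lower[OF projection_contraction[OF asym_power_projection] DNE_D(2)[OF \<Lambda> max_entangled_carrier] bip_power_carrier W\<rho>])
  also have "\<dots> \<le> Re (mtrace (?W * \<Lambda> (classical ?K)))"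
    using split mtrace_psd_mult_nonneg[OF Wp DNE_D(4)[OF \<Lambda> D]] by simp
  also have "\<dots> = 2 ^ m * Re (mtrace (?W * \<Lambda> \<sigma>))"
    unfolding \<sigma>(2) DNE_D(3)[OF \<Lambda> \<sigma>c] mtrace_mult_smult[OF Wc DNE_D(2)[OF \<Lambda> \<sigma>c]] by simp
  also have "\<dots> \<le> 2 ^ m * ((1 + \<delta>) * sqrt ((3 / 4) ^ n))"
    by (intro mult_left_mono DNE_separable_functional[OF \<Lambda> \<sigma>(1) N N Wp antisymmetric_overlap_separable]) simp_all
  finally show ?thesis .
qed

text \<open>The test operator is moved to the input as a separable \<open>Z\<close>. There the
  antisymmetric power may be exchanged for the larger separable majorant, and moving back leaves the
  image of a separable state, on which G has bounded expectation.\<close>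

lemma one_shot_distillation_bound:
  assumes d: "2 \<le> d" and \<Theta>: "\<Theta> \<in> DNE \<delta> (d ^ n) (d ^ n) (2 ^ m) (2 ^ m)"
  shows "2 ^ m * (1 - trace_norm (\<Theta> (bip_power d d (antisymmetric_state d) n) - max_entangled m)) \<le> (1 + 2 / real d) ^ n * ((1 + \<delta>) * 2)"
proof -
  let ?K = "2 ^ m :: nat" and ?N = "d ^ n"
  let ?\<rho> = "bip_power d d (antisymmetric_state d) n" and ?S = "bip_power d d (majorant d) n"
  have K: "0 < ?K" and N: "0 < ?N" using d by simp_all
  have \<rho>: "psd (?N * ?N) ?\<rho>" by (rule psd_antisymmetric_power[OF d])
  have \<rho>c: "?\<rho> \<in> carrier_mat (?N * ?N) (?N * ?N)" and Sc: "?S \<in> carrier_mat (?N * ?N) (?N * ?N)" by simp_all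
  have \<Theta>\<rho>: "psd (?K * ?K) (\<Theta> ?\<rho>)" by (rule DNE_D(4)[OF \<Theta> \<rho>])
  have \<Theta>\<rho>c: "\<Theta> ?\<rho> \<in> carrier_mat (?K * ?K) (?K * ?K)" by (rule psd_carrier[OF \<Theta>\<rho>])
  have Gp: "psd (?K * ?K) (sep_test ?K)" by (rule sep_cone_psd[OF sep_cone_sep_test])
  let ?C = "1 + 2 / real d"
  have sd: "majorant d \<in> carrier_mat (d * d) (d * d)" by (simp add: majorant_def)
  define \<sigma> where "\<sigma> = complex_of_real (1 / ?C ^ n) \<cdot>\<^sub>m ?S"
  have "mtrace ?S = complex_of_real (?C ^ n)" by (simp add: mtrace_bip_power[OF sd] mtrace_majorant[OF d])
  then have \<sigma>: "\<sigma> \<in> separable ?N ?N" "?S = complex_of_real (?C ^ n) \<cdot>\<^sub>m \<sigma>"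
    unfolding \<sigma>_def by (rule sep_cone_normalize[OF sep_cone_bip_power[OF sep_cone_majorant[OF d]] _ _ N N]; simp add: add_pos_nonneg)+
  have \<sigma>c: "\<sigma> \<in> carrier_mat (?N * ?N) (?N * ?N)" by (rule sep_cone_carrier[OF separable_sep_cone(1)[OF \<sigma>(1)]])
  \<comment> \<open>The adjoint condition speaks of states, so G is divided by its trace, the square
    of K; the factor returns in \<open>adj\<close>.\<close>
  define \<tau> where "\<tau> = complex_of_real (1 / (real ?K)\<^sup>2) \<cdot>\<^sub>m sep_test ?K"
  have \<tau>: "\<tau> \<in> separable ?K ?K" "sep_test ?K = complex_of_real ((real ?K)\<^sup>2) \<cdot>\<^sub>m \<tau>"
    unfolding \<tau>_def by (rule sep_cone_normalize[OF sep_cone_sep_test mtrace_sep_test _ K K]; simp)+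
  have \<tau>c: "\<tau> \<in> carrier_mat (?K * ?K) (?K * ?K)" by (rule sep_cone_carrier[OF separable_sep_cone(1)[OF \<tau>(1)]])
  define Z where "Z = adjoint_map (?N * ?N) \<Theta> \<tau>"
  have Z: "sep_cone ?N ?N Z" unfolding Z_def by (rule DNE_D(7)[OF \<Theta> \<tau>(1)])
  note Zc = sep_cone_carrier[OF Z]
  have adj: "mtrace (sep_test ?K * \<Theta> Y) = complex_of_real ((real ?K)\<^sup>2) * mtrace (Y * Z)" if Y: "Y \<in> carrier_mat (?N * ?N) (?N * ?N)" for Y
  proof -
    have "mtrace (sep_test ?K * \<Theta> Y) = complex_of_real ((real ?K)\<^sup>2) * mtrace (\<tau> * \<Theta> Y)"
      by (subst \<tau>(2)) (rule mtrace_smult_mult[OF \<tau>c DNE_D(2)[OF \<Theta> Y]])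
    also have "mtrace (\<tau> * \<Theta> Y) = mtrace (Z * Y)" unfolding Z_def by (rule adjoint_map_props(2)[OF DNE_D(1)[OF \<Theta>] \<tau>c Y])
    also have "\<dots> = mtrace (Y * Z)" by (rule mtrace_commute[OF Zc Y])
    finally show ?thesis .
  qed
  have le: "Re (mtrace (?\<rho> * Z)) \<le> Re (mtrace (?S * Z))"
  proof -
    have diff: "mtrace ((?\<rho> - ?S) * A) = mtrace (?\<rho> * A) - mtrace (?S * A)" if A: "A \<in> carrier_mat (?N * ?N) (?N * ?N)" for A
      using mtrace_mult_diff[OF A \<rho>c Sc] mtrace_commute[OF A \<rho>c] mtrace_commute[OF A Sc] mtrace_commute[OF A minus_carrier_mat[OF Sc]] by simp
    \<comment> \<open>The comparison on product vectors, extended to the cone with bound 0.\<close>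
    have "Re (mtrace ((?\<rho> - ?S) * Z)) \<le> 0 * Re (mtrace Z)"
      by (rule sep_cone_mono[OF minus_carrier_mat[OF Sc] Z])
         (use antisymmetric_le_majorant_pure_product[OF d, of n] in \<open>simp add: diff[OF pure_product_carrier]\<close>)
    then show ?thesis by (simp add: diff[OF Zc])
  qed
  have "1 - trace_norm (\<Theta> ?\<rho> - max_entangled m) \<le> Re (mtrace (max_entangled m * \<Theta> ?\<rho>))"
    by (rule trace_norm_lower[OF projection_contraction[OF max_entangled_projection] \<Theta>\<rho>c max_entangled_carrier])
       (simp add: max_entangled_projection mtrace_max_entangled)
  then have "2 ^ m * (1 - trace_norm (\<Theta> ?\<rho> - max_entangled m)) \<le> 2 ^ m * Re (mtrace (max_entangled m * \<Theta> ?\<rho>))" by simp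
  also have "\<dots> = Re (mtrace (\<Theta> ?\<rho> * (complex_of_real (2 ^ m) \<cdot>\<^sub>m max_entangled m)))"
    unfolding mtrace_mult_smult[OF \<Theta>\<rho>c max_entangled_carrier] mtrace_commute[OF max_entangled_carrier \<Theta>\<rho>c] by (simp del: of_real_power)
  also have "\<dots> \<le> Re (mtrace (\<Theta> ?\<rho> * sep_test ?K))"
    by (rule mtrace_loewner_mono[OF \<Theta>\<rho> sep_test_ge_max_entangled])
  also have "\<dots> = Re (mtrace (sep_test ?K * \<Theta> ?\<rho>))" unfolding mtrace_commute[OF \<Theta>\<rho>c sep_test_carrier] ..
  also have "\<dots> = (real ?K)\<^sup>2 * Re (mtrace (?\<rho> * Z))" unfolding adj[OF \<rho>c] by (simp del: of_real_power)
  also have "\<dots> \<le> (real ?K)\<^sup>2 * Re (mtrace (?S * Z))" using le by (intro mult_left_mono) simp_all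
  also have "\<dots> = Re (mtrace (sep_test ?K * \<Theta> ?S))" unfolding adj[OF Sc] by (simp del: of_real_power)
  also have "\<dots> = ?C ^ n * Re (mtrace (sep_test ?K * \<Theta> \<sigma>))"
    unfolding \<sigma>(2) DNE_D(3)[OF \<Theta> \<sigma>c] mtrace_mult_smult[OF sep_test_carrier DNE_D(2)[OF \<Theta> \<sigma>c]] by (simp del: of_real_power)
  also have "\<dots> \<le> ?C ^ n * ((1 + \<delta>) * 2)"
  proof (intro mult_left_mono DNE_separable_functional[OF \<Theta> \<sigma>(1) K K Gp])
    fix \<omega> assume "\<omega> \<in> separable ?K ?K"
    from sep_cone_mono[OF sep_test_carrier separable_sep_cone(1)[OF this] sep_test_pure_product_le] separable_sep_cone(2)[OF this]
    show "Re (mtrace (sep_test ?K * \<omega>)) \<le> 2" by simp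
  qed simp
  finally show ?thesis .
qed

section \<open>Limits in the error\<close>

lemma tendsto_at_right_mono:
  fixes f :: "real \<Rightarrow> ereal"
  assumes "\<And>x y. 0 < x \<Longrightarrow> x \<le> y \<Longrightarrow> f x \<le> f y"
  shows "(f \<longlongrightarrow> (INF x\<in>{0<..}. f x)) (at_right 0)"
proof (rule order_tendstoI)
  fix a assume "a < (INF x\<in>{0<..}. f x)"
  then have "a < f x" if "0 < x" for x using that by (meson INF_lower greaterThan_iff less_le_trans)
  then show "\<forall>\<^sub>F x in at_right 0. a < f x"
    unfolding eventually_at_right_field by (intro exI[of _ 1]) simp
next
  fix a assume "(INF x\<in>{0<..}. f x) < a"
  then obtain x0 where x0: "0 < x0" "f x0 < a" by (auto simp: INF_less_iff)
  then have "f x < a" if "0 < x" "x < x0" for x using assms[of x x0] that by simp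
  then show "\<forall>\<^sub>F x in at_right 0. f x < a" using x0(1) by (auto simp: eventually_at_right)
qed

lemma tendsto_at_right_antimono:
  fixes f :: "real \<Rightarrow> ereal"
  assumes "\<And>x y. 0 < x \<Longrightarrow> x \<le> y \<Longrightarrow> f y \<le> f x"
  shows "(f \<longlongrightarrow> (SUP x\<in>{0<..}. f x)) (at_right 0)"
proof (rule order_tendstoI)
  fix a assume "(SUP x\<in>{0<..}. f x) < a"
  then have "f x < a" if "0 < x" for x using that by (meson SUP_upper greaterThan_iff le_less_trans)
  then show "\<forall>\<^sub>F x in at_right 0. f x < a"
    unfolding eventually_at_right_field by (intro exI[of _ 1]) simp
next
  fix a assume "a < (SUP x\<in>{0<..}. f x)"
  then obtain x0 where x0: "0 < x0" "a < f x0" by (auto simp: less_SUP_iff)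
  then have "a < f x" if "0 < x" "x < x0" for x using assms[of x x0] that by (meson less_eq_real_def less_le_trans)
  then show "\<forall>\<^sub>F x in at_right 0. a < f x" using x0(1) by (auto simp: eventually_at_right)
qed

lemma ereal_divide_nat_mono: "x \<le> y \<Longrightarrow> x / ereal (real n) \<le> y / ereal (real n)"
  unfolding divide_ereal_def by (rule ereal_mult_right_mono) simp_all

text \<open>\<open>Lim\<close> is a definite description, so convergence has to be shown: the rate
  at fixed error grows with the error, and the limit is the infimum. One fixed error, here 1/8, then
  bounds it.\<close>

lemma distillable_rate_le:
  assumes "\<And>n. distillable_one_shot (\<delta> n) (1 / 8) (a ^ n) (b ^ n) (bip_power a b \<rho> n) \<le> ereal (A + real n * L)"
  shows "distillable_rate \<delta> a b \<rho> \<le> ereal L"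
proof -
  define f where "f = (\<lambda>\<epsilon>::real. liminf (\<lambda>n. distillable_one_shot (\<delta> n) \<epsilon> (a ^ n) (b ^ n) (bip_power a b \<rho> n) / ereal (real n)))"
  have "f x \<le> f y" if "x \<le> y" for x y
    unfolding f_def
  proof (intro Liminf_mono always_eventually allI ereal_divide_nat_mono)
    fix n show "distillable_one_shot (\<delta> n) x (a ^ n) (b ^ n) (bip_power a b \<rho> n) \<le> distillable_one_shot (\<delta> n) y (a ^ n) (b ^ n) (bip_power a b \<rho> n)"
      unfolding distillable_one_shot_def by (rule Sup_subset_mono) (use that in force)
  qed
  then have "(f \<longlongrightarrow> (INF x\<in>{0<..}. f x)) (at_right 0)" by (intro tendsto_at_right_mono) simp
  then have "distillable_rate \<delta> a b \<rho> = (INF x\<in>{0<..}. f x)"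
    unfolding distillable_rate_def f_def by (intro tendsto_Lim) simp_all
  also have "\<dots> \<le> f (1 / 8)" by (rule INF_lower) simp
  also have "\<dots> \<le> liminf (\<lambda>n. ereal (A / real n + L))"
    unfolding f_def
  proof (rule Liminf_mono, rule eventually_sequentiallyI[of 1])
    fix n :: nat assume n: "1 \<le> n"
    have "distillable_one_shot (\<delta> n) (1 / 8) (a ^ n) (b ^ n) (bip_power a b \<rho> n) / ereal (real n) \<le> ereal (A + real n * L) / ereal (real n)"
      by (rule ereal_divide_nat_mono[OF assms])
    also have "\<dots> = ereal (A / real n + L)" using n by (simp add: add_divide_distrib)
    finally show "distillable_one_shot (\<delta> n) (1 / 8) (a ^ n) (b ^ n) (bip_power a b \<rho> n) / ereal (real n) \<le> ereal (A / real n + L)" .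
  qed
  also have "\<dots> = ereal L"
  proof (rule lim_imp_Liminf)
    have "(\<lambda>n. A / real n + L) \<longlonglongrightarrow> 0 + L" by (intro tendsto_intros lim_const_over_n)
    then show "(\<lambda>n. ereal (A / real n + L)) \<longlonglongrightarrow> ereal L" by simp
  qed simp
  finally show ?thesis .
qed

text \<open>Mirror image of the distillation case: the cost falls as the error grows, so the limit
  is a supremum and the value at error 1/8 lies below it.\<close>

lemma cost_rate_ge:
  assumes "\<And>n. ereal (real n * L - A) \<le> cost_one_shot (\<delta> n) (1 / 8) (a ^ n) (b ^ n) (bip_power a b \<rho> n)"
  shows "ereal L \<le> cost_rate \<delta> a b \<rho>"
proof -
  define f where "f = (\<lambda>\<epsilon>::real. limsup (\<lambda>n. cost_one_shot (\<delta> n) \<epsilon> (a ^ n) (b ^ n) (bip_power a b \<rho> n) / ereal (real n)))"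
  have "f y \<le> f x" if "x \<le> y" for x y
    unfolding f_def
  proof (intro Limsup_mono always_eventually allI ereal_divide_nat_mono)
    fix n show "cost_one_shot (\<delta> n) y (a ^ n) (b ^ n) (bip_power a b \<rho> n) \<le> cost_one_shot (\<delta> n) x (a ^ n) (b ^ n) (bip_power a b \<rho> n)"
      unfolding cost_one_shot_def by (rule Inf_superset_mono) (use that in force)
  qed
  then have "(f \<longlongrightarrow> (SUP x\<in>{0<..}. f x)) (at_right 0)" by (intro tendsto_at_right_antimono) simp
  then have rate: "cost_rate \<delta> a b \<rho> = (SUP x\<in>{0<..}. f x)"
    unfolding cost_rate_def f_def by (intro tendsto_Lim) simp_all
  have "ereal L = limsup (\<lambda>n. ereal (L - A / real n))"
  proof (rule lim_imp_Limsup[symmetric])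
    have "(\<lambda>n. L - A / real n) \<longlonglongrightarrow> L - 0" by (intro tendsto_intros lim_const_over_n)
    then show "(\<lambda>n. ereal (L - A / real n)) \<longlonglongrightarrow> ereal L" by simp
  qed simp
  also have "\<dots> \<le> f (1 / 8)"
    unfolding f_def
  proof (rule Limsup_mono, rule eventually_sequentiallyI[of 1])
    fix n :: nat assume n: "1 \<le> n"
    have "ereal (L - A / real n) = ereal (real n * L - A) / ereal (real n)" using n by (simp add: diff_divide_distrib)
    also have "\<dots> \<le> cost_one_shot (\<delta> n) (1 / 8) (a ^ n) (b ^ n) (bip_power a b \<rho> n) / ereal (real n)"
      by (rule ereal_divide_nat_mono[OF assms])
    finally show "ereal (L - A / real n) \<le> cost_one_shot (\<delta> n) (1 / 8) (a ^ n) (b ^ n) (bip_power a b \<rho> n) / ereal (real n)" .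
  qed
  also have "\<dots> \<le> (SUP x\<in>{0<..}. f x)" by (rule SUP_upper) simp
  finally show ?thesis unfolding rate .
qed

text \<open>The infimum may fail to be attained, hence the strictly larger \<open>c'\<close>; on the
  empty set it would be an unspecified number.\<close>

lemma INF_le_witness:
  fixes f :: "'a \<Rightarrow> real"
  assumes "(INF x\<in>A. f x) \<le> c" "c < c'" "A \<noteq> {}"
  obtains x where "x \<in> A" "f x < c'"
proof -
  have "Inf (f ` A) < c'" using assms by simp
  from cInf_lessD[OF _ this] assms(3) that show ?thesis by blast
qed

text \<open>A uniform bound \<open>D\<close> turns the factors \<open>1 + \<delta> n\<close> into
  one constant, which disappears from the rate on division by \<open>n\<close>.\<close>

lemma null_sequence_bounded:
  assumes "\<delta> \<in> null_sequences"
  obtains D where "0 \<le> D" "\<forall>n. 0 \<le> \<delta> n" "\<forall>n. \<delta> n \<le> D"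
proof -
  have nn: "0 \<le> \<delta> n" for n using assms by (simp add: null_sequences_def)
  have "Bseq \<delta>" using assms by (auto simp: null_sequences_def intro: convergent_imp_Bseq convergentI)
  then obtain D where "0 < D" "\<And>n. norm (\<delta> n) \<le> D" by (auto elim: BseqE)
  then show ?thesis using that[of D] nn by simp
qed

section \<open>The two rates and the gap\<close>

lemma distillable_antisymmetric:
  assumes d: "2 \<le> d" and \<delta>: "\<delta> \<in> null_sequences"
  shows "distillable_rate \<delta> d d (antisymmetric_state d) \<le> ereal (log 2 (1 + 2 / real d))"
proof -
  obtain D where D: "0 \<le> D" "\<forall>n. 0 \<le> \<delta> n" "\<forall>n. \<delta> n \<le> D" by (rule null_sequence_bounded[OF \<delta>])
  let ?C = "1 + 2 / real d"
  have C: "0 < ?C" by (simp add: add_pos_nonneg)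
  show ?thesis
  proof (rule distillable_rate_le)
    fix n
    let ?\<rho> = "bip_power d d (antisymmetric_state d) n"
    show "distillable_one_shot (\<delta> n) (1 / 8) (d ^ n) (d ^ n) ?\<rho> \<le> ereal (log 2 (4 * (1 + D)) + real n * log 2 ?C)"
      unfolding distillable_one_shot_def
    proof (rule Sup_least, clarify)
      fix m assume "(INF \<Theta>\<in>DNE (\<delta> n) (d ^ n) (d ^ n) (2 ^ m) (2 ^ m). 1 / 2 * trace_norm (\<Theta> ?\<rho> - bip_power 2 2 Phi2 m)) \<le> 1 / 8"
      \<comment> \<open>From an infimum of at most 1/8 to a map with error below 1/4: its trace norm
        distance is below 1/2, so at least half of the acceptance probability remains.\<close>
      then obtain \<Theta> where \<Theta>: "\<Theta> \<in> DNE (\<delta> n) (d ^ n) (d ^ n) (2 ^ m) (2 ^ m)" and t: "1 / 2 * trace_norm (\<Theta> ?\<rho> - max_entangled m) < 1 / 4"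
        unfolding max_entangled_def by (rule INF_le_witness[where c' = "1 / 4"]) (use d D DNE_nonempty in auto)
      have "2 ^ m * (1 / 2) \<le> 2 ^ m * (1 - trace_norm (\<Theta> ?\<rho> - max_entangled m))"
        using t by (intro mult_left_mono) simp_all
      also have "\<dots> \<le> ?C ^ n * ((1 + \<delta> n) * 2)" by (rule one_shot_distillation_bound[OF d \<Theta>])
      also have "\<dots> \<le> ?C ^ n * ((1 + D) * 2)" using D C by (intro mult_left_mono mult_right_mono) simp_all
      \<comment> \<open>The constant 4 is the bound 2 on the expectation of G, divided by the
        remaining acceptance probability 1/2.\<close>
      finally have "2 powr real m \<le> 4 * (1 + D) * ?C ^ n" by (simp add: powr_realpow algebra_simps)
      then have "real m \<le> log 2 (4 * (1 + D) * ?C ^ n)" using D C by (subst le_log_iff) simp_all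
      also have "\<dots> = log 2 (4 * (1 + D)) + real n * log 2 ?C" using D C by (simp add: log_mult log_nat_power)
      finally show "ereal (real m) \<le> ereal (log 2 (4 * (1 + D)) + real n * log 2 ?C)" by simp
    qed
  qed
qed

lemma cost_antisymmetric:
  assumes d: "2 \<le> d" and \<delta>: "\<delta> \<in> null_sequences"
  shows "ereal (1 / 2 * log 2 (4 / 3)) \<le> cost_rate \<delta> d d (antisymmetric_state d)"
proof -
  obtain D where D: "0 \<le> D" "\<forall>n. 0 \<le> \<delta> n" "\<forall>n. \<delta> n \<le> D" by (rule null_sequence_bounded[OF \<delta>])
  show ?thesis
  proof (rule cost_rate_ge)
    fix n
    let ?\<rho> = "bip_power d d (antisymmetric_state d) n"
    define c where "c = sqrt ((3 / 4) ^ n)"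
    have c: "0 < c" by (simp add: c_def)
    have lc: "log 2 c = - (real n * (1 / 2 * log 2 (4 / 3)))"
    proof -
      have "log 2 (4 / 3) = - log 2 (3 / 4 :: real)" by (simp add: log_def ln_div diff_divide_distrib)
      moreover have "log 2 c = 1 / 2 * (real n * log 2 (3 / 4))"
        unfolding c_def by (simp add: log_def ln_sqrt ln_realpow)
      ultimately show ?thesis by simp
    qed
    show "ereal (real n * (1 / 2 * log 2 (4 / 3)) - log 2 (2 * (1 + D))) \<le> cost_one_shot (\<delta> n) (1 / 8) (d ^ n) (d ^ n) ?\<rho>"
      unfolding cost_one_shot_def
    proof (rule Inf_greatest, clarify)
      fix m assume "(INF \<Lambda>\<in>DNE (\<delta> n) (2 ^ m) (2 ^ m) (d ^ n) (d ^ n). 1 / 2 * trace_norm (\<Lambda> (bip_power 2 2 Phi2 m) - ?\<rho>)) \<le> 1 / 8"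
      then obtain \<Lambda> where \<Lambda>: "\<Lambda> \<in> DNE (\<delta> n) (2 ^ m) (2 ^ m) (d ^ n) (d ^ n)" and t: "1 / 2 * trace_norm (\<Lambda> (max_entangled m) - ?\<rho>) < 1 / 4"
        unfolding max_entangled_def by (rule INF_le_witness[where c' = "1 / 4"]) (use d D DNE_nonempty in auto)
      have "1 / 2 \<le> 1 - trace_norm (\<Lambda> (max_entangled m) - ?\<rho>)" using t by simp
      also have "\<dots> \<le> 2 ^ m * ((1 + \<delta> n) * c)" unfolding c_def by (rule one_shot_cost_bound[OF d \<Lambda>])
      also have "\<dots> \<le> 2 ^ m * ((1 + D) * c)" using D c by (intro mult_left_mono mult_right_mono) simp_all
      finally have "1 \<le> 2 ^ m * (2 * (1 + D) * c)" by (simp add: algebra_simps)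
      then have "log 2 1 \<le> log 2 (2 ^ m * (2 * (1 + D) * c))" using D c by (subst log_le_cancel_iff) simp_all
      also have "\<dots> = real m + (log 2 (2 * (1 + D)) + log 2 c)" using D c by (simp add: log_mult log_nat_power)
      finally show "ereal (real n * (1 / 2 * log 2 (4 / 3)) - log 2 (2 * (1 + D))) \<le> ereal (real m)" unfolding lc by simp
    qed
  qed
qed

text \<open>The value at d = 13 is \<open>(15 / 13)^2 = 225 / 169\<close>, just below
  \<open>4 / 3\<close>; at d = 12 it would be \<open>49 / 36\<close>, which is above.\<close>

lemma rate_gap:
  assumes "13 \<le> d"
  shows "log 2 (1 + 2 / real d) < 1 / 2 * log 2 (4 / 3)"
proof -
  have pos: "0 < 1 + 2 / real d" by (simp add: add_pos_nonneg)
  have "2 / real d \<le> 2 / 13" using assms by (intro divide_left_mono) simp_all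
  then have "(1 + 2 / real d)\<^sup>2 \<le> (1 + 2 / 13)\<^sup>2" by (intro power_mono) simp_all
  also have "\<dots> < 4 / 3" by (simp add: power2_eq_square)
  finally have "log 2 ((1 + 2 / real d)\<^sup>2) < log 2 (4 / 3)"
    using pos by (subst log_less_cancel_iff) simp_all
  moreover have "log 2 ((1 + 2 / real d)\<^sup>2) = 2 * log 2 (1 + 2 / real d)"
    using log_nat_power[of "1 + 2 / real d" 2 2] by (simp add: add_pos_nonneg)
  ultimately show ?thesis by simp
qed

theorem mainTheorem4:
  fixes d :: nat
  assumes "13 \<le> d"
  shows "cost_ADNE d d (antisymmetric_state d) > distillable_ADNE d d (antisymmetric_state d)"
proof -
  have d: "2 \<le> d" using assms by simp
  have "distillable_ADNE d d (antisymmetric_state d) \<le> ereal (log 2 (1 + 2 / real d))"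
    unfolding distillable_ADNE_def by (intro SUP_least distillable_antisymmetric d)
  also have "\<dots> < ereal (1 / 2 * log 2 (4 / 3))" using rate_gap[OF assms] by simp
  also have "\<dots> \<le> cost_ADNE d d (antisymmetric_state d)"
    unfolding cost_ADNE_def by (intro INF_greatest cost_antisymmetric d)
  finally show ?thesis .
qed

end
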